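(* Let $n\ge1$, $a\in\mathbb{R}^n$, $0<\beta<1$ and $q>1+\frac1{n+\beta}$. Let $u_0:\mathbb{R}^n\to\mathbb{R}$, $u_0\in L^1(\mathbb{R}^n)\cap L^q(\mathbb{R}^n)$, satisfy $\sup_{t>0}t^{\beta/2}\|e^{t\Delta}u_0\|_1<\infty$. If $q\le 1+\frac1n$, assume in addition that $u_0\in L^\infty(\mathbb{R}^n)$ and that $\sup_{t>0}t^{\beta/2}\|e^{t\Delta}u_0\|_1<\eta$, where $\eta>0$ is a sufficiently small constant depending only on $n,\beta,q,a$ and an upper bound for $\|u_0\|_\infty$. Let $u$ be the solution of $$u_t-\Delta u+a\cdot\nabla(u|u|^{q-1})=0\ \ (x\in\mathbb{R}^n,\ t>0),\qquad u(x,0)=u_0(x).$$ (a) If $I_\beta u_0\in L^1(\mathbb{R}^n)$ and $A=\lim_{|\xi|\to0}\widehat u_0(\xi)/|\xi|^\beta=\int_{\mathbb{R}^n}(I_\beta u_0)(x)\,dx$, then for every $p\in[1,\infty]$ $$t^{(n/2)(1-1/p)+\beta/2}\,\|u(\cdot,t)-A\,D^\beta G(\cdot,t)\|_p\to0\quad\text{as }t\to\infty.$$ (b) If $\sup_{\xi\ne0}|\widehat u_0(\xi)|/|\xi|^\beta<\infty$ and $\lim_{|\xi|\to0}\widehat u_0(\xi)/|\xi|^\beta=A$ for some $A\in\mathbb{R}$, then the same convergence holds for every $p\in[2,\infty]$.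
   Context: $\|\cdot\|_p$ is the norm of $L^p(\mathbb{R}^n)$. $G(x,t)=(4\pi t)^{-n/2}\exp(-|x|^2/(4t))$ and $e^{t\Delta}u_0=G(\cdot,t)*u_0$. Fourier transform: $\widehat v(\xi)=\int_{\mathbb{R}^n}e^{-ix\cdot\xi}v(x)\,dx$, so $\widehat{G(\cdot,t)}(\xi)=e^{-t|\xi|^2}$. $D^\beta$ and $I_\beta$ are defined by $\widehat{D^\beta w}(\xi)=|\xi|^\beta\widehat w(\xi)$ and $\widehat{I_\beta w}(\xi)=\widehat w(\xi)/|\xi|^\beta$; "$I_\beta u_0\in L^1$" means that there is a function in $L^1(\mathbb{R}^n)$, denoted $I_\beta u_0$, whose Fourier transform is $\widehat u_0(\xi)/|\xi|^\beta$ for $\xi\neq0$. For every $u_0\in L^1(\mathbb{R}^n)$ the Cauchy problem has a unique solution $u\in C([0,\infty);L^1(\mathbb{R}^n))$ satisfying $u\in C((0,\infty);W^{2,p}(\mathbb{R}^n))\cap C^1((0,\infty);L^p(\mathbb{R}^n))$ for all $p\in(1,\infty)$; "the solution" means this one. It satisfies $u(t)=e^{t\Delta}u_0-\int_0^t a\cdot\nabla e^{(t-\tau)\Delta}(u|u|^{q-1})(\tau)\,d\tau$. Known facts which may be assumed: this well-posedness, and the estimate (Carlen–Loss) $\|u(\cdot,t)\|_p\le C(p,r)t^{-(n/2)(1/r-1/p)}\|u_0\|_r$ for all $1\le r\le p\le\infty$, $t>0$. *)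

theory Defs
  imports "HOL-Probability.Essential_Supremum"
begin

section \<open>Lebesgue spaces on \<open>\<real>\<^sup>n\<close>\<close>

text \<open>Elements of \<open>L\<^sup>p\<close> are represented by Borel functions; the exponent ranges over
  \<open>[1, \<infinity>]\<close>.  For a measurable function, \<open>Lp_norm p f = \<infinity>\<close> means that \<open>f\<close> is not in \<open>L\<^sup>p\<close>.\<close>

definition Lp_norm :: "ennreal \<Rightarrow> (real^'n \<Rightarrow> real) \<Rightarrow> ennreal" where
  "Lp_norm p f =
    (if p = \<infinity> then esssup lborel (\<lambda>x. ennreal \<bar>f x\<bar>)
     else let I = (\<integral>\<^sup>+x. ennreal (\<bar>f x\<bar> powr enn2real p) \<partial>lborel)
          in if I = \<infinity> then \<infinity> else ennreal (enn2real I powr (1 / enn2real p)))"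

definition Lp :: "ennreal \<Rightarrow> (real^'n \<Rightarrow> real) set" where
  "Lp p = {f. f \<in> borel_measurable lborel \<and> Lp_norm p f < \<infinity>}"

text \<open>The real number \<open>1/p\<close>, with \<open>1/\<infinity> = 0\<close>.\<close>

definition recip :: "ennreal \<Rightarrow> real" where
  "recip p = enn2real (1 / p)"

section \<open>Heat semigroup, Fourier transform, fractional derivative and integral\<close>

definition heat_kernel :: "real \<Rightarrow> real^'n \<Rightarrow> real" where
  "heat_kernel t x =
    (4 * pi * t) powr (- real CARD('n) / 2) * exp (- (norm x)\<^sup>2 / (4 * t))"

definition heat :: "real \<Rightarrow> (real^'n \<Rightarrow> real) \<Rightarrow> real^'n \<Rightarrow> real" where
  "heat t f x = (\<integral>y. heat_kernel t (x - y) * f y \<partial>lborel)"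

definition heat_decay :: "real \<Rightarrow> (real^'n \<Rightarrow> real) \<Rightarrow> ennreal" where
  "heat_decay \<beta> f = (SUP t\<in>{0<..}. ennreal (t powr (\<beta> / 2)) * Lp_norm 1 (heat t f))"

definition fourier :: "(real^'n \<Rightarrow> real) \<Rightarrow> real^'n \<Rightarrow> complex" where
  "fourier v \<xi> = (\<integral>x. exp (- \<i> * of_real (x \<bullet> \<xi>)) * of_real (v x) \<partial>lborel)"

text \<open>\<open>w\<close> is \<open>I\<^sub>\<beta> v\<close>, as an element of \<open>L\<^sup>1\<close>.\<close>

definition is_frac_integral :: "real \<Rightarrow> (real^'n \<Rightarrow> real) \<Rightarrow> (real^'n \<Rightarrow> real) \<Rightarrow> bool" where
  "is_frac_integral \<beta> v w \<longleftrightarrow>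
    w \<in> Lp 1 \<and> (\<forall>\<xi>. \<xi> \<noteq> 0 \<longrightarrow> fourier w \<xi> = fourier v \<xi> / of_real (norm \<xi> powr \<beta>))"

text \<open>\<open>D\<^sup>\<beta> w\<close>, for \<open>w\<close> such that this is again in \<open>L\<^sup>1\<close>; it is then determined up to a null set
  by its Fourier transform, and a representative is chosen.\<close>

definition frac_deriv :: "real \<Rightarrow> (real^'n \<Rightarrow> real) \<Rightarrow> real^'n \<Rightarrow> real" where
  "frac_deriv \<beta> w =
    (SOME v. v \<in> Lp 1 \<and> (\<forall>\<xi>. fourier v \<xi> = of_real (norm \<xi> powr \<beta>) * fourier w \<xi>))"

section \<open>Weak derivatives\<close>

definition partial :: "'n \<Rightarrow> (real^'n \<Rightarrow> real) \<Rightarrow> real^'n \<Rightarrow> real" where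
  "partial i f x = frechet_derivative f (at x) (axis i 1)"

fun Ck :: "nat \<Rightarrow> (real^'n \<Rightarrow> real) \<Rightarrow> bool" where
  "Ck 0 f \<longleftrightarrow> continuous_on UNIV f"
| "Ck (Suc k) f \<longleftrightarrow> (\<forall>x. f differentiable (at x)) \<and> (\<forall>i. Ck k (partial i f))"

definition test_function :: "(real^'n \<Rightarrow> real) \<Rightarrow> bool" where
  "test_function \<phi> \<longleftrightarrow> (\<forall>k. Ck k \<phi>) \<and> (\<exists>K. compact K \<and> (\<forall>x. x \<notin> K \<longrightarrow> \<phi> x = 0))"

definition locally_integrable :: "(real^'n \<Rightarrow> real) \<Rightarrow> bool" where
  "locally_integrable f \<longleftrightarrow> (\<forall>K. compact K \<longrightarrow> set_integrable lborel K f)"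

definition weak_partial :: "'n \<Rightarrow> (real^'n \<Rightarrow> real) \<Rightarrow> (real^'n \<Rightarrow> real) \<Rightarrow> bool" where
  "weak_partial i f g \<longleftrightarrow> locally_integrable f \<and> locally_integrable g \<and>
    (\<forall>\<phi>. test_function \<phi> \<longrightarrow>
      (\<integral>x. f x * partial i \<phi> x \<partial>lborel) = - (\<integral>x. g x * \<phi> x \<partial>lborel))"

section \<open>The Cauchy problem\<close>

definition continuous_Lp :: "ennreal \<Rightarrow> real set \<Rightarrow> (real \<Rightarrow> real^'n \<Rightarrow> real) \<Rightarrow> bool" where
  "continuous_Lp p T u \<longleftrightarrow>
    (\<forall>t\<in>T. u t \<in> Lp p \<and> ((\<lambda>s. Lp_norm p (\<lambda>x. u s x - u t x)) \<longlongrightarrow> 0) (at t within T))"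

definition has_derivative_Lp ::
    "ennreal \<Rightarrow> real set \<Rightarrow> (real \<Rightarrow> real^'n \<Rightarrow> real) \<Rightarrow> (real \<Rightarrow> real^'n \<Rightarrow> real) \<Rightarrow> bool" where
  "has_derivative_Lp p T u v \<longleftrightarrow>
    (\<forall>t\<in>T. ((\<lambda>s. Lp_norm p (\<lambda>x. (u s x - u t x) / (s - t) - v t x)) \<longlongrightarrow> 0) (at t within T))"

definition flux :: "real \<Rightarrow> real \<Rightarrow> real" where
  "flux q s = s * \<bar>s\<bar> powr (q - 1)"

text \<open>The time derivative \<open>ut\<close> and the weak space derivatives \<open>Du\<close>, \<open>D2u\<close> can be chosen
  independently of \<open>p\<close>, because they are unique up to null sets for each \<open>t\<close>.\<close>

definition is_solution ::
    "real^'n \<Rightarrow> real \<Rightarrow> (real^'n \<Rightarrow> real) \<Rightarrow> (real \<Rightarrow> real^'n \<Rightarrow> real) \<Rightarrow> bool" where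
  "is_solution a q u0 u \<longleftrightarrow>
    continuous_Lp 1 {0..} u \<and> (AE x in lborel. u 0 x = u0 x) \<and>
    (\<exists>ut Du D2u.
      (\<forall>t>0. \<forall>i. weak_partial i (u t) (Du i t) \<and>
                 (\<forall>j. weak_partial j (Du i t) (D2u i j t))) \<and>
      (\<forall>p. 1 < p \<and> p < \<infinity> \<longrightarrow>
        continuous_Lp p {0<..} u \<and>
        (\<forall>i. continuous_Lp p {0<..} (Du i)) \<and>
        (\<forall>i j. continuous_Lp p {0<..} (D2u i j)) \<and>
        continuous_Lp p {0<..} ut \<and> has_derivative_Lp p {0<..} u ut) \<and>
      (\<forall>t>0. \<exists>N. (\<forall>i. weak_partial i (\<lambda>x. flux q (u t x)) (N i)) \<and>
        (AE x in lborel. ut t x - (\<Sum>i\<in>UNIV. D2u i i t x) + (\<Sum>i\<in>UNIV. a $ i * N i x) = 0)))"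

text \<open>\<open>u(t) = e\<^bsup>t\<Delta>\<^esup> u0 - \<integral>\<^sub>0\<^sup>t a \<cdot> \<nabla>e\<^bsup>(t-\<tau>)\<Delta>\<^esup> (u|u|\<^bsup>q-1\<^esup>)(\<tau>) d\<tau>\<close>, almost everywhere in space for each
  \<open>t\<close>; \<open>a \<cdot> \<nabla>\<close> acts on a smooth function, as the derivative in direction \<open>a\<close>.\<close>

definition mild_formula ::
    "real^'n \<Rightarrow> real \<Rightarrow> (real^'n \<Rightarrow> real) \<Rightarrow> (real \<Rightarrow> real^'n \<Rightarrow> real) \<Rightarrow> bool" where
  "mild_formula a q u0 u \<longleftrightarrow>
    (\<forall>t>0. AE x in lborel.
      let k = (\<lambda>\<tau>. frechet_derivative (heat (t - \<tau>) (\<lambda>y. flux q (u \<tau> y))) (at x) a)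
      in set_integrable lborel {0<..<t} k \<and>
         u t x = heat t u0 x - (LINT \<tau>:{0<..<t}|lborel. k \<tau>))"

text \<open>\<open>t\<^bsup>(n/2)(1-1/p)+\<beta>/2\<^esup> \<parallel>u(t) - A D\<^sup>\<beta>G(t)\<parallel>\<^sub>p \<rightarrow> 0\<close> as \<open>t \<rightarrow> \<infinity>\<close>.\<close>

definition asymptotic_Lp ::
    "real \<Rightarrow> real \<Rightarrow> (real \<Rightarrow> real^'n \<Rightarrow> real) \<Rightarrow> ennreal \<Rightarrow> bool" where
  "asymptotic_Lp \<beta> A u p \<longleftrightarrow>
    ((\<lambda>t. ennreal (t powr (real CARD('n) / 2 * (1 - recip p) + \<beta> / 2)) *
          Lp_norm p (\<lambda>x. u t x - A * frac_deriv \<beta> (heat_kernel t) x)) \<longlongrightarrow> 0) at_top"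

end

theory Submission
  imports Defs "HOL-Probability.Probability"
begin

text \<open>By Carlen--Loss smoothing, \<open>\<parallel>u(\<tau>)\<parallel>\<^sub>\<infinity> \<le> C \<tau>\<^bsup>-n/2\<^esup> \<parallel>u(\<tau>/2)\<parallel>\<^sub>1\<close>, so the mass \<open>h(t) = \<parallel>u(t)\<parallel>\<^sub>1\<close> satisfies an
  integral inequality with kernel \<open>(t - \<tau>)\<^bsup>-1/2\<^esup>\<close> and source \<open>\<parallel>|u(\<tau>)|\<^sup>q\<parallel>\<^sub>1\<close>.  Measured against
  \<open>\<tau>\<^bsup>-1/2-\<beta>/2\<^esup>\<close>, the source carries a small factor at late times (and, for \<open>q \<le> 1 + 1/n\<close>, at early times
  as well, because \<open>u\<close> is bounded), so that it can be absorbed: linearly if \<open>q > 1 + 1/n\<close>, and by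
  smallness and a first-hitting-time argument otherwise.  This yields \<open>h(t) \<le> G t\<^bsup>-\<beta>/2\<^esup>\<close>, and then
  \<open>q > 1 + 1/(n + \<beta>)\<close> makes the Duhamel term decay faster than the heat flow in \<open>L\<^sup>1\<close> and
  in \<open>L\<^sup>\<infinity>\<close>.

  It remains to compare \<open>e\<^bsup>t\<Delta>\<^esup> u0\<close> with \<open>A D\<^sup>\<beta>G(t)\<close>.  The Fourier transform of the difference is
  \<open>e\<^bsup>-t|\<xi>|\<^sup>2\<^esup> |\<xi>|\<^sup>\<beta> m(\<xi>)\<close> with \<open>m\<close> bounded and \<open>m(\<xi>) \<rightarrow> 0\<close> as \<open>\<xi> \<rightarrow> 0\<close>, which settles \<open>L\<^sup>2\<close> and \<open>L\<^sup>\<infinity>\<close>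
  by rescaling.  If \<open>w = I\<^sub>\<beta> u0\<close> is integrable, the difference is the convolution of \<open>D\<^sup>\<beta>G(t/2)\<close>, of
  \<open>L\<^sup>1\<close> norm \<open>O(t\<^bsup>-\<beta>/2\<^esup>)\<close>, with \<open>e\<^bsup>(t/2)\<Delta>\<^esup> w - A G(t/2) \<rightarrow> 0\<close> in \<open>L\<^sup>1\<close>.  The remaining exponents
  follow by interpolation.\<close>

section \<open>Fourier analysis of the heat semigroup\<close>

text \<open>The numbers come from \<open>|u|^q <= sup|u|^(q-1) |u|\<close>. If the mass decays like
  t^(-beta/2), restarting gives sup|u| of order t^(-(n+beta)/2), and the source decays like
  t^(-(1/2+beta/2)-d) with 2d = (n+beta)(q-1)-1, which is positive exactly under the hypothesis on
  q. Before any decay of the mass is known, sup|u| is only of order t^(-n/2), and the same count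
  gives 2d = n(q-1)-1, positive only for q > 1+1/n. Below that exponent the good rate has to be
  assumed up to some time and recovered with a better constant; this costs a power G^q of the
  assumed bound G, hence smallness. Two technical points shape the rest. \<open>frac_deriv\<close>
  is a choice of representative known only through its Fourier transform, so inversion, Plancherel
  and uniqueness are established for L^1 functions. And \<open>u\<close> is given by separate
  representatives at each time, so measurability in space-time is obtained from the heat flow of
  \<open>|u|^q\<close>.\<close>

abbreviation L1_norm :: "('a::euclidean_space \<Rightarrow> real) \<Rightarrow> real" where
  "L1_norm f \<equiv> \<integral>x. \<bar>f x\<bar> \<partial>lborel"

abbreviation L1_ennnorm :: "('a::euclidean_space \<Rightarrow> real) \<Rightarrow> ennreal" where
  "L1_ennnorm f \<equiv> \<integral>\<^sup>+x. ennreal \<bar>f x\<bar> \<partial>lborel"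

section \<open>Coordinatewise integration and affine substitutions\<close>

text \<open>\<open>lborel\<close> is the image of the product of one-dimensional Lebesgue measures
  under the coordinate map, so integrals of products over the basis factor. Gaussian computations
  thereby reduce to one real variable.\<close>

lemma
  fixes f :: "'a::euclidean_space \<Rightarrow> real \<Rightarrow> 'b::{real_normed_field,banach,second_countable_topology}"
  assumes int: "\<And>b. b \<in> Basis \<Longrightarrow> integrable lborel (f b)"
  shows integrable_lborel_prod: "integrable lborel (\<lambda>x::'a. \<Prod>b\<in>Basis. f b (x \<bullet> b))"
    and integral_lborel_prod:
      "(LBINT x. (\<Prod>b\<in>(Basis::'a set). f b (x \<bullet> b))) = (\<Prod>b\<in>Basis. (LBINT y. f b y))"
proof -
  interpret product_sigma_finite "\<lambda>_::'a. lborel :: real measure" by standard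
  have [measurable]: "f b \<in> borel_measurable borel" if "b \<in> Basis" for b
    using borel_measurable_integrable[OF int[OF that]] by simp
  have eq: "(\<Prod>b\<in>Basis. f b ((\<Sum>c\<in>Basis. y c *\<^sub>R c) \<bullet> b)) = (\<Prod>b\<in>Basis. f b (y b))" for y :: "'a \<Rightarrow> real"
    by (intro prod.cong) auto
  show "integrable lborel (\<lambda>x::'a. \<Prod>b\<in>Basis. f b (x \<bullet> b))"
    by (subst lborel_eq, subst integrable_distr_eq)
       (auto simp: eq intro!: product_integrable_prod int)
  show "(LBINT x. (\<Prod>b\<in>(Basis::'a set). f b (x \<bullet> b))) = (\<Prod>b\<in>Basis. (LBINT y. f b y))"
    by (subst lborel_eq, subst integral_distr)
       (auto simp: eq intro!: product_integral_prod int)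
qed

lemma nn_integral_lborel_affine:
  fixes f :: "'a::euclidean_space \<Rightarrow> ennreal" and t :: 'a
  assumes [measurable]: "f \<in> borel_measurable borel" and c: "c \<noteq> 0"
  shows "(\<integral>\<^sup>+x. f x \<partial>lborel) = ennreal (\<bar>c\<bar> ^ DIM('a)) * (\<integral>\<^sup>+x. f (t + c *\<^sub>R x) \<partial>lborel)"
  by (subst lborel_affine[OF c, of t]) (simp add: nn_integral_density nn_integral_distr nn_integral_cmult)

lemma integral_lborel_affine:
  fixes f :: "'a::euclidean_space \<Rightarrow> 'b::{banach, second_countable_topology}" and t :: 'a
  assumes [measurable]: "f \<in> borel_measurable borel" and c: "c \<noteq> 0"
  shows "(LBINT x. f x) = \<bar>c\<bar> ^ DIM('a) *\<^sub>R (LBINT x. f (t + c *\<^sub>R x))"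
  by (subst lborel_affine[OF c, of t]) (simp add: integral_density integral_distr)

lemma integrable_lborel_affine:
  fixes f :: "'a::euclidean_space \<Rightarrow> 'b::{banach, second_countable_topology}" and t :: 'a
  assumes int: "integrable lborel f" and c: "c \<noteq> 0"
  shows "integrable lborel (\<lambda>x. f (t + c *\<^sub>R x))"
proof -
  have [measurable]: "f \<in> borel_measurable borel"
    using borel_measurable_integrable[OF int] by simp
  show ?thesis
    using int c unfolding integrable_iff_bounded
    by (subst (asm) nn_integral_lborel_affine[where c=c and t=t]) (auto simp: ennreal_mult_less_top)
qed

lemma nn_integral_lborel_reflect:
  fixes f :: "'a::euclidean_space \<Rightarrow> ennreal"
  assumes [measurable]: "f \<in> borel_measurable borel"
  shows "(\<integral>\<^sup>+y. f (x - y) \<partial>lborel) = (\<integral>\<^sup>+y. f y \<partial>lborel)"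
  using nn_integral_lborel_affine[of f "-1" x] by simp

lemma nn_integral_lborel_translate:
  fixes f :: "'a::euclidean_space \<Rightarrow> ennreal"
  assumes [measurable]: "f \<in> borel_measurable borel"
  shows "(\<integral>\<^sup>+y. f (y - x) \<partial>lborel) = (\<integral>\<^sup>+y. f y \<partial>lborel)"
  using nn_integral_lborel_affine[of f 1 "-x"] by simp

lemma integral_lborel_translate:
  fixes f :: "'a::euclidean_space \<Rightarrow> 'b::{banach, second_countable_topology}"
  assumes [measurable]: "f \<in> borel_measurable borel"
  shows "(LBINT y. f (y - x)) = (LBINT y. f y)"
  using integral_lborel_affine[of f 1 "-x"] by simp

section \<open>Gaussian integrals and the heat kernel\<close>

text \<open>The substitution y = sigma z leads to the characteristic function of the standard normal
  law at the frequency \<open>- (\<sigma> * u)\<close>.\<close>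

lemma fourier_normal_density:
  assumes "0 < \<sigma>"
  shows "(LBINT y. exp (- \<i> * of_real (y * u)) * of_real (normal_density 0 \<sigma> y))
    = (of_real (exp (- (\<sigma> * u)\<^sup>2 / 2)) :: complex)"
proof -
  have std: "(LBINT y. of_real (std_normal_density y) * exp (\<i> * of_real (s * y)))
      = (of_real (exp (- s\<^sup>2 / 2)) :: complex)" for s
    using fun_cong[OF char_std_normal_distribution, of s]
    by (simp add: char_def integral_density normal_density_nonneg scaleR_conv_of_real)
  have "(LBINT y. exp (- \<i> * of_real (y * u)) * of_real (normal_density 0 \<sigma> y))
     = \<bar>\<sigma>\<bar> *\<^sub>R (LBINT y. exp (- \<i> * of_real ((0 + \<sigma> * y) * u)) * of_real (normal_density 0 \<sigma> (0 + \<sigma> * y)))"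
    using assms by (intro lborel_integral_real_affine) auto
  also have "\<dots> = (LBINT y. of_real (std_normal_density y) * exp (\<i> * of_real (- (\<sigma> * u) * y)))"
    unfolding integral_scaleR_right[symmetric]
    using assms
    by (intro Bochner_Integration.integral_cong refl)
       (simp add: normal_density_def scaleR_conv_of_real real_sqrt_mult power_mult_distrib mult_ac)
  also have "\<dots> = of_real (exp (- (\<sigma> * u)\<^sup>2 / 2))"
    by (subst std) simp
  finally show ?thesis .
qed

lemma norm_sq_eq_sum_Basis: "(norm (x::'a::euclidean_space))\<^sup>2 = (\<Sum>b\<in>Basis. (x \<bullet> b)\<^sup>2)"
  unfolding power2_norm_eq_inner by (subst euclidean_inner) (simp add: power2_eq_square)

text \<open>Identifies the kernel as the joint density of independent centred normal variables of
  variance 2t, one per coordinate; total mass and Fourier transform then come from the normal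
  law.\<close>

lemma heat_kernel_eq_prod:
  fixes x :: "real^'n"
  assumes "0 < t"
  shows "heat_kernel t x = (\<Prod>b\<in>Basis. normal_density 0 (sqrt (2 * t)) (x \<bullet> b))"
proof -
  have "(4 * pi * t) powr (- real CARD('n) / 2) = (1 / sqrt (4 * pi * t)) ^ CARD('n)"
    using assms
    by (simp add: powr_half_sqrt[symmetric] powr_minus_divide[symmetric] powr_powr powr_realpow[symmetric])
  moreover have "exp (- (norm x)\<^sup>2 / (4 * t)) = (\<Prod>b\<in>Basis. exp (- (x \<bullet> b)\<^sup>2 / (4 * t)))"
    by (simp add: norm_sq_eq_sum_Basis exp_sum[symmetric] sum_negf sum_divide_distrib[symmetric])
  ultimately show ?thesis
    using assms by (simp add: heat_kernel_def normal_density_def prod.distrib prod_dividef power_divide mult.assoc)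
qed

lemma heat_kernel_nonneg [simp]: "0 \<le> heat_kernel t x"
  by (simp add: heat_kernel_def)

lemma heat_kernel_minus [simp]: "heat_kernel t (- x) = heat_kernel t x"
  by (simp add: heat_kernel_def)

lemma heat_kernel_minus_commute: "heat_kernel t (x - y) = heat_kernel t (y - x)"
  by (simp add: heat_kernel_def norm_minus_commute)

lemma heat_kernel_measurable [measurable (raw)]:
  assumes [measurable]: "f \<in> borel_measurable M" "g \<in> borel_measurable M"
  shows "(\<lambda>w. heat_kernel (f w) (g w :: real^'n)) \<in> borel_measurable M"
  unfolding heat_kernel_def by measurable

lemma
  assumes "0 < t"
  shows integrable_heat_kernel: "integrable lborel (heat_kernel t :: real^'n \<Rightarrow> real)"
    and integral_heat_kernel: "(LBINT x. heat_kernel t (x :: real^'n)) = 1"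
proof -
  note int = integrable_normal_density[of "sqrt (2 * t)" 0]
  show "integrable lborel (heat_kernel t :: real^'n \<Rightarrow> real)"
    unfolding heat_kernel_eq_prod[OF assms] using assms by (intro integrable_lborel_prod int) auto
  show "(LBINT x. heat_kernel t (x :: real^'n)) = 1"
    unfolding heat_kernel_eq_prod[OF assms] using assms by (subst integral_lborel_prod) (auto intro!: int)
qed

lemma fourier_heat_kernel:
  fixes \<xi> :: "real^'n"
  assumes "0 < t"
  shows "fourier (heat_kernel t) \<xi> = of_real (exp (- t * (norm \<xi>)\<^sup>2))"
proof -
  let ?g = "\<lambda>b y. exp (- \<i> * of_real (y * (\<xi> \<bullet> b))) * of_real (normal_density 0 (sqrt (2 * t)) y) :: complex"
  have int: "integrable lborel (?g b)" for b
    by (rule Bochner_Integration.integrable_bound[OF integrable_normal_density[of "sqrt (2*t)" 0]])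
       (auto simp: norm_mult assms)
  have "exp (- \<i> * of_real (x \<bullet> \<xi>)) * of_real (heat_kernel t x) = (\<Prod>b\<in>Basis. ?g b (x \<bullet> b))" for x
    by (simp add: heat_kernel_eq_prod assms prod.distrib exp_sum[symmetric] euclidean_inner[of x \<xi>]
        sum_distrib_left sum_negf)
  then have "fourier (heat_kernel t) \<xi> = (\<Prod>b\<in>Basis. (LBINT y. ?g b y))"
    unfolding fourier_def by (simp only: integral_lborel_prod[OF int])
  also have "\<dots> = (\<Prod>b\<in>Basis. of_real (exp (- (sqrt (2 * t) * (\<xi> \<bullet> b))\<^sup>2 / 2)))"
    using assms by (intro prod.cong fourier_normal_density refl) auto
  also have "\<dots> = of_real (exp (- t * (norm \<xi>)\<^sup>2))"
    using assms by (simp add: norm_sq_eq_sum_Basis of_real_prod[symmetric] exp_sum[symmetric] power_mult_distrib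
        sum_distrib_left sum_negf del: of_real_prod)
  finally show ?thesis .
qed

lemma borel_measurable_fourier [measurable]:
  fixes v :: "real^'n \<Rightarrow> real"
  assumes [measurable]: "v \<in> borel_measurable borel"
  shows "fourier v \<in> borel_measurable borel"
  unfolding fourier_def by measurable

lemma integrable_fourier_integrand:
  fixes v :: "real^'n \<Rightarrow> real"
  assumes "integrable lborel v"
  shows "integrable lborel (\<lambda>x. exp (- \<i> * of_real (x \<bullet> \<xi>)) * of_real (v x) :: complex)"
proof (rule Bochner_Integration.integrable_bound[OF assms])
  have [measurable]: "v \<in> borel_measurable borel"
    using borel_measurable_integrable[OF assms] by simp
  show "(\<lambda>x. exp (- \<i> * of_real (x \<bullet> \<xi>)) * of_real (v x) :: complex) \<in> borel_measurable lborel"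
    by measurable
qed (simp add: norm_mult)

lemma norm_fourier_le:
  assumes "integrable lborel v"
  shows "norm (fourier v \<xi>) \<le> L1_norm v"
proof -
  have "norm (fourier v \<xi>) \<le> (LBINT x. norm (exp (- \<i> * of_real (x \<bullet> \<xi>)) * of_real (v x) :: complex))"
    unfolding fourier_def by (rule integral_norm_bound)
  then show ?thesis by (simp add: norm_mult)
qed

lemma fourier_diff:
  "integrable lborel v \<Longrightarrow> integrable lborel w \<Longrightarrow> fourier (\<lambda>x. v x - w x) \<xi> = fourier v \<xi> - fourier w \<xi>"
  unfolding fourier_def
  by (simp only: of_real_diff right_diff_distrib Bochner_Integration.integral_diff[OF integrable_fourier_integrand integrable_fourier_integrand])

lemma fourier_cmult: "fourier (\<lambda>x. c * v x) \<xi> = of_real c * fourier v \<xi>"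
  unfolding fourier_def by (simp add: mult.left_commute)

text \<open>A Gaussian in frequency is itself a multiple of a heat kernel, at time 1/(4s), so the
  inverse transform is the already known forward transform at \<open>- x\<close>.\<close>

lemma inverse_fourier_gaussian:
  fixes x :: "real^'n"
  assumes "0 < s"
  shows "(LBINT \<xi>. exp (\<i> * of_real (x \<bullet> \<xi>)) * of_real (exp (- s * (norm \<xi>)\<^sup>2)))
    = (of_real ((2 * pi) ^ CARD('n) * heat_kernel s x) :: complex)"
proof -
  \<comment> \<open>The normalisation of that kernel: at time 1/(4s) its value at xi is c exp(-s
    |xi|^2).\<close>
  define c :: real where "c = (pi / s) powr (- real CARD('n) / 2)"
  have "c > 0" using assms by (simp add: c_def)
  have "fourier (heat_kernel (1 / (4 * s))) (- x)
      = of_real c * (LBINT \<xi>. exp (\<i> * of_real (x \<bullet> \<xi>)) * of_real (exp (- s * (norm \<xi>)\<^sup>2)))"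
    unfolding fourier_def integral_mult_right_zero[symmetric]
    using assms by (intro Bochner_Integration.integral_cong) (auto simp: heat_kernel_def c_def inner_commute mult_ac)
  moreover have "fourier (heat_kernel (1 / (4 * s))) (- x) = of_real (exp (- (norm x)\<^sup>2 / (4 * s)))"
    using assms by (subst fourier_heat_kernel) auto
  moreover have "exp (- (norm x)\<^sup>2 / (4 * s)) = c * ((2 * pi) ^ CARD('n) * heat_kernel s x)"
  proof -
    have "c * ((2 * pi) ^ CARD('n) * (4 * pi * s) powr (- real CARD('n) / 2))
      = (pi / s * (4 * pi * s)) powr (- real CARD('n) / 2) * (2 * pi) ^ CARD('n)"
      unfolding c_def using assms by (subst powr_mult) auto
    also have "pi / s * (4 * pi * s) = (2 * pi) powr 2"
      using assms by (simp add: power2_eq_square)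
    also have "((2 * pi) powr 2) powr (- real CARD('n) / 2) = (2 * pi) powr (- real CARD('n))"
      by (subst powr_powr) simp
    also have "(2 * pi) powr (- real CARD('n)) * (2 * pi) ^ CARD('n) = 1"
      by (subst powr_realpow[symmetric]) (simp_all flip: powr_add)
    finally have "c * ((2 * pi) ^ CARD('n) * (4 * pi * s) powr (- real CARD('n) / 2)) = 1" .
    then show ?thesis
      unfolding heat_kernel_def by (metis mult.assoc mult_1)
  qed
  ultimately have "of_real c * (LBINT \<xi>. exp (\<i> * of_real (x \<bullet> \<xi>)) * of_real (exp (- s * (norm \<xi>)\<^sup>2)))
     = (of_real c * of_real ((2 * pi) ^ CARD('n) * heat_kernel s x) :: complex)"
    by (simp only: of_real_mult)
  then show ?thesis using \<open>c > 0\<close> by simp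
qed

lemma integrable_gaussian:
  assumes "0 < s"
  shows "integrable lborel (\<lambda>\<xi>::real^'n. exp (- s * (norm \<xi>)\<^sup>2))"
proof -
  have "integrable lborel (\<lambda>\<xi>::real^'n. (pi / s) powr (real CARD('n) / 2) * heat_kernel (1 / (4 * s)) \<xi>)"
    using assms by (intro integrable_mult_right integrable_heat_kernel) auto
  moreover have "(pi / s) powr (real CARD('n) / 2) * heat_kernel (1 / (4 * s)) \<xi> = exp (- s * (norm \<xi>)\<^sup>2)"
    for \<xi> :: "real^'n"
    using assms by (simp add: heat_kernel_def powr_minus field_simps)
  ultimately show ?thesis by simp
qed

section \<open>Double integrals and convolutions\<close>

interpretation lborel_pair: pair_sigma_finite "lborel :: 'a::euclidean_space measure" "lborel :: 'b::euclidean_space measure"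
  by standard

lemma integrable_product:
  fixes f :: "'a::euclidean_space \<Rightarrow> 'c::{real_normed_field,banach,second_countable_topology}"
    and g :: "'b::euclidean_space \<Rightarrow> 'c"
  assumes f: "integrable lborel f" and g: "integrable lborel g"
  shows "integrable (lborel \<Otimes>\<^sub>M lborel) (\<lambda>(x, y). f x * g y)"
proof -
  have [measurable]: "f \<in> borel_measurable borel" "g \<in> borel_measurable borel"
    using borel_measurable_integrable[OF f] borel_measurable_integrable[OF g] by auto
  have "(\<integral>\<^sup>+z. ennreal (norm (case z of (x, y) \<Rightarrow> f x * g y)) \<partial>(lborel \<Otimes>\<^sub>M lborel))
    = (\<integral>\<^sup>+x. \<integral>\<^sup>+y. ennreal (norm (f x)) * ennreal (norm (g y)) \<partial>lborel \<partial>lborel)"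
    by (subst lborel.nn_integral_fst[symmetric]) (auto simp: norm_mult ennreal_mult)
  also have "\<dots> = (\<integral>\<^sup>+x. ennreal (norm (f x)) \<partial>lborel) * (\<integral>\<^sup>+y. ennreal (norm (g y)) \<partial>lborel)"
    by (simp add: nn_integral_cmult nn_integral_multc)
  also have "\<dots> < \<infinity>"
    using f g by (simp add: integrable_iff_bounded ennreal_mult_less_top)
  finally show ?thesis
    by (subst integrable_iff_bounded) auto
qed

text \<open>By Tonelli and translation invariance the inner integral over x is the same for every y,
  which gives the exact mass of the modulus; integrability on the product is then read off.\<close>

lemma
  fixes k v :: "'a::euclidean_space \<Rightarrow> real"
  assumes k: "integrable lborel k" and v: "integrable lborel v"
  shows integrable_convolution_pair: "integrable (lborel \<Otimes>\<^sub>M lborel) (\<lambda>(x, y). k (x - y) * v y)"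
    and nn_integral_convolution: "(\<integral>\<^sup>+x. \<integral>\<^sup>+y. ennreal \<bar>k (x - y) * v y\<bar> \<partial>lborel \<partial>lborel)
      = ennreal (L1_norm k) * ennreal (L1_norm v)"
proof -
  have [measurable]: "k \<in> borel_measurable borel" "v \<in> borel_measurable borel"
    using borel_measurable_integrable[OF k] borel_measurable_integrable[OF v] by auto
  have "(\<integral>\<^sup>+x. \<integral>\<^sup>+y. ennreal \<bar>k (x - y) * v y\<bar> \<partial>lborel \<partial>lborel)
      = (\<integral>\<^sup>+y. \<integral>\<^sup>+x. ennreal \<bar>k (x - y) * v y\<bar> \<partial>lborel \<partial>lborel)"
    by (rule lborel_pair.Fubini') measurable
  also have "\<dots> = (\<integral>\<^sup>+y. (\<integral>\<^sup>+x. ennreal \<bar>k (x - y)\<bar> \<partial>lborel) * ennreal \<bar>v y\<bar> \<partial>lborel)"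
    by (simp add: abs_mult ennreal_mult nn_integral_multc)
  also have "\<dots> = (\<integral>\<^sup>+y. L1_ennnorm k * ennreal \<bar>v y\<bar> \<partial>lborel)"
    by (simp add: nn_integral_lborel_translate[where f="\<lambda>x. ennreal \<bar>k x\<bar>"])
  also have "\<dots> = ennreal (L1_norm k) * ennreal (L1_norm v)"
    using k v by (simp add: nn_integral_cmult nn_integral_eq_integral)
  finally show eq: "(\<integral>\<^sup>+x. \<integral>\<^sup>+y. ennreal \<bar>k (x - y) * v y\<bar> \<partial>lborel \<partial>lborel)
      = ennreal (L1_norm k) * ennreal (L1_norm v)" .
  have "(\<integral>\<^sup>+z. ennreal (norm (case z of (x, y) \<Rightarrow> k (x - y) * v y)) \<partial>(lborel \<Otimes>\<^sub>M lborel)) < \<infinity>"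
    by (subst lborel.nn_integral_fst[symmetric]) (auto simp: eq ennreal_mult_less_top)
  then show "integrable (lborel \<Otimes>\<^sub>M lborel) (\<lambda>(x, y). k (x - y) * v y)"
    by (subst integrable_iff_bounded) auto
qed

section \<open>Fourier inversion and Plancherel\<close>

text \<open>Inversion regularised by a Gaussian: the weight makes the double integral absolutely
  convergent for any integrable \<open>v\<close>, so Fubini applies and the frequency integral
  becomes a heat kernel.\<close>

lemma heat_eq_inverse_fourier:
  fixes v :: "real^'n \<Rightarrow> real"
  assumes v: "integrable lborel v" and "0 < s"
  shows "of_real (heat s v x) = of_real (1 / (2 * pi) ^ CARD('n)) *
    (LBINT \<xi>. exp (\<i> * of_real (x \<bullet> \<xi>)) * of_real (exp (- s * (norm \<xi>)\<^sup>2)) * fourier v \<xi>)"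
proof -
  have [measurable]: "v \<in> borel_measurable borel"
    using borel_measurable_integrable[OF v] by simp
  let ?e = "\<lambda>\<xi>. exp (- s * (norm \<xi>)\<^sup>2)"
  let ?f = "\<lambda>\<xi> y. exp (\<i> * of_real ((x - y) \<bullet> \<xi>)) * of_real (?e \<xi>) * of_real (v y) :: complex"
  have "integrable (lborel \<Otimes>\<^sub>M lborel) (\<lambda>(\<xi>::real^'n, y). ?e \<xi> * v y)"
    using integrable_product[OF integrable_gaussian[OF \<open>0 < s\<close>] v] .
  then have int: "integrable (lborel \<Otimes>\<^sub>M lborel) (\<lambda>(\<xi>, y). ?f \<xi> y)"
    by (rule Bochner_Integration.integrable_bound) (auto simp: norm_mult)
  have "(LBINT \<xi>. exp (\<i> * of_real (x \<bullet> \<xi>)) * of_real (?e \<xi>) * fourier v \<xi>) = (LBINT \<xi>. (LBINT y. ?f \<xi> y))"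
    unfolding fourier_def integral_mult_right_zero[symmetric]
    by (intro Bochner_Integration.integral_cong refl)
       (simp add: inner_diff_left right_diff_distrib exp_diff exp_minus field_simps)
  also have "\<dots> = (LBINT y. (LBINT \<xi>. ?f \<xi> y))"
    using lborel_pair.Fubini_integral[of ?f] int by simp
  also have "\<dots> = (LBINT y. of_real ((2 * pi) ^ CARD('n) * (heat_kernel s (x - y) * v y)))"
    by (simp only: integral_mult_left_zero inverse_fourier_gaussian[OF \<open>0 < s\<close>] of_real_mult) (simp only: mult.assoc)
  also have "\<dots> = of_real ((2 * pi) ^ CARD('n) * heat s v x)"
    unfolding heat_def by (simp only: of_real_mult flip: integral_complex_of_real integral_mult_right_zero)
  finally show ?thesis by simp
qed

text \<open>The positive and negative parts of \<open>r\<close> are densities of two measures that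
  agree and are finite on all boxes. Boxes are a generator stable under intersection, so the
  measures are equal and the two parts coincide almost everywhere; at each point one of them is
  zero.\<close>

lemma AE_eq_0_if_integral_box_eq_0:
  fixes r :: "'a::euclidean_space \<Rightarrow> real"
  assumes int: "\<And>a b. set_integrable lborel (box a b) r"
    and zero: "\<And>a b. (LINT x:box a b|lborel. r x) = 0"
    and [measurable]: "r \<in> borel_measurable borel"
  shows "AE x in lborel. r x = 0"
proof -
  let ?p = "\<lambda>x. ennreal (max 0 (r x))" and ?m = "\<lambda>x. ennreal (max 0 (- r x))"
  have box: "emeasure (density lborel ?p) (box a b) = emeasure (density lborel ?m) (box a b)
      \<and> emeasure (density lborel ?p) (box a b) \<noteq> \<infinity>
      \<and> emeasure (density lborel ?m) (box a b) \<noteq> \<infinity>" for a b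
  proof -
    let ?ri = "\<lambda>x. indicator (box a b) x *\<^sub>R r x"
    have ri: "integrable lborel ?ri" "(LBINT x. ?ri x) = 0"
      using int[of a b] zero[of a b] by (auto simp: set_integrable_def set_lebesgue_integral_def)
    have p: "integrable lborel (\<lambda>x. max 0 (?ri x))" and m: "integrable lborel (\<lambda>x. max 0 (- ?ri x))"
      using ri(1) by auto
    have "(LBINT x. ?ri x) = (LBINT x. max 0 (?ri x) - max 0 (- ?ri x))"
      by (intro Bochner_Integration.integral_cong) auto
    then have eq: "(LBINT x. max 0 (?ri x)) = (LBINT x. max 0 (- ?ri x))"
      using p m ri(2) by (simp add: Bochner_Integration.integral_diff)
    have "emeasure (density lborel ?p) (box a b) = (\<integral>\<^sup>+x. ennreal (max 0 (?ri x)) \<partial>lborel)"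
      by (subst emeasure_density) (auto intro!: nn_integral_cong split: split_indicator)
    moreover have "emeasure (density lborel ?m) (box a b) = (\<integral>\<^sup>+x. ennreal (max 0 (- ?ri x)) \<partial>lborel)"
      by (subst emeasure_density) (auto intro!: nn_integral_cong split: split_indicator)
    ultimately show ?thesis
      using eq nn_integral_eq_integral[OF p] nn_integral_eq_integral[OF m] by simp
  qed
  have "density lborel ?p = density lborel ?m"
  proof (rule measure_eqI_generator_eq[where E="range (\<lambda>(a, b). box a b)" and A="\<lambda>k. box (- real k *\<^sub>R One) (real k *\<^sub>R One)"])
    show "Int_stable (range (\<lambda>(a, b). box a b :: 'a set))"
      by (force simp: Int_stable_def box_Int_box)
    show "sets (density lborel ?p) = sigma_sets UNIV (range (\<lambda>(a, b). box a b))"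
         "sets (density lborel ?m) = sigma_sets UNIV (range (\<lambda>(a, b). box a b))"
      by (simp_all add: borel_eq_box)
    show "(\<Union>k. box (- real k *\<^sub>R One) (real k *\<^sub>R One)) = (UNIV :: 'a set)"
      using UN_box_eq_UNIV by simp
  qed (use box in \<open>auto\<close>)
  then have "AE x in lborel. ?p x = ?m x"
    by (intro sigma_finite_measure.density_unique[OF lborel.sigma_finite_measure_axioms]) auto
  then show ?thesis
    by eventually_elim (auto simp: max_def split: if_splits)
qed

lemma heat_kernel_scaleR:
  fixes x :: "real^'n"
  assumes "0 < c" "0 < t"
  shows "heat_kernel (c\<^sup>2 * t) (c *\<^sub>R x) = heat_kernel t x / c ^ CARD('n)"
proof -
  have "(4 * pi * (c\<^sup>2 * t)) powr (- real CARD('n) / 2) = ((c powr 2) * (4 * pi * t)) powr (- real CARD('n) / 2)"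
    using assms by (simp add: mult_ac)
  also have "\<dots> = c powr (- real CARD('n)) * (4 * pi * t) powr (- real CARD('n) / 2)"
    using assms powr_mult[of "c powr 2" "4 * pi * t" "- real CARD('n) / 2"] powr_powr[of c 2 "- real CARD('n) / 2"]
    by (simp del: powr_numeral)
  also have "c powr (- real CARD('n)) = 1 / c ^ CARD('n)"
    using assms by (simp add: powr_minus_divide powr_realpow)
  finally show ?thesis
    using assms by (simp add: heat_kernel_def power_mult_distrib)
qed

text \<open>The substitution y = x + sqrt s z moves \<open>s\<close> out of the kernel and leaves a
  fixed density, which serves for domination as s tends to 0.\<close>

lemma heat_rescale:
  fixes f :: "real^'n \<Rightarrow> real"
  assumes [measurable]: "f \<in> borel_measurable borel" and "0 < s"
  shows "heat s f x = (LBINT z. heat_kernel 1 z * f (x + sqrt s *\<^sub>R z))"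
proof -
  have "heat s f x = sqrt s ^ CARD('n) * (LBINT z. heat_kernel s (x - (x + sqrt s *\<^sub>R z)) * f (x + sqrt s *\<^sub>R z))"
    unfolding heat_def using assms
    by (subst integral_lborel_affine[where c="sqrt s" and t=x]) auto
  also have "(\<lambda>z. heat_kernel s (x - (x + sqrt s *\<^sub>R z))) = (\<lambda>z. heat_kernel 1 z / sqrt s ^ CARD('n))"
    using heat_kernel_scaleR[of "sqrt s" 1, where 'n='n] assms by (simp add: fun_eq_iff)
  finally show ?thesis using assms by simp
qed

lemma heat_tendsto:
  fixes f :: "real^'n \<Rightarrow> real"
  assumes [measurable]: "f \<in> borel_measurable borel" and bound: "\<And>x. \<bar>f x\<bar> \<le> B"
    and cont: "isCont f x" and s: "\<And>k. 0 < s k" "s \<longlonglongrightarrow> 0"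
  shows "(\<lambda>k. heat (s k) f x) \<longlonglongrightarrow> f x"
proof -
  have "(\<lambda>k. LBINT z. heat_kernel 1 z * f (x + sqrt (s k) *\<^sub>R z)) \<longlonglongrightarrow> (LBINT z. heat_kernel 1 (z::real^'n) * f x)"
  proof (rule integral_dominated_convergence[where w="\<lambda>z::real^'n. heat_kernel 1 z * B"]; (measurable)?)
    have "(\<lambda>k. heat_kernel 1 z * f (x + sqrt (s k) *\<^sub>R z)) \<longlonglongrightarrow> heat_kernel 1 z * f x" for z
    proof -
      have "(\<lambda>k. x + sqrt (s k) *\<^sub>R z) \<longlonglongrightarrow> x + sqrt 0 *\<^sub>R z"
        by (intro tendsto_intros s)
      then show ?thesis
        using isCont_tendsto_compose[OF cont] by (intro tendsto_intros) simp
    qed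
    then show "AE z in lborel. (\<lambda>k. heat_kernel 1 z * f (x + sqrt (s k) *\<^sub>R z)) \<longlonglongrightarrow> heat_kernel 1 z * f x"
      by simp
    show "integrable lborel (\<lambda>z::real^'n. heat_kernel 1 z * B)"
      by (simp add: integrable_heat_kernel)
    show "AE z in lborel. norm (heat_kernel 1 z * f (x + sqrt (s k) *\<^sub>R z)) \<le> heat_kernel 1 z * B" for k
      using bound by (auto simp: abs_mult intro!: mult_left_mono)
  qed
  moreover have "(LBINT z. heat_kernel 1 (z::real^'n) * f x) = f x"
    using integral_heat_kernel[of 1, where 'n='n] by simp
  ultimately have "(\<lambda>k. LBINT z. heat_kernel 1 z * f (x + sqrt (s k) *\<^sub>R z)) \<longlonglongrightarrow> f x"
    by (simp only:)
  then show ?thesis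
    using s(1) by (simp add: heat_rescale)
qed

lemma heat_measurable [measurable]:
  fixes f :: "real^'n \<Rightarrow> real"
  assumes [measurable]: "f \<in> borel_measurable borel"
  shows "heat s f \<in> borel_measurable borel"
  unfolding heat_def by measurable

lemma integrable_heat:
  fixes v :: "real^'n \<Rightarrow> real"
  assumes "integrable lborel v" "0 < s"
  shows "integrable lborel (heat s v)"
  using lborel_pair.integrable_fst'[OF integrable_convolution_pair[OF integrable_heat_kernel[OF assms(2)] assms(1)]]
  by (simp add: heat_def[abs_def])

text \<open>The kernel is symmetric, so the heat flow can be shifted onto the test function. In the
  inversion theorem that function is the indicator of a box.\<close>

lemma integral_heat_mult:
  fixes v \<phi> :: "real^'n \<Rightarrow> real"
  assumes v: "integrable lborel v" and "0 < s"
    and [measurable]: "\<phi> \<in> borel_measurable borel" and bound: "\<And>x. \<bar>\<phi> x\<bar> \<le> B"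
  shows "(LBINT x. heat s v x * \<phi> x) = (LBINT y. heat s \<phi> y * v y)"
proof -
  have [measurable]: "v \<in> borel_measurable borel"
    using borel_measurable_integrable[OF v] by simp
  let ?f = "\<lambda>x y. heat_kernel s (x - y) * v y * \<phi> x"
  have "integrable (lborel \<Otimes>\<^sub>M lborel) (\<lambda>z. B * (case z of (x, y) \<Rightarrow> heat_kernel s (x - y) * v y))"
    by (intro integrable_mult_right integrable_convolution_pair integrable_heat_kernel v \<open>0 < s\<close>)
  then have int: "integrable (lborel \<Otimes>\<^sub>M lborel) (\<lambda>(x, y). ?f x y)"
  proof (rule Bochner_Integration.integrable_bound)
    have "B \<ge> 0" using bound[of 0] by auto
    then show "AE z in lborel \<Otimes>\<^sub>M lborel. norm (case z of (x, y) \<Rightarrow> ?f x y)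
        \<le> norm (B * (case z of (x, y) \<Rightarrow> heat_kernel s (x - y) * v y))"
      using bound by (auto simp: abs_mult mult.commute split: prod.split intro!: mult_right_mono AE_I2)
  qed auto
  have "(LBINT x. heat s v x * \<phi> x) = (LBINT x. (LBINT y. ?f x y))"
    by (simp add: heat_def)
  also have "\<dots> = (LBINT y. (LBINT x. ?f x y))"
    using lborel_pair.Fubini_integral[of ?f] int by simp
  also have "\<dots> = (LBINT y. heat s \<phi> y * v y)"
    unfolding heat_def integral_mult_left_zero[symmetric]
    by (simp add: heat_kernel_minus_commute mult_ac)
  finally show ?thesis .
qed

lemma abs_heat_le:
  fixes f :: "real^'n \<Rightarrow> real"
  assumes [measurable]: "f \<in> borel_measurable borel" and bound: "AE x in lborel. \<bar>f x\<bar> \<le> B" and "0 < s"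
  shows "\<bar>heat s f x\<bar> \<le> B"
proof -
  have int: "integrable lborel (\<lambda>y. heat_kernel s (x - y))"
    using integrable_lborel_affine[OF integrable_heat_kernel[OF \<open>0 < s\<close>], of "-1" x] by simp
  have eq: "(LBINT y. heat_kernel s (x - y)) = 1"
    using integral_lborel_affine[of "heat_kernel s" "-1" x] integral_heat_kernel[OF \<open>0 < s\<close>, where 'n='n] by simp
  have "\<bar>heat s f x\<bar> \<le> (LBINT y. \<bar>heat_kernel s (x - y) * f y\<bar>)"
    unfolding heat_def by (rule integral_abs_bound)
  also have "\<dots> \<le> (LBINT y. heat_kernel s (x - y) * B)"
  proof (rule integral_mono_AE)
    show b: "AE y in lborel. \<bar>heat_kernel s (x - y) * f y\<bar> \<le> heat_kernel s (x - y) * B"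
      using bound by eventually_elim (auto simp: abs_mult intro!: mult_left_mono)
    show B: "integrable lborel (\<lambda>y. heat_kernel s (x - y) * B)"
      using int by simp
    show "integrable lborel (\<lambda>y. \<bar>heat_kernel s (x - y) * f y\<bar>)"
      using b by (intro Bochner_Integration.integrable_bound[OF B]) (auto elim!: eventually_mono)
  qed
  finally show ?thesis using eq by simp
qed


text \<open>The heat flow of \<open>v\<close> at small times has two limits: pointwise the inverse
  transform, by domination with \<open>fourier v\<close>, and, tested against a box, the integral of
  \<open>v\<close>. Equality of all box integrals then gives equality almost everywhere.\<close>

lemma fourier_inversion:
  fixes v :: "real^'n \<Rightarrow> real"
  assumes v: "integrable lborel v" and F: "integrable lborel (fourier v)"
  shows "AE x in lborel. v x =
    Re (of_real (1 / (2 * pi) ^ CARD('n)) * (LBINT \<xi>. exp (\<i> * of_real (x \<bullet> \<xi>)) * fourier v \<xi>))"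
proof -
  have [measurable]: "v \<in> borel_measurable borel"
    using borel_measurable_integrable[OF v] by simp
  define c :: real where "c = 1 / (2 * pi) ^ CARD('n)"
  have "c > 0" by (simp add: c_def)
  define g where "g x = (LBINT \<xi>. exp (\<i> * of_real (x \<bullet> \<xi>)) * fourier v \<xi>)" for x :: "real^'n"
  define s :: "nat \<Rightarrow> real" where "s k = inverse (real (Suc k))" for k
  have s: "0 < s k" "s \<longlonglongrightarrow> 0" for k
    using LIMSEQ_inverse_real_of_nat by (auto simp: s_def[abs_def])
  have [measurable]: "g \<in> borel_measurable borel" unfolding g_def by measurable
  have heat_eq: "heat (s k) v x = Re (of_real c *
    (LBINT \<xi>. exp (\<i> * of_real (x \<bullet> \<xi>)) * of_real (exp (- s k * (norm \<xi>)\<^sup>2)) * fourier v \<xi>))" for k x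
    using arg_cong[OF heat_eq_inverse_fourier[OF v s(1)], of Re k x] unfolding c_def by (simp only: Re_complex_of_real)
  have exp_le: "exp (- s k * (norm \<xi>)\<^sup>2) \<le> 1" for k and \<xi> :: "real^'n"
    using s(1)[of k] by simp
  \<comment> \<open>A bound for all the regularised inversions, uniform in time and space; on a box
    the constant is integrable and dominates.\<close>
  define K where "K = c * (LBINT \<xi>. norm (fourier v \<xi>))"
  have bound: "\<bar>Re (of_real c * (LBINT \<xi>. w \<xi>))\<bar> \<le> K"
    if "\<And>\<xi>. norm (w \<xi>) \<le> norm (fourier v \<xi>)" "w \<in> borel_measurable lborel" for w :: "real^'n \<Rightarrow> complex"
  proof -
    have "\<bar>Re (of_real c * (LBINT \<xi>. w \<xi>))\<bar> \<le> c * norm (LBINT \<xi>. w \<xi>)"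
      using \<open>c > 0\<close> abs_Re_le_cmod[of "of_real c * (LBINT \<xi>. w \<xi>)"] by (simp add: norm_mult)
    also have "\<dots> \<le> c * (LBINT \<xi>. norm (w \<xi>))"
      using \<open>c > 0\<close> by (intro mult_left_mono integral_norm_bound) auto
    also have "\<dots> \<le> K"
      unfolding K_def using \<open>c > 0\<close> that
      by (intro mult_left_mono integral_mono integrable_norm Bochner_Integration.integrable_bound[OF F] F)
         (auto intro!: AE_I2)
    finally show ?thesis .
  qed
  have heat_bound: "\<bar>heat (s k) v x\<bar> \<le> K" for k x
    unfolding heat_eq using exp_le[of k]
    by (intro bound) (simp_all add: norm_mult mult_left_le_one_le del: minus_mult_commute mult_minus_left)
  have g_bound: "\<bar>Re (of_real c * g x)\<bar> \<le> K" for x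
    unfolding g_def by (intro bound) (auto simp: norm_mult)
  have lim: "(\<lambda>k. heat (s k) v x) \<longlonglongrightarrow> Re (of_real c * g x)" for x
  proof -
    have "(\<lambda>k. LBINT \<xi>. exp (\<i> * of_real (x \<bullet> \<xi>)) * of_real (exp (- s k * (norm \<xi>)\<^sup>2)) * fourier v \<xi>) \<longlonglongrightarrow> g x"
      unfolding g_def
    proof (rule integral_dominated_convergence[where w="\<lambda>\<xi>. norm (fourier v \<xi>)"]; (measurable)?)
      have "(\<lambda>k. exp (\<i> * of_real (x \<bullet> \<xi>)) * of_real (exp (- s k * (norm \<xi>)\<^sup>2)) * fourier v \<xi>)
         \<longlonglongrightarrow> exp (\<i> * of_real (x \<bullet> \<xi>)) * of_real (exp (- 0 * (norm \<xi>)\<^sup>2)) * fourier v \<xi>" for \<xi>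
        by (intro tendsto_intros s)
      then show "AE \<xi> in lborel. (\<lambda>k. exp (\<i> * of_real (x \<bullet> \<xi>)) * of_real (exp (- s k * (norm \<xi>)\<^sup>2)) * fourier v \<xi>)
         \<longlonglongrightarrow> exp (\<i> * of_real (x \<bullet> \<xi>)) * fourier v \<xi>"
        by simp
    qed (use F exp_le in \<open>simp_all add: norm_mult mult_left_le_one_le\<close>)
    then show ?thesis unfolding heat_eq by (intro tendsto_intros)
  qed
  have "AE x in lborel. v x - Re (of_real c * g x) = 0"
  proof (rule AE_eq_0_if_integral_box_eq_0)
    fix a b :: "real^'n"
    let ?B = "box a b"
    have fin: "emeasure lborel ?B < \<infinity>"
      using emeasure_bounded_finite[of "?B"] by simp
    have intv: "integrable lborel (\<lambda>x. indicator ?B x * v x)"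
      using integrable_mult_indicator[OF _ v, of ?B] by simp
    have intK: "integrable lborel (\<lambda>x. indicator ?B x * K)"
      using fin by (intro integrable_mult_left) (auto simp: integrable_indicator_iff)
    have intg: "integrable lborel (\<lambda>x. indicator ?B x * Re (of_real c * g x))"
      using g_bound by (intro Bochner_Integration.integrable_bound[OF intK]) (auto intro!: AE_I2 split: split_indicator intro: order_trans[OF _ abs_ge_self])
    show "set_integrable lborel ?B (\<lambda>x. v x - Re (of_real c * g x))"
      using Bochner_Integration.integrable_diff[OF intv intg]
      by (simp add: set_integrable_def right_diff_distrib)
    have "(\<lambda>k. LBINT x. heat (s k) v x * indicator ?B x) \<longlonglongrightarrow> (LBINT x. Re (of_real c * g x) * indicator ?B x)"
    proof (rule integral_dominated_convergence[where w="\<lambda>x. indicator ?B x * K"]; (measurable)?)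
      show "AE x in lborel. (\<lambda>k. heat (s k) v x * indicator ?B x) \<longlonglongrightarrow> Re (of_real c * g x) * indicator ?B x"
        by (intro AE_I2 tendsto_intros lim)
      show "AE x in lborel. norm (heat (s k) v x * indicator ?B x) \<le> indicator ?B x * K" for k
        using heat_bound by (auto split: split_indicator)
    qed (rule intK)
    moreover have "(\<lambda>k. LBINT y. heat (s k) (indicator ?B) y * v y) \<longlonglongrightarrow> (LBINT y. indicator ?B y * v y)"
    proof (rule integral_dominated_convergence[where w="\<lambda>y. norm (v y)"]; (measurable)?)
      \<comment> \<open>Off the frontier the indicator is continuous, as \<open>heat_tendsto\<close>
        demands, and the frontier of a convex set is null.\<close>
      have "AE y in lborel. y \<notin> frontier ?B"
        using negligible_convex_frontier[OF convex_box(2)[of a b]]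
        by (intro AE_not_in) (simp add: negligible_iff_null_sets null_sets_completion_iff)
      then show "AE y in lborel. (\<lambda>k. heat (s k) (indicator ?B) y * v y) \<longlonglongrightarrow> indicator ?B y * v y"
      proof eventually_elim
        case (elim y)
        then show ?case
          by (intro tendsto_intros heat_tendsto[where B=1] s) (auto simp: isCont_indicator split: split_indicator)
      qed
      show "AE y in lborel. norm (heat (s k) (indicator ?B) y * v y) \<le> norm (v y)" for k
      proof (rule AE_I2)
        fix y :: "real^'n"
        have "\<bar>heat (s k) (indicator ?B) y\<bar> \<le> 1"
          using s(1)[of k] by (intro abs_heat_le) (auto split: split_indicator)
        then show "norm (heat (s k) (indicator ?B) y * v y) \<le> norm (v y)"
          by (simp add: abs_mult mult_left_le_one_le)
      qed
    qed (use v in simp)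
    moreover have "(LBINT x. heat (s k) v x * indicator ?B x) = (LBINT y. heat (s k) (indicator ?B) y * v y)" for k
      by (rule integral_heat_mult[where B=1, OF v s(1)]) (simp_all add: indicator_def)
    ultimately have "(LBINT x. Re (of_real c * g x) * indicator ?B x) = (LBINT y. indicator ?B y * v y)"
      by (simp only: LIMSEQ_unique)
    then show "(LINT x:?B|lborel. v x - Re (of_real c * g x)) = 0"
      using Bochner_Integration.integral_diff[OF intv intg]
      by (simp add: set_lebesgue_integral_def right_diff_distrib mult.commute)
  qed measurable
  then show ?thesis
    by eventually_elim (simp add: c_def g_def)
qed

lemma AE_abs_le_integral_fourier:
  fixes v :: "real^'n \<Rightarrow> real"
  assumes v: "integrable lborel v" and F: "integrable lborel (fourier v)"
  shows "AE x in lborel. \<bar>v x\<bar> \<le> (LBINT \<xi>. norm (fourier v \<xi>)) / (2 * pi) ^ CARD('n)"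
  using fourier_inversion[OF assms]
proof eventually_elim
  case (elim x)
  let ?I = "LBINT \<xi>. exp (\<i> * of_real (x \<bullet> \<xi>)) * fourier v \<xi>"
  have "\<bar>v x\<bar> \<le> norm ?I / (2 * pi) ^ CARD('n)"
    unfolding elim using abs_Re_le_cmod[of "of_real (1 / (2 * pi) ^ CARD('n)) * ?I"] by (simp add: norm_mult norm_divide norm_power)
  also have "norm ?I \<le> (LBINT \<xi>. norm (exp (\<i> * of_real (x \<bullet> \<xi>)) * fourier v \<xi>))"
    by (rule integral_norm_bound)
  finally show ?case by (simp add: norm_mult divide_right_mono)
qed

text \<open>In the square of \<open>v\<close> one factor is replaced by its inversion formula. After
  Fubini the remaining integral over x is the conjugate of \<open>fourier v\<close>, because
  \<open>v\<close> is real.\<close>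

lemma Plancherel:
  fixes v :: "real^'n \<Rightarrow> real"
  assumes v: "integrable lborel v" and F: "integrable lborel (fourier v)"
  shows "(\<integral>\<^sup>+x. ennreal ((v x)\<^sup>2) \<partial>lborel) = ennreal ((LBINT \<xi>. (norm (fourier v \<xi>))\<^sup>2) / (2 * pi) ^ CARD('n))"
proof -
  have [measurable]: "v \<in> borel_measurable borel"
    using borel_measurable_integrable[OF v] by simp
  define c :: real where "c = 1 / (2 * pi) ^ CARD('n)"
  \<comment> \<open>Inversion makes \<open>v\<close> bounded, and a bounded integrable function is
    square integrable.\<close>
  obtain K where K: "AE x in lborel. \<bar>v x\<bar> \<le> K"
    using AE_abs_le_integral_fourier[OF assms] by blast
  have int2: "integrable lborel (\<lambda>x. (v x)\<^sup>2)"
  proof (rule Bochner_Integration.integrable_bound)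
    show "integrable lborel (\<lambda>x. K * v x)" using v by simp
    show "AE x in lborel. norm ((v x)\<^sup>2) \<le> norm (K * v x)"
      using K
    proof eventually_elim
      case (elim x)
      then have "\<bar>v x\<bar> * \<bar>v x\<bar> \<le> \<bar>K\<bar> * \<bar>v x\<bar>" by (intro mult_right_mono) auto
      then show ?case by (simp add: power2_eq_square abs_mult)
    qed
  qed measurable
  let ?f = "\<lambda>x \<xi>. of_real (v x) * (exp (\<i> * of_real (x \<bullet> \<xi>)) * fourier v \<xi>)"
  have int: "integrable (lborel \<Otimes>\<^sub>M lborel) (\<lambda>(x, \<xi>). ?f x \<xi>)"
  proof (rule Bochner_Integration.integrable_bound)
    show "integrable (lborel \<Otimes>\<^sub>M lborel) (\<lambda>(x, \<xi>). of_real (v x) * fourier v \<xi>)"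
      by (intro integrable_product F) (use v in simp)
  qed (auto simp: norm_mult)
  have "(LBINT x. (v x)\<^sup>2) = (LBINT x. Re (of_real c * (LBINT \<xi>. ?f x \<xi>)))"
  proof (rule integral_cong_AE)
    show "AE x in lborel. (v x)\<^sup>2 = Re (of_real c * (LBINT \<xi>. ?f x \<xi>))"
      using fourier_inversion[OF assms]
      by eventually_elim (simp add: c_def power2_eq_square)
  qed measurable
  also have "\<dots> = Re (of_real c * (LBINT x. (LBINT \<xi>. ?f x \<xi>)))"
    using lborel_pair.integrable_fst'[OF int]
    by (subst integral_Re) (simp_all only: integral_mult_right_zero prod.case integrable_mult_right)
  also have "(LBINT x. (LBINT \<xi>. ?f x \<xi>)) = (LBINT \<xi>. (LBINT x. ?f x \<xi>))"
    using lborel_pair.Fubini_integral[of ?f] int by simp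
  also have "\<dots> = (LBINT \<xi>. of_real ((norm (fourier v \<xi>))\<^sup>2))"
  proof (intro Bochner_Integration.integral_cong refl)
    fix \<xi> :: "real^'n"
    have "cnj (fourier v \<xi>) = (LBINT x. cnj (exp (- \<i> * of_real (x \<bullet> \<xi>)) * of_real (v x)))"
      unfolding fourier_def by (rule Bochner_Integration.integral_cnj[symmetric])
    also have "\<dots> = (LBINT x. of_real (v x) * exp (\<i> * of_real (x \<bullet> \<xi>)))"
      by (intro Bochner_Integration.integral_cong refl) (simp add: exp_cnj)
    finally have A: "cnj (fourier v \<xi>) = (LBINT x. of_real (v x) * exp (\<i> * of_real (x \<bullet> \<xi>)))" .
    have B: "(LBINT x. ?f x \<xi>) = (LBINT x. of_real (v x) * exp (\<i> * of_real (x \<bullet> \<xi>))) * fourier v \<xi>"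
      unfolding mult.assoc[symmetric] by (rule integral_mult_left_zero)
    have "(LBINT x. ?f x \<xi>) = fourier v \<xi> * cnj (fourier v \<xi>)"
      unfolding A B by (rule mult.commute)
    then show "(LBINT x. ?f x \<xi>) = of_real ((norm (fourier v \<xi>))\<^sup>2)"
      unfolding complex_norm_square .
  qed
  also have "\<dots> = of_real (LBINT \<xi>. (norm (fourier v \<xi>))\<^sup>2)"
    by (rule integral_complex_of_real)
  finally have "(LBINT x. (v x)\<^sup>2) = c * (LBINT \<xi>. (norm (fourier v \<xi>))\<^sup>2)"
    by (simp only: of_real_mult[symmetric] Re_complex_of_real)
  then show ?thesis
    using int2 by (subst nn_integral_eq_integral) (auto simp: c_def)
qed

section \<open>The fractional derivative of the heat kernel\<close>

text \<open>With b = beta/2 and L = n/t this is the origin of the factor t^(-beta/2) in the L^1 norm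
  of the profile: the linear bound tames s^(-1-b) at 0, the constant bound makes the tail
  converge.\<close>

lemma nn_integral_powr_min_le:
  fixes b L :: real
  assumes b: "0 < b" "b < 1" and L: "0 < L"
  shows "(\<integral>\<^sup>+s. ennreal (indicator {0<..} s * s powr (-1 - b) * min 2 (L * s)) \<partial>lborel)
    \<le> ennreal ((1 / (1 - b) + 2 / b) * L powr b)"
proof -
  \<comment> \<open>At the scale 1/L both pieces become multiples of L^b. The two bounds cross at
    2/L, but each is valid everywhere, so only the constants are affected.\<close>
  define c where "c = 1 / L"
  have c: "0 < c" using L by (simp add: c_def)
  have "(\<integral>\<^sup>+s. ennreal (indicator {0<..} s * s powr (-1 - b) * min 2 (L * s)) \<partial>lborel)
    \<le> (\<integral>\<^sup>+s. ennreal (L * s powr (- b)) * indicator {0..c} s + ennreal (2 * s powr (-1 - b)) * indicator {c..} s \<partial>lborel)"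
  proof (rule nn_integral_mono)
    fix s :: real
    show "ennreal (indicator {0<..} s * s powr (-1 - b) * min 2 (L * s))
      \<le> ennreal (L * s powr (- b)) * indicator {0..c} s + ennreal (2 * s powr (-1 - b)) * indicator {c..} s"
    proof (cases "0 < s")
      case True
      have eq: "s * s powr (-1 - b) = s powr (- b)"
        using True by (simp add: powr_diff powr_minus field_simps)
      have "s powr (-1 - b) * min 2 (L * s) \<le> L * (s * s powr (-1 - b))"
        using mult_left_mono[of "min 2 (L * s)" "L * s" "s powr (-1 - b)"] by (simp add: mult_ac)
      moreover have "s powr (-1 - b) * min 2 (L * s) \<le> 2 * s powr (-1 - b)"
        using mult_left_mono[of "min 2 (L * s)" 2 "s powr (-1 - b)"] by (simp add: mult_ac)
      ultimately have "ennreal (s powr (-1 - b) * min 2 (L * s)) \<le> ennreal (L * s powr (- b))"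
          "ennreal (s powr (-1 - b) * min 2 (L * s)) \<le> ennreal (2 * s powr (-1 - b))"
        unfolding eq by (auto intro: ennreal_leI)
      then show ?thesis
        using True by (auto simp: indicator_def intro: add_increasing2)
    qed simp
  qed
  also have "\<dots> = ennreal (L * (c powr (1 - b) / (1 - b))) + ennreal (2 * (c powr (- b) / b))"
  proof -
    have "((\<lambda>s. L * s powr (- b)) has_integral L * (c powr (- b + 1) / (- b + 1))) {0..c}"
      using b c by (intro has_integral_mult_right has_integral_powr_from_0) auto
    then have "(\<integral>\<^sup>+s. ennreal (L * s powr (- b)) * indicator {0..c} s \<partial>lborel) = ennreal (L * (c powr (1 - b) / (1 - b)))"
      using L by (subst nn_integral_has_integral_lebesgue') auto
    moreover have "((\<lambda>s. 2 * s powr (- 1 - b)) has_integral 2 * (- (c powr (- 1 - b + 1)) / (- 1 - b + 1))) {c..}"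
      using b c by (intro has_integral_mult_right has_integral_powr_to_inf) auto
    then have "(\<integral>\<^sup>+s. ennreal (2 * s powr (- 1 - b)) * indicator {c..} s \<partial>lborel) = ennreal (2 * (c powr (- b) / b))"
      by (subst nn_integral_has_integral_lebesgue') auto
    ultimately show ?thesis
      by (subst nn_integral_add) auto
  qed
  also have "\<dots> = ennreal ((1 / (1 - b) + 2 / b) * L powr b)"
  proof -
    have "L * c powr (1 - b) = L powr b" "c powr (- b) = L powr b"
      using L by (auto simp: c_def powr_diff powr_minus powr_divide field_simps)
    then show ?thesis
      using b L by (subst ennreal_plus[symmetric]) (auto simp: distrib_right)
  qed
  finally show ?thesis .
qed

text \<open>The power is exp(-a ln(1 + s/t)); then ln(1 + y) <= y and exp z >= 1 + z.\<close>

lemma one_minus_powr_le: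
  fixes t s a :: real
  assumes "0 < t" "0 \<le> s" "0 \<le> a"
  shows "1 - (t / (t + s)) powr a \<le> min 1 (a * (s / t))"
proof -
  have "ln (t / (t + s)) = - ln (1 + s / t)"
    using assms by (simp add: ln_div field_simps)
  moreover have "ln (1 + s / t) \<le> s / t"
    using assms by (intro ln_add_one_self_le_self) auto
  ultimately have "1 - a * (s / t) \<le> 1 + a * ln (t / (t + s))"
    using assms mult_left_mono[of "ln (1 + s / t)" "s / t" a] by simp
  also have "\<dots> \<le> (t / (t + s)) powr a"
    using assms by (simp add: powr_def exp_ge_add_one_self)
  finally show ?thesis by simp
qed

text \<open>Both kernels have integral 1, so the \<open>L\<^sup>1\<close> distance is twice the integral of the positive part,
  and \<open>G(t + s) \<ge> (t / (t + s))\<^bsup>n/2\<^esup> G(t)\<close> bounds the latter.\<close>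

lemma integral_heat_kernel_diff_le:
  assumes t: "0 < t" and s: "0 \<le> s"
  shows "(LBINT x. \<bar>heat_kernel t (x :: real^'n) - heat_kernel (t + s) x\<bar>)
    \<le> min 2 (real CARD('n) / t * s)"
proof -
  define r where "r = (t / (t + s)) powr (real CARD('n) / 2)"
  let ?d = "\<lambda>x::real^'n. heat_kernel t x - heat_kernel (t + s) x"
  note int = integrable_heat_kernel[OF t, where 'n='n] integrable_heat_kernel[of "t + s", where 'n='n]
  have r: "0 \<le> r" "r \<le> 1"
    using t s by (auto simp: r_def intro!: powr_le1)
  have le: "max 0 (?d x) \<le> (1 - r) * heat_kernel t x" for x
  proof -
    have "r * heat_kernel t x = (t / (t + s)) powr (real CARD('n) / 2) * (4 * pi * t) powr (- real CARD('n) / 2) * exp (- (norm x)\<^sup>2 / (4 * t))"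
      by (simp add: r_def heat_kernel_def)
    also have "(t / (t + s)) powr (real CARD('n) / 2) * (4 * pi * t) powr (- real CARD('n) / 2) = (4 * pi * (t + s)) powr (- real CARD('n) / 2)"
    proof -
      have "t / (t + s) = (4 * pi * t) / (4 * pi * (t + s))" by simp
      then show ?thesis using t s
        by (simp only: powr_divide) (simp add: powr_minus field_simps)
    qed
    also have "\<dots> * exp (- (norm x)\<^sup>2 / (4 * t)) \<le> heat_kernel (t + s) x"
      unfolding heat_kernel_def using t s by (intro mult_left_mono) (auto intro!: divide_left_mono)
    finally have "?d x \<le> (1 - r) * heat_kernel t x" by (simp add: algebra_simps)
    then show ?thesis using r by simp
  qed
  have "(LBINT x. \<bar>?d x\<bar>) = (LBINT x. 2 * max 0 (?d x) - ?d x)"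
    by (intro Bochner_Integration.integral_cong refl) (simp add: max_def)
  also have "\<dots> = 2 * (LBINT x. max 0 (?d x))"
    using int t s by (simp add: integral_heat_kernel)
  also have "(LBINT x. max 0 (?d x)) \<le> (LBINT x. (1 - r) * heat_kernel t (x::real^'n))"
    using int t s le by (intro integral_mono) auto
  also have "\<dots> = 1 - r" using t by (simp add: integral_heat_kernel)
  also have "1 - r \<le> min 1 (real CARD('n) / 2 * (s / t))"
    unfolding r_def using t s by (intro one_minus_powr_le) auto
  also have "2 * min 1 (real CARD('n) / 2 * (s / t)) = min 2 (real CARD('n) / t * s)"
    using t by (auto simp: min_def field_simps)
  finally show ?thesis by simp
qed

section \<open>The profile D^beta G as a superposition of heat kernels\<close>

text \<open>Normalising constant of the integral formula for |xi|^beta; for 0 < beta < 2 it equals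
  Gamma(1 - beta/2) / (beta/2).\<close>

definition frac_const :: "real \<Rightarrow> real" where
  "frac_const \<beta> = (LBINT s. indicator {0<..} s * s powr (-1 - \<beta> / 2) * (1 - exp (- s)))"

text \<open>The integral of a non-integrable function is 0 by convention, so integrability comes
  first. A vanishing integral would then force the integrand, which is positive on (0,1), to vanish
  almost everywhere.\<close>

lemma frac_const_pos:
  assumes "0 < \<beta>" "\<beta> < 2"
  shows "0 < frac_const \<beta>"
proof -
  let ?f = "\<lambda>s::real. indicator {0<..} s * s powr (-1 - \<beta> / 2) * (1 - exp (- s))"
  have nn: "0 \<le> ?f s" for s by (auto simp: indicator_def)
  have int: "integrable lborel ?f"
  proof (subst integrable_iff_bounded, intro conjI)
    have "(\<integral>\<^sup>+s. ennreal (norm (?f s)) \<partial>lborel)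
      \<le> (\<integral>\<^sup>+s. ennreal (indicator {0<..} s * s powr (-1 - \<beta> / 2) * min 2 (1 * s)) \<partial>lborel)"
    proof (intro nn_integral_mono ennreal_leI)
      fix s :: real
      have "1 - exp (- s) \<le> min 2 s"
        using exp_ge_add_one_self[of "- s"] exp_ge_zero[of "- s"] by (auto simp: min_def simp del: exp_ge_zero)
      then show "norm (?f s) \<le> indicator {0<..} s * s powr (-1 - \<beta> / 2) * min 2 (1 * s)"
        by (auto simp: indicator_def abs_mult intro!: mult_left_mono)
    qed
    also have "\<dots> \<le> ennreal ((1 / (1 - \<beta> / 2) + 2 / (\<beta> / 2)) * 1 powr (\<beta> / 2))"
      using assms by (intro nn_integral_powr_min_le) auto
    finally show "(\<integral>\<^sup>+s. ennreal (norm (?f s)) \<partial>lborel) < \<infinity>"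
      using le_less_trans by fastforce
  qed measurable
  have "frac_const \<beta> \<noteq> 0"
  proof
    assume "frac_const \<beta> = 0"
    then have "AE s in lborel. ?f s = 0"
      unfolding frac_const_def by (subst (asm) integral_nonneg_eq_0_iff_AE[OF int]) (use nn in auto)
    then have "AE s in lborel. s \<notin> {0<..<1::real}"
      by eventually_elim auto
    then have "{0<..<1::real} \<in> null_sets lborel"
      by (subst AE_iff_null_sets) auto
    then show False using null_setsD1 by fastforce
  qed
  moreover have "0 \<le> frac_const \<beta>"
    unfolding frac_const_def using nn by (intro integral_nonneg_AE AE_I2) auto
  ultimately show ?thesis by simp
qed

lemma integral_frac_scaled:
  fixes l :: real
  assumes "0 < l"
  shows "(LBINT s. indicator {0<..} s * s powr (-1 - \<beta> / 2) * (1 - exp (- s * l))) = l powr (\<beta> / 2) * frac_const \<beta>"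
proof -
  have "(LBINT s. indicator {0<..} s * s powr (-1 - \<beta> / 2) * (1 - exp (- s * l)))
    = \<bar>1 / l\<bar> *\<^sub>R (LBINT s. indicator {0<..} (0 + 1 / l * s) * (0 + 1 / l * s) powr (-1 - \<beta> / 2) * (1 - exp (- (0 + 1 / l * s) * l)))"
    using assms by (intro lborel_integral_real_affine) auto
  also have "\<dots> = (LBINT s. l powr (\<beta> / 2) * (indicator {0<..} s * s powr (-1 - \<beta> / 2) * (1 - exp (- s))))"
    unfolding integral_scaleR_right[symmetric]
  proof (intro Bochner_Integration.integral_cong refl)
    fix s :: real
    show "\<bar>1 / l\<bar> *\<^sub>R (indicator {0<..} (0 + 1 / l * s) * (0 + 1 / l * s) powr (-1 - \<beta> / 2) * (1 - exp (- (0 + 1 / l * s) * l)))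
      = l powr (\<beta> / 2) * (indicator {0<..} s * s powr (-1 - \<beta> / 2) * (1 - exp (- s)))"
    proof (cases "0 < s")
      case True
      have "(s / l) powr (-1 - \<beta> / 2) / l = l powr (\<beta> / 2) * s powr (-1 - \<beta> / 2)"
        using True assms powr_add[of l "-1 - \<beta> / 2" 1] by (simp add: powr_divide powr_minus field_simps)
      then show ?thesis using True assms by (simp add: indicator_def mult_ac) (simp add: field_simps)
    next
      case False
      then show ?thesis using assms by (simp add: indicator_def zero_less_divide_iff)
    qed
  qed
  finally show ?thesis by (simp add: frac_const_def)
qed

text \<open>The kernel is obtained from \<open>|\<xi>|\<^sup>\<beta> = c \<integral>\<^sub>0\<^sup>\<infinity> (1 - e\<^bsup>-s|\<xi>|\<^sup>2\<^esup>) s\<^bsup>-1-\<beta>/2\<^esup> ds\<close>.\<close>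

lemma frac_deriv_kernel_exists:
  fixes \<beta> t :: real
  assumes \<beta>: "0 < \<beta>" "\<beta> < 2" and t: "0 < t"
  shows "\<exists>V::real^'n \<Rightarrow> real. integrable lborel V \<and>
    (\<forall>\<xi>. fourier V \<xi> = of_real (norm \<xi> powr \<beta>) * fourier (heat_kernel t) \<xi>) \<and>
    L1_norm V \<le> (1 / (1 - \<beta> / 2) + 2 / (\<beta> / 2)) * (real CARD('n) / t) powr (\<beta> / 2) / frac_const \<beta>"
proof -
  define c where "c = 1 / frac_const \<beta>"
  have c: "0 < c" using frac_const_pos[OF \<beta>] by (simp add: c_def)
  define B where "B = (1 / (1 - \<beta> / 2) + 2 / (\<beta> / 2)) * (real CARD('n) / t) powr (\<beta> / 2)"
  have B: "0 \<le> B" using \<beta> by (simp add: B_def)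
  define w where "w s = indicator {0<..} s * s powr (-1 - \<beta> / 2)" for s :: real
  have w0: "0 \<le> w s" for s by (simp add: w_def)
  have [measurable]: "w \<in> borel_measurable borel" unfolding w_def by measurable
  \<comment> \<open>The Fourier transform of \<open>K s\<close> is the integrand of the formula for
    |xi|^beta times the transform of the kernel at time t. The difference of kernels has L^1 norm
    O(s) near s = 0, which compensates the singular weight.\<close>
  define K where "K s x = c * w s * (heat_kernel t x - heat_kernel (t + s) x)" for s and x :: "real^'n"
  have [measurable]: "(\<lambda>(s, x). K s x) \<in> borel_measurable (borel \<Otimes>\<^sub>M borel)"
    unfolding K_def split_beta' by measurable
  have bound: "(\<integral>\<^sup>+s. \<integral>\<^sup>+x. ennreal \<bar>K s x\<bar> \<partial>lborel \<partial>lborel) \<le> ennreal (c * B)"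
  proof -
    have "L1_ennnorm (K s) \<le> ennreal c * ennreal (w s * min 2 (real CARD('n) / t * s))" for s
    proof (cases "0 < s")
      case True
      have "integrable lborel (\<lambda>x::real^'n. \<bar>heat_kernel t x - heat_kernel (t + s) x\<bar>)"
        using t True by (intro integrable_abs Bochner_Integration.integrable_diff integrable_heat_kernel) auto
      then have "L1_ennnorm (K s) = ennreal (c * w s * (LBINT x. \<bar>heat_kernel t (x::real^'n) - heat_kernel (t + s) x\<bar>))"
        unfolding K_def using c w0[of s]
        by (subst nn_integral_eq_integral) (auto simp: abs_mult)
      also have "\<dots> \<le> ennreal (c * w s * min 2 (real CARD('n) / t * s))"
        using t True c w0[of s] by (intro ennreal_leI mult_left_mono integral_heat_kernel_diff_le) auto
      finally show ?thesis using c by (simp add: ennreal_mult' mult.assoc)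
    qed (auto simp: K_def w_def)
    then have "(\<integral>\<^sup>+s. \<integral>\<^sup>+x. ennreal \<bar>K s x\<bar> \<partial>lborel \<partial>lborel)
      \<le> (\<integral>\<^sup>+s. ennreal c * ennreal (w s * min 2 (real CARD('n) / t * s)) \<partial>lborel)"
      by (intro nn_integral_mono) auto
    also have "\<dots> = ennreal c * (\<integral>\<^sup>+s. ennreal (w s * min 2 (real CARD('n) / t * s)) \<partial>lborel)"
      by (rule nn_integral_cmult) measurable
    also have "\<dots> \<le> ennreal c * ennreal B"
      unfolding w_def B_def using \<beta> t by (intro mult_left_mono nn_integral_powr_min_le) auto
    finally show ?thesis using c B by (simp add: ennreal_mult)
  qed
  have int: "integrable (lborel \<Otimes>\<^sub>M lborel) (\<lambda>(s, x). K s x)"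
  proof (subst integrable_iff_bounded, intro conjI)
    have "(\<integral>\<^sup>+z. ennreal (norm (case z of (s, x) \<Rightarrow> K s x)) \<partial>(lborel \<Otimes>\<^sub>M lborel))
      = (\<integral>\<^sup>+s. \<integral>\<^sup>+x. ennreal \<bar>K s x\<bar> \<partial>lborel \<partial>lborel)"
      by (subst lborel.nn_integral_fst[symmetric]) auto
    also have "\<dots> < \<infinity>" using bound le_less_trans by fastforce
    finally show "(\<integral>\<^sup>+z. ennreal (norm (case z of (s, x) \<Rightarrow> K s x)) \<partial>(lborel \<Otimes>\<^sub>M lborel)) < \<infinity>" .
  qed measurable
  define V where "V x = (LBINT s. K s x)" for x
  have [measurable]: "V \<in> borel_measurable borel" unfolding V_def by measurable
  have V_le: "L1_ennnorm V \<le> ennreal (c * B)"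
  proof -
    have "L1_ennnorm V \<le> (\<integral>\<^sup>+x. \<integral>\<^sup>+s. ennreal \<bar>K s x\<bar> \<partial>lborel \<partial>lborel)"
    proof (rule nn_integral_mono_AE)
      have "AE x in lborel. integrable lborel (\<lambda>s. K s x)"
        using lborel_pair.AE_integrable_snd[OF int] .
      then show "AE x in lborel. ennreal \<bar>V x\<bar> \<le> (\<integral>\<^sup>+s. ennreal \<bar>K s x\<bar> \<partial>lborel)"
      proof eventually_elim
        case (elim x)
        then show ?case
          unfolding V_def using integral_norm_bound_ennreal[OF elim] by simp
      qed
    qed
    also have "\<dots> = (\<integral>\<^sup>+s. \<integral>\<^sup>+x. ennreal \<bar>K s x\<bar> \<partial>lborel \<partial>lborel)"
      by (rule lborel_pair.Fubini') measurable
    finally show ?thesis using bound by simp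
  qed
  have intV: "integrable lborel V"
    by (subst integrable_iff_bounded) (use V_le le_less_trans in fastforce)
  have "ennreal (L1_norm V) \<le> ennreal (c * B)"
    using V_le intV by (subst nn_integral_eq_integral[symmetric]) auto
  then have norm_le: "L1_norm V \<le> c * B"
    using c B by (subst (asm) ennreal_le_iff) auto
  have fourier_V: "fourier V \<xi> = of_real (norm \<xi> powr \<beta>) * fourier (heat_kernel t) \<xi>" for \<xi>
  proof -
    let ?e = "\<lambda>x. exp (- \<i> * of_real (x \<bullet> \<xi>)) :: complex"
    let ?f = "\<lambda>s x. ?e x * of_real (K s x)"
    have intf: "integrable (lborel \<Otimes>\<^sub>M lborel) (\<lambda>(s, x). ?f s x)"
      by (rule Bochner_Integration.integrable_bound[OF int]) (auto simp: norm_mult)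
    have "fourier V \<xi> = (LBINT x. (LBINT s. ?f s x))"
      unfolding fourier_def V_def by simp
    also have "\<dots> = (LBINT s. (LBINT x. ?f s x))"
      using lborel_pair.Fubini_integral[of ?f] intf by simp
    also have "\<dots> = (LBINT s. of_real (c * exp (- t * (norm \<xi>)\<^sup>2) * (indicator {0<..} s * s powr (-1 - \<beta> / 2) * (1 - exp (- s * (norm \<xi>)\<^sup>2)))))"
    proof (intro Bochner_Integration.integral_cong refl)
      fix s :: real
      have "(LBINT x. ?f s x) = of_real (c * w s) * fourier (\<lambda>x. heat_kernel t x - heat_kernel (t + s) x) \<xi>"
        unfolding fourier_def K_def by (simp add: mult.left_commute)
      also have "\<dots> = of_real (c * exp (- t * (norm \<xi>)\<^sup>2) * (w s * (1 - exp (- s * (norm \<xi>)\<^sup>2))))"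
      proof (cases "0 < s")
        case True
        have "exp (- ((t + s) * (norm \<xi>)\<^sup>2)) = exp (- (t * (norm \<xi>)\<^sup>2)) * exp (- (s * (norm \<xi>)\<^sup>2))"
          by (simp add: exp_add[symmetric] algebra_simps)
        then show ?thesis
          using t True
          by (simp add: fourier_diff integrable_heat_kernel fourier_heat_kernel algebra_simps
              flip: of_real_diff of_real_mult)
      qed (simp add: w_def)
      finally show "(LBINT x. ?f s x) = of_real (c * exp (- t * (norm \<xi>)\<^sup>2) * (indicator {0<..} s * s powr (-1 - \<beta> / 2) * (1 - exp (- s * (norm \<xi>)\<^sup>2))))"
        by (simp add: w_def)
    qed
    also have "\<dots> = of_real (c * exp (- t * (norm \<xi>)\<^sup>2) * (LBINT s. indicator {0<..} s * s powr (-1 - \<beta> / 2) * (1 - exp (- s * (norm \<xi>)\<^sup>2))))"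
      unfolding integral_complex_of_real by simp
    also have "(LBINT s. indicator {0<..} s * s powr (-1 - \<beta> / 2) * (1 - exp (- s * (norm \<xi>)\<^sup>2))) = norm \<xi> powr \<beta> / c"
    proof (cases "\<xi> = 0")
      case False
      then have "((norm \<xi>)\<^sup>2) powr (\<beta> / 2) = norm \<xi> powr \<beta>"
        using powr_powr[of "norm \<xi>" 2 "\<beta> / 2"] by simp
      then show ?thesis using False by (subst integral_frac_scaled) (auto simp: c_def)
    qed simp
    finally show ?thesis using c t by (simp add: fourier_heat_kernel)
  qed
  show ?thesis
    using intV fourier_V norm_le by (intro exI[of _ V]) (auto simp: B_def c_def)
qed

lemma Lp_norm_1: "Lp_norm 1 f = L1_ennnorm f"
  by (auto simp: Lp_norm_def Let_def less_top)

lemma Lp_1_iff_integrable: "f \<in> Lp 1 \<longleftrightarrow> integrable lborel f"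
  by (auto simp: Lp_def Lp_norm_1 integrable_iff_bounded)

text \<open>\<open>frac_deriv\<close> is a choice, and its defining property is available only once
  some function has it; \<open>frac_deriv_kernel_exists\<close> supplies that witness.\<close>

lemma
  fixes \<beta> t :: real
  assumes \<beta>: "0 < \<beta>" "\<beta> < 2" and t: "0 < t"
  shows integrable_frac_deriv: "integrable lborel (frac_deriv \<beta> (heat_kernel t) :: real^'n \<Rightarrow> real)"
    and fourier_frac_deriv: "\<And>\<xi>::real^'n. fourier (frac_deriv \<beta> (heat_kernel t)) \<xi> = of_real (norm \<xi> powr \<beta> * exp (- t * (norm \<xi>)\<^sup>2))"
proof -
  let ?V = "frac_deriv \<beta> (heat_kernel t) :: real^'n \<Rightarrow> real"
  have "\<exists>v::real^'n \<Rightarrow> real. v \<in> Lp 1 \<and> (\<forall>\<xi>. fourier v \<xi> = of_real (norm \<xi> powr \<beta>) * fourier (heat_kernel t) \<xi>)"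
    using frac_deriv_kernel_exists[OF assms, where 'n='n] by (auto simp: Lp_1_iff_integrable)
  then have "?V \<in> Lp 1 \<and> (\<forall>\<xi>. fourier ?V \<xi> = of_real (norm \<xi> powr \<beta>) * fourier (heat_kernel t) \<xi>)"
    unfolding frac_deriv_def by (rule someI_ex)
  then show "integrable lborel ?V" "\<And>\<xi>. fourier ?V \<xi> = of_real (norm \<xi> powr \<beta> * exp (- t * (norm \<xi>)\<^sup>2))"
    using t by (auto simp: Lp_1_iff_integrable fourier_heat_kernel)
qed

section \<open>Convolution theorem and uniqueness of the Fourier transform\<close>

lemma fourier_convolution:
  fixes k v :: "real^'n \<Rightarrow> real"
  assumes k: "integrable lborel k" and v: "integrable lborel v"
  shows "fourier (\<lambda>x. LBINT y. k (x - y) * v y) \<xi> = fourier k \<xi> * fourier v \<xi>"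
proof -
  have [measurable]: "k \<in> borel_measurable borel" "v \<in> borel_measurable borel"
    using borel_measurable_integrable[OF k] borel_measurable_integrable[OF v] by auto
  let ?e = "\<lambda>x. exp (- \<i> * of_real (x \<bullet> \<xi>)) :: complex"
  let ?f = "\<lambda>x y. ?e x * of_real (k (x - y) * v y)"
  have int: "integrable (lborel \<Otimes>\<^sub>M lborel) (\<lambda>(x, y). ?f x y)"
    by (rule Bochner_Integration.integrable_bound[OF integrable_convolution_pair[OF k v]]) (auto simp: norm_mult)
  have "fourier (\<lambda>x. LBINT y. k (x - y) * v y) \<xi> = (LBINT x. (LBINT y. ?f x y))"
    unfolding fourier_def
    by (simp only: integral_complex_of_real[symmetric] integral_mult_right_zero)
  also have "\<dots> = (LBINT y. (LBINT x. ?f x y))"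
    using lborel_pair.Fubini_integral[of ?f] int by simp
  also have "\<dots> = (LBINT y. fourier k \<xi> * (?e y * of_real (v y)))"
  proof (intro Bochner_Integration.integral_cong refl)
    fix y :: "real^'n"
    have "(LBINT x. ?f x y) = (LBINT x. (\<lambda>z. ?e z * of_real (k z)) (x - y) * (?e y * of_real (v y)))"
      by (intro Bochner_Integration.integral_cong refl)
         (simp add: inner_diff_left right_diff_distrib exp_diff exp_minus field_simps)
    also have "\<dots> = (LBINT x. (\<lambda>z. ?e z * of_real (k z)) (x - y)) * (?e y * of_real (v y))"
      by (rule integral_mult_left_zero)
    also have "(LBINT x. (\<lambda>z. ?e z * of_real (k z)) (x - y)) = fourier k \<xi>"
      unfolding fourier_def by (rule integral_lborel_translate) measurable
    finally show "(LBINT x. ?f x y) = fourier k \<xi> * (?e y * of_real (v y))" .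
  qed
  also have "\<dots> = fourier k \<xi> * fourier v \<xi>"
    by (simp only: integral_mult_right_zero fourier_def[of v])
  finally show ?thesis .
qed

lemma integrable_convolution:
  fixes k v :: "'a::euclidean_space \<Rightarrow> real"
  assumes "integrable lborel k" "integrable lborel v"
  shows "integrable lborel (\<lambda>x. LBINT y. k (x - y) * v y)"
  using lborel_pair.integrable_fst'[OF integrable_convolution_pair[OF assms]] by simp

lemma nn_integral_abs_convolution_le:
  fixes k v :: "'a::euclidean_space \<Rightarrow> real"
  assumes k: "integrable lborel k" and v: "integrable lborel v"
  shows "(\<integral>\<^sup>+x. ennreal \<bar>LBINT y. k (x - y) * v y\<bar> \<partial>lborel)
    \<le> ennreal (L1_norm k * L1_norm v)"
proof -
  have "(\<integral>\<^sup>+x. ennreal \<bar>LBINT y. k (x - y) * v y\<bar> \<partial>lborel)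
    \<le> (\<integral>\<^sup>+x. \<integral>\<^sup>+y. ennreal \<bar>k (x - y) * v y\<bar> \<partial>lborel \<partial>lborel)"
  proof (rule nn_integral_mono_AE)
    have "AE x in lborel. integrable lborel (\<lambda>y. k (x - y) * v y)"
      using lborel_pair.AE_integrable_fst'[OF integrable_convolution_pair[OF assms]] by simp
    then show "AE x in lborel. ennreal \<bar>LBINT y. k (x - y) * v y\<bar> \<le> (\<integral>\<^sup>+y. ennreal \<bar>k (x - y) * v y\<bar> \<partial>lborel)"
    proof eventually_elim
      case (elim x)
      then show ?case using integral_norm_bound_ennreal[OF elim] by simp
    qed
  qed
  also have "\<dots> = ennreal (L1_norm k * L1_norm v)"
    by (simp add: nn_integral_convolution[OF assms] ennreal_mult)
  finally show ?thesis .
qed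

lemma fourier_heat:
  assumes "integrable lborel v" "0 < s"
  shows "fourier (heat s v) \<xi> = of_real (exp (- s * (norm \<xi>)\<^sup>2)) * fourier v \<xi>"
  using fourier_convolution[OF integrable_heat_kernel[OF assms(2)] assms(1), of \<xi>]
  by (simp add: heat_def[abs_def] fourier_heat_kernel assms(2))

text \<open>The difference has Fourier transform 0 off a null set, so that transform is integrable
  and the supremum bound from inversion is 0. The origin is exempt because the transform of I_beta
  u_0 is prescribed only away from it.\<close>

lemma fourier_eq_imp_AE_eq:
  fixes v w :: "real^'n \<Rightarrow> real"
  assumes v: "integrable lborel v" and w: "integrable lborel w"
    and eq: "\<And>\<xi>. \<xi> \<noteq> 0 \<Longrightarrow> fourier v \<xi> = fourier w \<xi>"
  shows "AE x in lborel. v x = w x"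
proof -
  let ?d = "\<lambda>x. v x - w x"
  have [measurable]: "v \<in> borel_measurable borel" "w \<in> borel_measurable borel"
    using borel_measurable_integrable[OF v] borel_measurable_integrable[OF w] by auto
  have AE0: "AE \<xi> in lborel. fourier ?d \<xi> = 0"
    using AE_lborel_singleton[of 0] by eventually_elim (simp add: fourier_diff v w eq)
  then have "integrable lborel (fourier ?d)"
    by (subst integrable_cong_AE[where g="\<lambda>_. 0"]) auto
  moreover have "(LBINT \<xi>. norm (fourier ?d \<xi>)) = 0"
    using AE0 by (intro integral_eq_zero_AE) (auto elim: eventually_mono)
  ultimately show ?thesis
    using AE_abs_le_integral_fourier[of ?d] v w by simp
qed

section \<open>Asymptotics of the heat flow\<close>

text \<open>Half of the Gaussian absorbs the power: r^gamma <= 1 + r^2 and r^2 exp(-c r^2/2) <= 2/c.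
  The range gamma <= 2 covers the exponents beta and 2 beta that occur later.\<close>

lemma powr_mult_gaussian_le:
  fixes r \<gamma> c :: real
  assumes "0 \<le> \<gamma>" "\<gamma> \<le> 2" "0 < c" "0 \<le> r"
  shows "r powr \<gamma> * exp (- c * r\<^sup>2) \<le> (1 + 2 / c) * exp (- (c / 2) * r\<^sup>2)"
proof -
  have le: "r powr \<gamma> \<le> 1 + r\<^sup>2"
  proof (cases "r \<le> 1")
    case True
    then have "r powr \<gamma> \<le> 1" using assms by (intro powr_le1) auto
    then show ?thesis by (simp add: add_increasing2)
  next
    case False
    then have "r powr \<gamma> \<le> r powr 2" using assms by (intro powr_mono) auto
    then show ?thesis using False by simp
  qed
  have "c / 2 * r\<^sup>2 * exp (- (c / 2) * r\<^sup>2) \<le> 1"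
    using exp_ge_add_one_self[of "c / 2 * r\<^sup>2"] by (simp add: exp_minus field_simps)
  then have sq: "r\<^sup>2 * exp (- (c / 2) * r\<^sup>2) \<le> 2 / c"
    using assms by (simp add: field_simps)
  have "r powr \<gamma> * exp (- (c / 2) * r\<^sup>2) \<le> (1 + r\<^sup>2) * exp (- (c / 2) * r\<^sup>2)"
    using le by (intro mult_right_mono) auto
  also have "\<dots> \<le> 1 + 2 / c"
    unfolding distrib_right using sq assms by (intro add_mono) auto
  finally have "r powr \<gamma> * exp (- (c / 2) * r\<^sup>2) \<le> 1 + 2 / c" .
  then have "r powr \<gamma> * exp (- (c / 2) * r\<^sup>2) * exp (- (c / 2) * r\<^sup>2) \<le> (1 + 2 / c) * exp (- (c / 2) * r\<^sup>2)"
    by (intro mult_right_mono) auto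
  then show ?thesis
    by (simp add: mult.assoc exp_add[symmetric])
qed

lemma integrable_powr_mult_gaussian:
  fixes \<gamma> c :: real
  assumes "0 \<le> \<gamma>" "\<gamma> \<le> 2" "0 < c"
  shows "integrable lborel (\<lambda>\<xi>::real^'n. norm \<xi> powr \<gamma> * exp (- c * (norm \<xi>)\<^sup>2))"
proof (rule Bochner_Integration.integrable_bound)
  show "integrable lborel (\<lambda>\<xi>::real^'n. (1 + 2 / c) * exp (- (c / 2) * (norm \<xi>)\<^sup>2))"
    using assms by (intro integrable_mult_right integrable_gaussian) auto
  show "AE \<xi> in lborel. norm (norm (\<xi>::real^'n) powr \<gamma> * exp (- c * (norm \<xi>)\<^sup>2)) \<le> norm ((1 + 2 / c) * exp (- (c / 2) * (norm \<xi>)\<^sup>2))"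
  proof (rule AE_I2)
    fix \<xi> :: "real^'n"
    show "norm (norm \<xi> powr \<gamma> * exp (- c * (norm \<xi>)\<^sup>2)) \<le> norm ((1 + 2 / c) * exp (- (c / 2) * (norm \<xi>)\<^sup>2))"
      using powr_mult_gaussian_le[OF assms, of "norm \<xi>"] assms by (simp add: abs_mult)
  qed
qed measurable

text \<open>Substituting \<open>\<xi> = \<eta> / \<surd>t\<close> turns the left-hand side into
  \<open>\<integral> |\<eta>|\<^sup>\<gamma> e\<^bsup>-c|\<eta>|\<^sup>2\<^esup> m(\<eta> / \<surd>t) d\<eta>\<close>.\<close>

lemma weighted_gaussian_integral_tendsto_0:
  fixes m :: "real^'n \<Rightarrow> real" and \<gamma> c :: real
  assumes \<gamma>: "0 \<le> \<gamma>" "\<gamma> \<le> 2" and c: "0 < c"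
    and [measurable]: "m \<in> borel_measurable borel"
    and bound: "\<And>\<xi>. \<bar>m \<xi>\<bar> \<le> B" and lim: "(m \<longlongrightarrow> 0) (at 0)"
  shows "((\<lambda>t. t powr (real CARD('n) / 2 + \<gamma> / 2) *
      (LBINT \<xi>. norm \<xi> powr \<gamma> * exp (- c * t * (norm \<xi>)\<^sup>2) * m \<xi>)) \<longlongrightarrow> 0) at_top"
proof -
  let ?w = "\<lambda>\<eta>::real^'n. norm \<eta> powr \<gamma> * exp (- c * (norm \<eta>)\<^sup>2)"
  have int: "integrable lborel (\<lambda>\<eta>. ?w \<eta> * B)"
    by (intro integrable_mult_left integrable_powr_mult_gaussian \<gamma> c)
  have "((\<lambda>t. \<integral>\<eta>. ?w \<eta> * m ((1 / sqrt t) *\<^sub>R \<eta>) \<partial>lborel) \<longlongrightarrow> (\<integral>\<eta>. 0 \<partial>(lborel :: (real^'n) measure))) at_top"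
  proof (rule integral_dominated_convergence_at_top[OF _ _ int])
    show "eventually (\<lambda>t. AE \<eta> in lborel. norm (?w \<eta> * m ((1 / sqrt t) *\<^sub>R \<eta>)) \<le> ?w \<eta> * B) at_top"
      using bound by (intro always_eventually allI AE_I2) (auto simp: abs_mult intro!: mult_left_mono)
    \<comment> \<open>The point 0 is discarded: rescaling leaves it fixed, and \<open>lim\<close>
      says nothing about the value of \<open>m\<close> there.\<close>
    show "AE \<eta> in lborel. ((\<lambda>t. ?w \<eta> * m ((1 / sqrt t) *\<^sub>R \<eta>)) \<longlongrightarrow> 0) at_top"
      using AE_lborel_singleton[of 0]
    proof eventually_elim
      case (elim \<eta>)
      have "((\<lambda>t. (1 / sqrt t) *\<^sub>R \<eta>) \<longlongrightarrow> 0 *\<^sub>R \<eta>) at_top"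
        by (intro tendsto_intros tendsto_divide_0[OF tendsto_const] filterlim_at_top_imp_at_infinity sqrt_at_top)
      moreover have "eventually (\<lambda>t. (1 / sqrt t) *\<^sub>R \<eta> \<noteq> 0) at_top"
        using eventually_gt_at_top[of 0] by eventually_elim (use elim in auto)
      ultimately have "filterlim (\<lambda>t. (1 / sqrt t) *\<^sub>R \<eta>) (at 0) at_top"
        by (simp add: filterlim_at)
      then have "((\<lambda>t. m ((1 / sqrt t) *\<^sub>R \<eta>)) \<longlongrightarrow> 0) at_top"
        by (rule filterlim_compose[OF lim])
      then show ?case by (rule tendsto_mult_right_zero)
    qed
  qed measurable
  then have "((\<lambda>t. LBINT \<eta>. ?w \<eta> * m ((1 / sqrt t) *\<^sub>R \<eta>)) \<longlongrightarrow> 0) at_top" by simp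
  moreover have "eventually (\<lambda>t. (LBINT \<eta>. ?w \<eta> * m ((1 / sqrt t) *\<^sub>R \<eta>)) =
     t powr (real CARD('n) / 2 + \<gamma> / 2) *
      (LBINT \<xi>. norm \<xi> powr \<gamma> * exp (- c * t * (norm \<xi>)\<^sup>2) * m \<xi>)) at_top"
    using eventually_gt_at_top[of 0]
  proof eventually_elim
    case (elim t)
    let ?c = "1 / sqrt t"
    let ?f = "\<lambda>\<xi>::real^'n. norm \<xi> powr \<gamma> * exp (- c * t * (norm \<xi>)\<^sup>2) * m \<xi>"
    have "(LBINT \<xi>. ?f \<xi>) = \<bar>?c\<bar> ^ CARD('n) *\<^sub>R (LBINT \<xi>. ?f (0 + ?c *\<^sub>R \<xi>))"
      using elim integral_lborel_affine[of ?f ?c 0] by simp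
    also have "\<bar>?c\<bar> ^ CARD('n) = t powr (- real CARD('n) / 2)"
      using elim by (simp add: powr_half_sqrt[symmetric] powr_minus_divide[symmetric] powr_powr powr_realpow[symmetric])
    also have "(\<lambda>\<xi>. ?f (0 + ?c *\<^sub>R \<xi>)) = (\<lambda>\<xi>. t powr (- \<gamma> / 2) * (?w \<xi> * m (?c *\<^sub>R \<xi>)))"
    proof
      fix \<xi> :: "real^'n"
      have "(norm \<xi> / sqrt t) powr \<gamma> = t powr (- \<gamma> / 2) * norm \<xi> powr \<gamma>"
        using elim by (simp add: powr_divide powr_half_sqrt[symmetric] powr_powr powr_minus field_simps)
      then show "?f (0 + ?c *\<^sub>R \<xi>) = t powr (- \<gamma> / 2) * (?w \<xi> * m (?c *\<^sub>R \<xi>))"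
        using elim by (simp add: power_divide)
    qed
    finally have eq: "(LBINT \<xi>. ?f \<xi>) = t powr (- real CARD('n) / 2) * (t powr (- \<gamma> / 2) * (LBINT \<eta>. ?w \<eta> * m (?c *\<^sub>R \<eta>)))"
      by simp
    have "t powr (real CARD('n) / 2 + \<gamma> / 2) * (t powr (- real CARD('n) / 2) * t powr (- \<gamma> / 2)) = 1"
      using elim by (simp add: powr_add[symmetric])
    then show ?case
      unfolding eq by (simp only: mult.assoc[symmetric] mult_1)
  qed
  ultimately show ?thesis
    by (rule Lim_transform_eventually)
qed

section \<open>The linear error in frequency space\<close>

definition linear_error :: "real \<Rightarrow> real \<Rightarrow> (real^'n \<Rightarrow> real) \<Rightarrow> real \<Rightarrow> real^'n \<Rightarrow> real" where
  "linear_error \<beta> A u0 t x = heat t u0 x - A * frac_deriv \<beta> (heat_kernel t) x"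

lemma integrable_linear_error:
  fixes u0 :: "real^'n \<Rightarrow> real"
  assumes "integrable lborel u0" "0 < \<beta>" "\<beta> < 2" "0 < t"
  shows "integrable lborel (linear_error \<beta> A u0 t)"
  unfolding linear_error_def[abs_def]
  by (intro Bochner_Integration.integrable_diff integrable_mult_right integrable_heat integrable_frac_deriv assms)

lemma fourier_linear_error:
  fixes u0 :: "real^'n \<Rightarrow> real"
  assumes u0: "integrable lborel u0" and \<beta>: "0 < \<beta>" "\<beta> < 2" and t: "0 < t"
  shows "fourier (linear_error \<beta> A u0 t) \<xi> =
    of_real (exp (- t * (norm \<xi>)\<^sup>2)) * (fourier u0 \<xi> - of_real (A * norm \<xi> powr \<beta>))"
proof -
  have "fourier (linear_error \<beta> A u0 t) \<xi> = fourier (heat t u0) \<xi> - fourier (\<lambda>x. A * frac_deriv \<beta> (heat_kernel t) x) \<xi>"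
    unfolding linear_error_def[abs_def]
    by (intro fourier_diff integrable_mult_right integrable_heat integrable_frac_deriv assms)
  also have "\<dots> = of_real (exp (- t * (norm \<xi>)\<^sup>2)) * fourier u0 \<xi>
      - of_real A * of_real (norm \<xi> powr \<beta> * exp (- t * (norm \<xi>)\<^sup>2))"
    by (simp only: fourier_cmult fourier_heat[OF u0 t] fourier_frac_deriv[OF \<beta> t])
  finally show ?thesis by (simp add: algebra_simps)
qed

context
  fixes \<beta> A B :: real and u0 :: "real^'n \<Rightarrow> real"
  assumes \<beta>: "0 < \<beta>" "\<beta> < 1"
    and u0: "integrable lborel u0"
    and bound: "\<And>\<xi>. \<xi> \<noteq> 0 \<Longrightarrow> norm (fourier u0 \<xi>) / norm \<xi> powr \<beta> \<le> B"
    and lim: "((\<lambda>\<xi>. fourier u0 \<xi> / of_real (norm \<xi> powr \<beta>)) \<longlongrightarrow> of_real A) (at 0)"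
begin

text \<open>The modulus of the multiplier \<open>m\<close> of the overview. The value 0 at the
  origin, where the quotient carries no information, keeps the bound valid at every point.\<close>

definition remainder :: "real^'n \<Rightarrow> real" where
  "remainder \<xi> = (if \<xi> = 0 then 0 else norm (fourier u0 \<xi> / of_real (norm \<xi> powr \<beta>) - of_real A))"

lemma remainder_measurable [measurable]: "remainder \<in> borel_measurable borel"
proof -
  have [measurable]: "u0 \<in> borel_measurable borel"
    using borel_measurable_integrable[OF u0] by simp
  show ?thesis unfolding remainder_def[abs_def] by measurable
qed

lemma remainder_nonneg: "0 \<le> remainder \<xi>"
  by (simp add: remainder_def)

lemma remainder_le: "remainder \<xi> \<le> \<bar>B\<bar> + \<bar>A\<bar>"
proof (cases "\<xi> = 0")
  case False
  have "remainder \<xi> \<le> norm (fourier u0 \<xi> / of_real (norm \<xi> powr \<beta>)) + norm (of_real A :: complex)"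
    using False unfolding remainder_def by (simp only: if_False) (rule norm_triangle_ineq4)
  also have "\<dots> \<le> \<bar>B\<bar> + \<bar>A\<bar>"
    using bound[OF False] by (simp add: norm_divide)
  finally show ?thesis .
qed (simp add: remainder_def)

lemma remainder_tendsto: "(remainder \<longlongrightarrow> 0) (at 0)"
proof (rule Lim_transform_eventually)
  show "((\<lambda>\<xi>. norm (fourier u0 \<xi> / of_real (norm \<xi> powr \<beta>) - of_real A)) \<longlongrightarrow> 0) (at 0)"
    using lim by (simp add: tendsto_norm_zero_iff LIM_zero_iff)
qed (auto simp: eventually_at remainder_def intro!: exI[of _ 1])

lemma norm_fourier_linear_error:
  assumes "0 < t" "\<xi> \<noteq> 0"
  shows "norm (fourier (linear_error \<beta> A u0 t) \<xi>) = norm \<xi> powr \<beta> * exp (- t * (norm \<xi>)\<^sup>2) * remainder \<xi>"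
proof -
  have "fourier u0 \<xi> - of_real (A * norm \<xi> powr \<beta>)
      = of_real (norm \<xi> powr \<beta>) * (fourier u0 \<xi> / of_real (norm \<xi> powr \<beta>) - of_real A)"
    using assms by (simp add: field_simps)
  then have "fourier (linear_error \<beta> A u0 t) \<xi>
    = of_real (exp (- t * (norm \<xi>)\<^sup>2)) * (of_real (norm \<xi> powr \<beta>) * (fourier u0 \<xi> / of_real (norm \<xi> powr \<beta>) - of_real A))"
    using fourier_linear_error[OF u0 _ _ \<open>0 < t\<close>, of \<beta> A \<xi>] \<beta> by simp
  then have "norm (fourier (linear_error \<beta> A u0 t) \<xi>)
    = exp (- t * (norm \<xi>)\<^sup>2) * (norm \<xi> powr \<beta> * norm (fourier u0 \<xi> / of_real (norm \<xi> powr \<beta>) - of_real A))"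
    by (simp only: norm_mult norm_of_real) simp
  then show ?thesis using assms by (simp add: remainder_def)
qed

lemma AE_norm_fourier_linear_error:
  assumes "0 < t"
  shows "AE \<xi> in lborel. norm (fourier (linear_error \<beta> A u0 t) \<xi>) = norm \<xi> powr \<beta> * exp (- t * (norm \<xi>)\<^sup>2) * remainder \<xi>"
  using AE_lborel_singleton[of 0] by eventually_elim (simp add: norm_fourier_linear_error assms)

lemma linear_error_measurable [measurable]:
  "0 < t \<Longrightarrow> linear_error \<beta> A u0 t \<in> borel_measurable borel"
  using borel_measurable_integrable[OF integrable_linear_error[OF u0 \<beta>(1) _, of t A]] \<beta> by simp

lemma integrable_fourier_linear_error:
  assumes "0 < t"
  shows "integrable lborel (fourier (linear_error \<beta> A u0 t))"
proof (rule Bochner_Integration.integrable_bound)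
  show "integrable lborel (\<lambda>\<xi>::real^'n. (\<bar>B\<bar> + \<bar>A\<bar>) * (norm \<xi> powr \<beta> * exp (- t * (norm \<xi>)\<^sup>2)))"
    using \<beta> assms by (intro integrable_mult_right integrable_powr_mult_gaussian) auto
  show "AE \<xi> in lborel. norm (fourier (linear_error \<beta> A u0 t) \<xi>)
      \<le> norm ((\<bar>B\<bar> + \<bar>A\<bar>) * (norm \<xi> powr \<beta> * exp (- t * (norm \<xi>)\<^sup>2)))"
    using AE_norm_fourier_linear_error[OF assms]
  proof eventually_elim
    case (elim \<xi>)
    have "norm \<xi> powr \<beta> * exp (- t * (norm \<xi>)\<^sup>2) * remainder \<xi> \<le> norm \<xi> powr \<beta> * exp (- t * (norm \<xi>)\<^sup>2) * (\<bar>B\<bar> + \<bar>A\<bar>)"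
      using remainder_le by (intro mult_left_mono) auto
    also have "\<dots> = norm ((\<bar>B\<bar> + \<bar>A\<bar>) * (norm \<xi> powr \<beta> * exp (- t * (norm \<xi>)\<^sup>2)))"
      by (simp add: abs_mult)
    finally show ?case unfolding elim .
  qed
  show "fourier (linear_error \<beta> A u0 t) \<in> borel_measurable lborel"
    using linear_error_measurable[OF assms] by measurable
qed

text \<open>The inversion bound is the weighted Gaussian integral with gamma = beta and c = 1, so
  the smallness comes from the vanishing of \<open>remainder\<close> at the origin.\<close>

lemma linear_error_sup:
  assumes "0 < \<epsilon>"
  shows "eventually (\<lambda>t. AE x in lborel.
    \<bar>linear_error \<beta> A u0 t x\<bar> \<le> \<epsilon> * t powr (- (real CARD('n) / 2 + \<beta> / 2))) at_top"
proof -
  let ?p = "real CARD('n) / 2 + \<beta> / 2"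
  let ?I = "\<lambda>t. LBINT \<xi>. norm \<xi> powr \<beta> * exp (- 1 * t * (norm \<xi>)\<^sup>2) * remainder \<xi>"
  have "((\<lambda>t. t powr ?p * ?I t) \<longlongrightarrow> 0) at_top"
    using \<beta> remainder_le remainder_nonneg
    by (intro weighted_gaussian_integral_tendsto_0[where B="\<bar>B\<bar> + \<bar>A\<bar>"] remainder_tendsto) auto
  then have "eventually (\<lambda>t. t powr ?p * ?I t < \<epsilon> * (2 * pi) ^ CARD('n)) at_top"
    using assms by (intro order_tendstoD) auto
  then show ?thesis
    using eventually_gt_at_top[of 0]
  proof eventually_elim
    case (elim t)
    have "(LBINT \<xi>. norm (fourier (linear_error \<beta> A u0 t) \<xi>)) = ?I t"
      using AE_norm_fourier_linear_error[OF elim(2)] linear_error_measurable[OF elim(2)]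
      by (intro integral_cong_AE) auto
    then have "AE x in lborel. \<bar>linear_error \<beta> A u0 t x\<bar> \<le> ?I t / (2 * pi) ^ CARD('n)"
      using AE_abs_le_integral_fourier[OF integrable_linear_error integrable_fourier_linear_error, OF u0 _ _ elim(2) elim(2)] \<beta>
      by simp
    moreover have "?I t / (2 * pi) ^ CARD('n) \<le> \<epsilon> * t powr (- ?p)"
      using elim by (simp add: powr_minus field_simps)
    ultimately show ?case by (auto elim!: eventually_mono)
  qed
qed

text \<open>Plancherel gives the weighted integral with gamma = 2 beta, c = 2 and the squared
  remainder; the rate is that of the squared norm.\<close>

lemma linear_error_L2:
  assumes "0 < \<epsilon>"
  shows "eventually (\<lambda>t. (\<integral>\<^sup>+x. ennreal ((linear_error \<beta> A u0 t x)\<^sup>2) \<partial>lborel)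
    \<le> ennreal (\<epsilon> * t powr (- (real CARD('n) / 2 + \<beta>)))) at_top"
proof -
  let ?p = "real CARD('n) / 2 + \<beta>"
  let ?I = "\<lambda>t. LBINT \<xi>. norm \<xi> powr (2 * \<beta>) * exp (- 2 * t * (norm \<xi>)\<^sup>2) * (remainder \<xi>)\<^sup>2"
  have "((\<lambda>t. t powr (real CARD('n) / 2 + 2 * \<beta> / 2) * ?I t) \<longlongrightarrow> 0) at_top"
  proof (rule weighted_gaussian_integral_tendsto_0)
    show "((\<lambda>\<xi>. (remainder \<xi>)\<^sup>2) \<longlongrightarrow> 0) (at 0)"
      using tendsto_power[OF remainder_tendsto, of 2] by simp
    show "\<bar>(remainder \<xi>)\<^sup>2\<bar> \<le> (\<bar>B\<bar> + \<bar>A\<bar>)\<^sup>2" for \<xi>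
      using power_mono[OF remainder_le remainder_nonneg] by simp
  qed (use \<beta> in auto)
  then have "((\<lambda>t. t powr ?p * ?I t) \<longlongrightarrow> 0) at_top" by simp
  then have "eventually (\<lambda>t. t powr ?p * ?I t < \<epsilon> * (2 * pi) ^ CARD('n)) at_top"
    using assms by (intro order_tendstoD) auto
  then show ?thesis
    using eventually_gt_at_top[of 0]
  proof eventually_elim
    case (elim t)
    have "(LBINT \<xi>. (norm (fourier (linear_error \<beta> A u0 t) \<xi>))\<^sup>2) = ?I t"
    proof (rule integral_cong_AE)
      show "AE \<xi> in lborel. (norm (fourier (linear_error \<beta> A u0 t) \<xi>))\<^sup>2 =
          norm \<xi> powr (2 * \<beta>) * exp (- 2 * t * (norm \<xi>)\<^sup>2) * (remainder \<xi>)\<^sup>2"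
        using AE_norm_fourier_linear_error[OF elim(2)]
      proof eventually_elim
        case (elim \<xi>)
        have "(norm \<xi> powr \<beta>)\<^sup>2 = norm \<xi> powr (2 * \<beta>)"
          by (simp add: power2_eq_square powr_add[symmetric])
        moreover have "(exp (- t * (norm \<xi>)\<^sup>2))\<^sup>2 = exp (- 2 * t * (norm \<xi>)\<^sup>2)"
          by (simp add: power2_eq_square[of "exp _"] exp_add[symmetric])
        ultimately show ?case unfolding elim power_mult_distrib by simp
      qed
    qed (use linear_error_measurable[OF elim(2)] in measurable)
    moreover have "?I t / (2 * pi) ^ CARD('n) \<le> \<epsilon> * t powr (- ?p)"
      using elim by (simp add: powr_minus field_simps)
    ultimately show ?case
      using Plancherel[OF integrable_linear_error integrable_fourier_linear_error, OF u0 _ _ elim(2) elim(2)] \<beta>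
      by (simp add: ennreal_leI)
  qed
qed

end

text \<open>Scheffe's argument: two probability densities are \<open>L\<^sup>1\<close>-close as soon as the positive part of
  their difference is small.\<close>

lemma heat_kernel_translate_tendsto:
  fixes y :: "real^'n"
  shows "((\<lambda>s. LBINT x. \<bar>heat_kernel s (x - y) - heat_kernel s x\<bar>) \<longlongrightarrow> 0) at_top"
proof -
  have int: "integrable lborel (\<lambda>x. heat_kernel s (x - z :: real^'n))" "(LBINT x. heat_kernel s (x - z :: real^'n)) = 1"
    if "0 < s" for s z
    using integrable_lborel_affine[OF integrable_heat_kernel[OF that], of 1 "- z"]
      integral_lborel_translate[of "heat_kernel s" z] integral_heat_kernel[OF that, where 'n='n] by auto
  have "((\<lambda>s. LBINT x. max 0 (heat_kernel 1 x - heat_kernel 1 (x - (1 / sqrt s) *\<^sub>R y)))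
      \<longlongrightarrow> (\<integral>x. 0 \<partial>(lborel :: (real^'n) measure))) at_top"
  proof (rule integral_dominated_convergence_at_top[where w="heat_kernel 1"])
    show "eventually (\<lambda>s. AE x in lborel. norm (max 0 (heat_kernel 1 x - heat_kernel 1 (x - (1 / sqrt s) *\<^sub>R y))) \<le> heat_kernel 1 x) at_top"
      by (intro always_eventually allI AE_I2) auto
    have "((\<lambda>s. max 0 (heat_kernel 1 x - heat_kernel 1 (x - (1 / sqrt s) *\<^sub>R y))) \<longlongrightarrow> 0) at_top" for x
    proof -
      have "((\<lambda>s. (1 / sqrt s) *\<^sub>R y) \<longlongrightarrow> 0 *\<^sub>R y) at_top"
        by (intro tendsto_intros tendsto_divide_0[OF tendsto_const] filterlim_at_top_imp_at_infinity sqrt_at_top)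
      then have L: "((\<lambda>s. (1 / sqrt s) *\<^sub>R y) \<longlongrightarrow> 0) at_top" by simp
      have "isCont (\<lambda>z. max 0 (heat_kernel 1 x - heat_kernel 1 (x - z))) 0"
        unfolding heat_kernel_def by (intro continuous_intros) auto
      from isCont_tendsto_compose[OF this L] show ?thesis by simp
    qed
    then show "AE x in lborel. ((\<lambda>s. max 0 (heat_kernel 1 x - heat_kernel 1 (x - (1 / sqrt s) *\<^sub>R y))) \<longlongrightarrow> 0) at_top"
      by simp
  qed (auto intro: integrable_heat_kernel)
  then have "((\<lambda>s. 2 * (LBINT x. max 0 (heat_kernel 1 x - heat_kernel 1 (x - (1 / sqrt s) *\<^sub>R y)))) \<longlongrightarrow> 0) at_top"
    by (intro tendsto_mult_right_zero) simp
  moreover have "eventually (\<lambda>s. 2 * (LBINT x. max 0 (heat_kernel 1 x - heat_kernel 1 (x - (1 / sqrt s) *\<^sub>R y)))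
      = (LBINT x. \<bar>heat_kernel s (x - y) - heat_kernel s x\<bar>)) at_top"
    using eventually_gt_at_top[of 0]
  proof eventually_elim
    case (elim s)
    let ?d = "\<lambda>x. heat_kernel s x - heat_kernel s (x - y)"
    have scale: "heat_kernel s (sqrt s *\<^sub>R x) = heat_kernel 1 x / sqrt s ^ CARD('n)" for x :: "real^'n"
      using heat_kernel_scaleR[of "sqrt s" 1 x] elim by simp
    have "(LBINT x. \<bar>heat_kernel s (x - y) - heat_kernel s x\<bar>) = (LBINT x. 2 * max 0 (?d x) - ?d x)"
      by (intro Bochner_Integration.integral_cong refl) (simp add: max_def)
    also have "\<dots> = 2 * (LBINT x. max 0 (?d x))"
      using int[OF elim, of 0] int[OF elim, of y] by simp
    also have "(LBINT x. max 0 (?d x)) = sqrt s ^ CARD('n) * (LBINT x. max 0 (?d (sqrt s *\<^sub>R x)))"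
      using elim by (subst integral_lborel_affine[where c="sqrt s" and t=0]) auto
    also have "\<dots> = (LBINT x. sqrt s ^ CARD('n) * max 0 (?d (sqrt s *\<^sub>R x)))"
      by simp
    also have "\<dots> = (LBINT x. max 0 (heat_kernel 1 x - heat_kernel 1 (x - (1 / sqrt s) *\<^sub>R y)))"
    proof (intro Bochner_Integration.integral_cong refl)
      fix x :: "real^'n"
      have "sqrt s *\<^sub>R x - y = sqrt s *\<^sub>R (x - (1 / sqrt s) *\<^sub>R y)"
        using elim by (simp add: scaleR_diff_right)
      then show "sqrt s ^ CARD('n) * max 0 (?d (sqrt s *\<^sub>R x)) = max 0 (heat_kernel 1 x - heat_kernel 1 (x - (1 / sqrt s) *\<^sub>R y))"
        using elim by (simp add: scale max_mult_distrib_left diff_divide_distrib[symmetric])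
    qed
    finally show ?case by simp
  qed
  ultimately show ?thesis by (rule Lim_transform_eventually)
qed

section \<open>The linear error in L^1\<close>

text \<open>The error is an average of translation differences of the kernel, so its L^1 norm is at
  most the integral of their norms against |w|. Each of these norms is at most 2 and tends to 0 for
  fixed y, so dominated convergence applies.\<close>

lemma heat_asymptotics_L1:
  fixes w :: "real^'n \<Rightarrow> real"
  assumes w: "integrable lborel w"
  shows "((\<lambda>s. LBINT x. \<bar>heat s w x - (LBINT y. w y) * heat_kernel s x\<bar>) \<longlongrightarrow> 0) at_top"
proof -
  have [measurable]: "w \<in> borel_measurable borel"
    using borel_measurable_integrable[OF w] by simp
  let ?T = "\<lambda>s y. LBINT x. \<bar>heat_kernel s (x - y) - heat_kernel s x\<bar>"
  have intT: "integrable lborel (\<lambda>x. heat_kernel s (x - y :: real^'n))" "(LBINT x. heat_kernel s (x - y :: real^'n)) = 1"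
    if "0 < s" for s y
    using integrable_lborel_affine[OF integrable_heat_kernel[OF that], of 1 "- y"]
      integral_lborel_translate[of "heat_kernel s" y] integral_heat_kernel[OF that, where 'n='n] by auto
  have T2: "?T s y \<le> 2" if "0 < s" for s and y :: "real^'n"
  proof -
    have "?T s y \<le> (LBINT x. heat_kernel s (x - y) + heat_kernel s x)"
    proof (rule integral_mono)
      fix x
      show "\<bar>heat_kernel s (x - y) - heat_kernel s x\<bar> \<le> heat_kernel s (x - y) + heat_kernel s x"
        using heat_kernel_nonneg[of s "x - y"] heat_kernel_nonneg[of s x] by linarith
    qed (use intT[OF that, of y] intT[OF that, of 0] in auto)
    also have "\<dots> = 2" using intT[OF that, of y] intT[OF that, of 0] by simp
    finally show ?thesis .
  qed
  have T0: "0 \<le> ?T s y" for s and y :: "real^'n" by (intro integral_nonneg_AE) auto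
  have "((\<lambda>s. \<integral>y. ?T s y * \<bar>w y\<bar> \<partial>lborel) \<longlongrightarrow> (\<integral>y. 0 \<partial>(lborel :: (real^'n) measure))) at_top"
  proof (rule integral_dominated_convergence_at_top[where w="\<lambda>y. 2 * \<bar>w y\<bar>"])
    show "eventually (\<lambda>s. AE y in lborel. norm (?T s y * \<bar>w y\<bar>) \<le> 2 * \<bar>w y\<bar>) at_top"
      using eventually_gt_at_top[of 0]
    proof eventually_elim
      case (elim s)
      show ?case using T2[OF elim] T0 by (intro AE_I2) (auto simp: abs_mult intro!: mult_right_mono)
    qed
    show "AE y in lborel. ((\<lambda>s. ?T s y * \<bar>w y\<bar>) \<longlongrightarrow> 0) at_top"
      by (intro AE_I2 tendsto_mult_left_zero heat_kernel_translate_tendsto)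
  qed (use w in auto)
  then have lim: "((\<lambda>s. LBINT y. ?T s y * \<bar>w y\<bar>) \<longlongrightarrow> 0) at_top" by simp
  have "eventually (\<lambda>s. (LBINT x. \<bar>heat s w x - (LBINT y. w y) * heat_kernel s x\<bar>) \<le> (LBINT y. ?T s y * \<bar>w y\<bar>)) at_top"
    using eventually_gt_at_top[of 0]
  proof eventually_elim
    case (elim s)
    let ?f = "\<lambda>x y. (heat_kernel s (x - y) - heat_kernel s x) * w y"
    have int1: "integrable (lborel \<Otimes>\<^sub>M lborel) (\<lambda>(x, y). heat_kernel s (x - y) * w y)"
      by (intro integrable_convolution_pair integrable_heat_kernel elim w)
    have int2: "integrable (lborel \<Otimes>\<^sub>M lborel) (\<lambda>(x, y). heat_kernel s (x::real^'n) * w y)"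
      by (intro integrable_product integrable_heat_kernel elim w)
    have int: "integrable (lborel \<Otimes>\<^sub>M lborel) (\<lambda>(x, y). ?f x y)"
      using Bochner_Integration.integrable_diff[OF int1 int2] by (simp add: split_beta' left_diff_distrib)
    have inta: "integrable (lborel \<Otimes>\<^sub>M lborel) (\<lambda>(x, y). \<bar>?f x y\<bar>)"
      using integrable_abs[OF int] by (simp add: split_beta')
    have "(LBINT x. \<bar>heat s w x - (LBINT y. w y) * heat_kernel s x\<bar>) = (LBINT x. \<bar>LBINT y. ?f x y\<bar>)"
    proof (rule integral_cong_AE)
      have "AE x in lborel. integrable lborel (\<lambda>y. heat_kernel s (x - y) * w y)"
        using lborel_pair.AE_integrable_fst'[OF int1] by simp
      then show "AE x in lborel. \<bar>heat s w x - (LBINT y. w y) * heat_kernel s x\<bar> = \<bar>LBINT y. ?f x y\<bar>"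
      proof eventually_elim
        case (elim x)
        have "(LBINT y. ?f x y) = (LBINT y. heat_kernel s (x - y) * w y) - (LBINT y. heat_kernel s x * w y)"
          unfolding left_diff_distrib using elim w by (intro Bochner_Integration.integral_diff) auto
        then show ?case by (simp add: heat_def mult.commute)
      qed
    qed measurable
    also have "\<dots> \<le> (LBINT x. (LBINT y. \<bar>?f x y\<bar>))"
      using lborel_pair.integrable_fst'[OF int] lborel_pair.integrable_fst'[OF inta]
      by (intro integral_mono integral_abs_bound) auto
    also have "\<dots> = (LBINT y. (LBINT x. \<bar>?f x y\<bar>))"
      using lborel_pair.Fubini_integral[of "\<lambda>x y. \<bar>?f x y\<bar>"] inta by simp
    also have "\<dots> = (LBINT y. ?T s y * \<bar>w y\<bar>)"
      by (simp add: abs_mult)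
    finally show ?case .
  qed
  then show ?thesis
    by (intro tendsto_sandwich[OF always_eventually _ tendsto_const lim]) (auto intro!: integral_nonneg_AE)
qed

text \<open>The time t is split into halves, one carrying |xi|^beta and the other the smoothing of
  \<open>w\<close>; the factorisation is verified on the Fourier side off the origin.
  \<open>V\<close> is the constructed kernel, whose L^1 bound comes with its construction, rather
  than the chosen \<open>frac_deriv\<close>.\<close>

lemma linear_error_L1:
  fixes u0 w :: "real^'n \<Rightarrow> real"
  assumes \<beta>: "0 < \<beta>" "\<beta> < 1" and u0: "integrable lborel u0" and w: "is_frac_integral \<beta> u0 w"
    and A: "A = (LBINT x. w x)" and \<epsilon>: "0 < \<epsilon>"
  shows "eventually (\<lambda>t. (\<integral>\<^sup>+x. ennreal \<bar>linear_error \<beta> A u0 t x\<bar> \<partial>lborel) \<le> ennreal (\<epsilon> * t powr (- (\<beta> / 2)))) at_top"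
proof -
  have intw: "integrable lborel w"
    and fw: "\<And>\<xi>. \<xi> \<noteq> 0 \<Longrightarrow> fourier w \<xi> = fourier u0 \<xi> / of_real (norm \<xi> powr \<beta>)"
    using w by (auto simp: is_frac_integral_def Lp_1_iff_integrable)
  \<comment> \<open>The bound for the kernel at time t/2 without its power of t: (n/(t/2))^(beta/2)
    = (2n)^(beta/2) t^(-beta/2).\<close>
  define C where "C = (1 / (1 - \<beta> / 2) + 2 / (\<beta> / 2)) * (2 * real CARD('n)) powr (\<beta> / 2) / frac_const \<beta>"
  have C: "0 < C"
    using \<beta> frac_const_pos[of \<beta>] by (auto simp: C_def intro!: divide_pos_pos mult_pos_pos add_pos_pos)
  let ?z = "\<lambda>s x. heat s w x - A * heat_kernel s x"
  have "((\<lambda>s. LBINT x. \<bar>?z s x\<bar>) \<longlongrightarrow> 0) at_top"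
    using heat_asymptotics_L1[OF intw] by (simp add: A)
  moreover have "filterlim (\<lambda>t::real. t / 2) at_top at_top"
    unfolding filterlim_at_top eventually_at_top_linorder
    by (intro allI, rule_tac x="2 * Z" in exI) simp
  ultimately have "((\<lambda>t. LBINT x. \<bar>?z (t / 2) x\<bar>) \<longlongrightarrow> 0) at_top"
    by (rule filterlim_compose)
  then have "eventually (\<lambda>t. (LBINT x. \<bar>?z (t / 2) x\<bar>) < \<epsilon> / C) at_top"
    using \<epsilon> C by (intro order_tendstoD) auto
  then show ?thesis
    using eventually_gt_at_top[of 0]
  proof eventually_elim
    case (elim t)
    obtain V :: "real^'n \<Rightarrow> real" where V: "integrable lborel V"
      and fV: "\<And>\<xi>. fourier V \<xi> = of_real (norm \<xi> powr \<beta>) * fourier (heat_kernel (t / 2)) \<xi>"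
      and V_le: "L1_norm V \<le> (1 / (1 - \<beta> / 2) + 2 / (\<beta> / 2)) * (real CARD('n) / (t / 2)) powr (\<beta> / 2) / frac_const \<beta>"
      using frac_deriv_kernel_exists[of \<beta> "t / 2", where 'n='n] \<beta> elim by auto
    have V_le': "L1_norm V \<le> C * t powr (- (\<beta> / 2))"
      using V_le elim by (simp add: C_def powr_divide powr_minus field_simps)
    have z: "integrable lborel (?z (t / 2))"
      using elim by (intro Bochner_Integration.integrable_diff integrable_mult_right integrable_heat integrable_heat_kernel intw) auto
    have "AE x in lborel. linear_error \<beta> A u0 t x = (LBINT y. V (x - y) * ?z (t / 2) y)"
    proof (rule fourier_eq_imp_AE_eq)
      show "integrable lborel (linear_error \<beta> A u0 t)"
        using \<beta> elim by (intro integrable_linear_error u0) auto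
      show "integrable lborel (\<lambda>x. LBINT y. V (x - y) * ?z (t / 2) y)"
        by (rule integrable_convolution[OF V z])
      fix \<xi> :: "real^'n" assume \<xi>: "\<xi> \<noteq> 0"
      have "fourier (?z (t / 2)) \<xi> = fourier (heat (t / 2) w) \<xi> - fourier (\<lambda>x. A * heat_kernel (t / 2) x) \<xi>"
        using elim by (intro fourier_diff integrable_mult_right integrable_heat integrable_heat_kernel intw) auto
      also have "\<dots> = of_real (exp (- (t / 2) * (norm \<xi>)\<^sup>2)) * (fourier w \<xi> - of_real A)"
        using elim by (simp add: fourier_cmult fourier_heat[OF intw] fourier_heat_kernel algebra_simps)
      finally have fz: "fourier (?z (t / 2)) \<xi> = \<dots>" .
      have e: "exp (- (t / 2) * (norm \<xi>)\<^sup>2) * exp (- (t / 2) * (norm \<xi>)\<^sup>2) = exp (- t * (norm \<xi>)\<^sup>2)"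
        by (simp add: exp_add[symmetric])
      have "fourier (\<lambda>x. LBINT y. V (x - y) * ?z (t / 2) y) \<xi> =
        of_real (norm \<xi> powr \<beta>) * of_real (exp (- (t / 2) * (norm \<xi>)\<^sup>2)) * (of_real (exp (- (t / 2) * (norm \<xi>)\<^sup>2)) * (fourier w \<xi> - of_real A))"
        using elim by (simp only: fourier_convolution[OF V z] fV fz) (simp add: fourier_heat_kernel)
      also have "\<dots> = of_real (exp (- t * (norm \<xi>)\<^sup>2)) * (of_real (norm \<xi> powr \<beta>) * (fourier w \<xi> - of_real A))"
        unfolding e[symmetric] by (simp only: of_real_mult mult_ac)
      also have "of_real (norm \<xi> powr \<beta>) * (fourier w \<xi> - of_real A) = fourier u0 \<xi> - of_real (A * norm \<xi> powr \<beta>)"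
        using \<xi> by (simp add: fw field_simps)
      also have "of_real (exp (- t * (norm \<xi>)\<^sup>2)) * (fourier u0 \<xi> - of_real (A * norm \<xi> powr \<beta>)) = fourier (linear_error \<beta> A u0 t) \<xi>"
        using fourier_linear_error[OF u0, of \<beta> t A \<xi>] \<beta> elim by simp
      finally show "fourier (linear_error \<beta> A u0 t) \<xi> = fourier (\<lambda>x. LBINT y. V (x - y) * ?z (t / 2) y) \<xi>" ..
    qed
    then have "(\<integral>\<^sup>+x. ennreal \<bar>linear_error \<beta> A u0 t x\<bar> \<partial>lborel)
       = (\<integral>\<^sup>+x. ennreal \<bar>LBINT y. V (x - y) * ?z (t / 2) y\<bar> \<partial>lborel)"
      by (intro nn_integral_cong_AE) (auto elim: eventually_mono)
    also have "\<dots> \<le> ennreal (L1_norm V * (LBINT x. \<bar>?z (t / 2) x\<bar>))"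
      by (rule nn_integral_abs_convolution_le[OF V z])
    also have "\<dots> \<le> ennreal (C * t powr (- (\<beta> / 2)) * (\<epsilon> / C))"
      using V_le' elim C by (intro ennreal_leI mult_mono) auto
    also have "C * t powr (- (\<beta> / 2)) * (\<epsilon> / C) = \<epsilon> * t powr (- (\<beta> / 2))"
      using C by simp
    finally show ?case .
  qed
qed

section \<open>Bounds on the Duhamel term\<close>

lemma heat_kernel_le: "heat_kernel s (x :: real^'n) \<le> (4 * pi * s) powr (- real CARD('n) / 2)" if "0 < s"
  unfolding heat_kernel_def using that by (simp add: mult_left_le)

lemma integrable_heat_integrand:
  fixes F :: "real^'n \<Rightarrow> real"
  assumes F: "integrable lborel F" and s: "0 < s"
  shows "integrable lborel (\<lambda>y. heat_kernel s (x - y) * F y)"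
proof (rule Bochner_Integration.integrable_bound)
  have [measurable]: "F \<in> borel_measurable borel"
    using borel_measurable_integrable[OF F] by simp
  show "integrable lborel (\<lambda>y. (4 * pi * s) powr (- real CARD('n) / 2) * F y)"
    using F by simp
  show "AE y in lborel. norm (heat_kernel s (x - y) * F y) \<le> norm ((4 * pi * s) powr (- real CARD('n) / 2) * F y)"
    using heat_kernel_le[OF s, where 'n='n] by (intro AE_I2) (simp add: abs_mult mult_right_mono)
  show "(\<lambda>y. heat_kernel s (x - y) * F y) \<in> borel_measurable lborel" by measurable
qed

lemma abs_heat_le_integral:
  fixes F :: "real^'n \<Rightarrow> real"
  assumes F: "integrable lborel F" and s: "0 < s"
  shows "\<bar>heat s F x\<bar> \<le> (4 * pi * s) powr (- real CARD('n) / 2) * L1_norm F"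
proof -
  have "\<bar>heat s F x\<bar> \<le> (LBINT y. \<bar>heat_kernel s (x - y) * F y\<bar>)"
    unfolding heat_def by (rule integral_abs_bound)
  also have "\<dots> \<le> (LBINT y. (4 * pi * s) powr (- real CARD('n) / 2) * \<bar>F y\<bar>)"
    using integrable_abs[OF integrable_heat_integrand[OF F s]] F heat_kernel_le[OF s, where 'n='n]
    by (intro integral_mono) (auto simp: abs_mult mult_right_mono)
  finally show ?thesis by simp
qed

lemma nn_integral_abs_heat_le:
  fixes F :: "real^'n \<Rightarrow> real"
  assumes F: "integrable lborel F" and s: "0 < s"
  shows "L1_ennnorm (heat s F) \<le> ennreal (L1_norm F)"
  using nn_integral_abs_convolution_le[OF integrable_heat_kernel[OF s] F] s
  by (simp add: heat_def[abs_def] integral_heat_kernel)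

section \<open>Gradient of the heat flow\<close>

text \<open>The derivative of \<open>heat_kernel s\<close> at \<open>x\<close> in the direction
  \<open>v\<close>.\<close>

definition heat_kernel_grad :: "real \<Rightarrow> real^'n \<Rightarrow> real^'n \<Rightarrow> real" where
  "heat_kernel_grad s x v = - (x \<bullet> v) / (2 * s) * heat_kernel s x"

text \<open>Expansion to second order along the segment from z to z + v. The remainder is uniform in
  z, so that it can be integrated against an arbitrary L^1 function.\<close>

lemma heat_kernel_Taylor:
  fixes z v :: "real^'n"
  assumes s: "0 < s"
  shows "\<bar>heat_kernel s (z + v) - heat_kernel s z - heat_kernel_grad s z v\<bar>
    \<le> (4 * pi * s) powr (- real CARD('n) / 2) / s * (norm v)\<^sup>2"
proof -
  define c where "c = (4 * pi * s) powr (- real CARD('n) / 2)"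
  have c: "0 < c" using s by (simp add: c_def)
  define p where "p r = z \<bullet> z + 2 * r * (z \<bullet> v) + r\<^sup>2 * (v \<bullet> v)" for r
  define l where "l r = z \<bullet> v + r * (v \<bullet> v)" for r
  have p_eq: "p r = (norm (z + r *\<^sub>R v))\<^sup>2" for r
    unfolding power2_norm_eq_inner
    by (simp add: p_def inner_add_left inner_add_right inner_commute power2_eq_square algebra_simps)
  have l_eq: "l r = (z + r *\<^sub>R v) \<bullet> v" for r
    by (simp add: l_def inner_add_left)
  \<comment> \<open>For m up to 2, \<open>diff m r\<close> is the m-th derivative in r of the kernel
    along the segment; \<open>p r\<close> is the squared norm of z + r v and \<open>l r\<close> half
    its derivative.\<close>
  define diff where "diff m r = (if m = 0 then c * exp (- p r / (4 * s))
     else if m = 1 then - l r / (2 * s) * (c * exp (- p r / (4 * s)))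
     else ((l r)\<^sup>2 / (4 * s\<^sup>2) - (v \<bullet> v) / (2 * s)) * (c * exp (- p r / (4 * s))))" for m :: nat and r
  have dp: "(p has_real_derivative 2 * l r) (at r)" for r
    unfolding p_def l_def by (auto intro!: derivative_eq_intros simp: algebra_simps)
  have dl: "(l has_real_derivative v \<bullet> v) (at r)" for r
    unfolding l_def by (auto intro!: derivative_eq_intros)
  have d: "(diff m has_real_derivative diff (Suc m) r) (at r)" if "m < 2" for m r
  proof -
    have "m = 0 \<or> m = 1" using that by auto
    then show ?thesis
    proof
      assume "m = 0"
      then show ?thesis unfolding diff_def using s
        by (auto intro!: derivative_eq_intros dp simp: field_simps)
    next
      assume "m = 1"
      then show ?thesis unfolding diff_def using s
        by (auto intro!: derivative_eq_intros dp dl simp: field_simps power2_eq_square)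
    qed
  qed
  have "\<exists>t>0. t < 1 \<and> diff 0 1 = (\<Sum>m<2. diff m 0 / fact m * 1 ^ m) + diff 2 t / fact 2 * 1 ^ 2"
    by (rule Maclaurin) (use d in auto)
  then obtain r where eq: "diff 0 1 = diff 0 0 + diff 1 0 + diff 2 r / 2"
    by (auto simp: numeral_2_eq_2)
  have "diff 0 1 = heat_kernel s (z + v)" "diff 0 0 = heat_kernel s z" "diff 1 0 = heat_kernel_grad s z v"
    by (simp_all add: diff_def p_eq l_eq heat_kernel_def heat_kernel_grad_def c_def)
  with eq have "\<bar>heat_kernel s (z + v) - heat_kernel s z - heat_kernel_grad s z v\<bar> = \<bar>diff 2 r\<bar> / 2" by simp
  also have "\<bar>diff 2 r\<bar> \<le> 2 * c / s * (norm v)\<^sup>2"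
  proof -
    let ?w = "z + r *\<^sub>R v"
    let ?e = "exp (- p r / (4 * s))"
    have "(l r)\<^sup>2 \<le> p r * (norm v)\<^sup>2"
      unfolding p_eq l_eq power_mult_distrib[symmetric] using Cauchy_Schwarz_ineq2[of ?w v]
      by (simp add: abs_le_square_iff[symmetric])
    then have "(l r)\<^sup>2 / (4 * s\<^sup>2) * ?e \<le> p r * (norm v)\<^sup>2 / (4 * s\<^sup>2) * ?e"
      using s by (intro mult_right_mono divide_right_mono) auto
    also have "\<dots> = (p r / (4 * s) * ?e) * ((norm v)\<^sup>2 / s)"
      using s by (simp add: field_simps power2_eq_square)
    also have "\<dots> \<le> 1 * ((norm v)\<^sup>2 / s)"
      using exp_ge_add_one_self[of "p r / (4 * s)"] s
      by (intro mult_right_mono) (simp_all add: exp_minus field_simps)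
    finally have 1: "(l r)\<^sup>2 / (4 * s\<^sup>2) * ?e \<le> (norm v)\<^sup>2 / s" by simp
    have "?e \<le> 1" using s by (simp add: p_eq)
    then have "(v \<bullet> v) / (2 * s) * ?e \<le> (v \<bullet> v) / (2 * s)"
      using s by (intro mult_left_le) auto
    also have "\<dots> \<le> (norm v)\<^sup>2 / s"
      unfolding power2_norm_eq_inner using s by (intro divide_left_mono) auto
    finally have 2: "(v \<bullet> v) / (2 * s) * ?e \<le> (norm v)\<^sup>2 / s" .
    have "diff 2 r = c * ((l r)\<^sup>2 / (4 * s\<^sup>2) * ?e - (v \<bullet> v) / (2 * s) * ?e)"
      by (simp add: diff_def algebra_simps)
    also have "\<bar>\<dots>\<bar> \<le> c * (2 * ((norm v)\<^sup>2 / s))"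
    proof -
      have "0 \<le> (l r)\<^sup>2 / (4 * s\<^sup>2) * ?e" "0 \<le> (v \<bullet> v) / (2 * s) * ?e" using s by auto
      then have "\<bar>(l r)\<^sup>2 / (4 * s\<^sup>2) * ?e - (v \<bullet> v) / (2 * s) * ?e\<bar> \<le> 2 * ((norm v)\<^sup>2 / s)"
        using 1 2 by linarith
      then show ?thesis unfolding abs_mult using c by (simp only: abs_of_pos) (intro mult_left_mono, auto)
    qed
    finally show ?thesis by (simp add: mult_ac)
  qed
  finally show ?thesis by (simp add: c_def)
qed

text \<open>The factor |z|/(2s) of the gradient is absorbed by half of the Gaussian: this leaves
  s^(-1/2), doubles the time of the kernel and costs 2^(n/2) in the normalisation.\<close>

lemma abs_heat_kernel_grad_le:
  fixes z v :: "real^'n"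
  assumes s: "0 < s"
  shows "\<bar>heat_kernel_grad s z v\<bar> \<le> norm v * 2 powr (real CARD('n) / 2) * s powr (- 1 / 2) * heat_kernel (2 * s) z"
proof -
  define y where "y = norm z / (2 * sqrt s)"
  have y2: "y\<^sup>2 / 2 = (norm z)\<^sup>2 / (8 * s)" using s by (simp add: y_def power_divide power_mult_distrib)
  have "y \<le> 1 + y\<^sup>2 / 2" using sum_power2_ge_zero[of "y - 1" 0] by (simp add: power2_eq_square algebra_simps)
  also have "\<dots> \<le> exp (y\<^sup>2 / 2)" by (rule exp_ge_add_one_self)
  finally have "y * exp (- (y\<^sup>2 / 2)) \<le> 1" by (simp add: exp_minus field_simps)
  then have "y * exp (- (y\<^sup>2 / 2)) * exp (- (y\<^sup>2 / 2)) \<le> 1 * exp (- (y\<^sup>2 / 2))"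
    by (intro mult_right_mono) auto
  then have le: "y * exp (- (norm z)\<^sup>2 / (4 * s)) \<le> exp (- (norm z)\<^sup>2 / (4 * (2 * s)))"
    unfolding y2 by (simp add: mult.assoc exp_add[symmetric])
  have eq: "(4 * pi * s) powr (- real CARD('n) / 2) = 2 powr (real CARD('n) / 2) * (4 * pi * (2 * s)) powr (- real CARD('n) / 2)"
  proof -
    have "(4 * pi * (2 * s)) powr (- real CARD('n) / 2) = 2 powr (- real CARD('n) / 2) * (4 * pi * s) powr (- real CARD('n) / 2)"
      using s by (subst powr_mult[symmetric]) (auto simp: mult_ac)
    then show ?thesis by (simp add: powr_minus)
  qed
  have "\<bar>heat_kernel_grad s z v\<bar> = \<bar>z \<bullet> v\<bar> / (2 * s) * heat_kernel s z"
    using s by (simp add: heat_kernel_grad_def abs_mult)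
  also have "\<dots> \<le> norm z * norm v / (2 * s) * heat_kernel s z"
    using s Cauchy_Schwarz_ineq2[of z v] by (intro mult_right_mono divide_right_mono) auto
  also have "norm z * norm v / (2 * s) = norm v * s powr (- 1 / 2) * y"
  proof -
    have "s powr (- 1 / 2) = 1 / sqrt s" using s by (simp add: powr_minus_divide powr_half_sqrt)
    then show ?thesis unfolding y_def using s by (simp only:) (simp add: field_simps)
  qed
  also have "norm v * s powr (- 1 / 2) * y * heat_kernel s z
     = norm v * s powr (- 1 / 2) * (4 * pi * s) powr (- real CARD('n) / 2) * (y * exp (- (norm z)\<^sup>2 / (4 * s)))"
    by (simp add: heat_kernel_def)
  also have "\<dots> \<le> norm v * s powr (- 1 / 2) * (4 * pi * s) powr (- real CARD('n) / 2) * exp (- (norm z)\<^sup>2 / (4 * (2 * s)))"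
    using le by (intro mult_left_mono) auto
  also have "\<dots> = norm v * 2 powr (real CARD('n) / 2) * s powr (- 1 / 2) * heat_kernel (2 * s) z"
    unfolding eq heat_kernel_def by simp
  finally show ?thesis .
qed

lemma integrable_heat_grad_integrand:
  fixes F :: "real^'n \<Rightarrow> real"
  assumes F: "integrable lborel F" and s: "0 < s"
  shows "integrable lborel (\<lambda>y. heat_kernel_grad s (x - y) v * F y)"
proof (rule Bochner_Integration.integrable_bound)
  have [measurable]: "F \<in> borel_measurable borel"
    using borel_measurable_integrable[OF F] by simp
  let ?c = "norm v * 2 powr (real CARD('n) / 2) * s powr (- 1 / 2)"
  show "integrable lborel (\<lambda>y. ?c * (heat_kernel (2 * s) (x - y) * F y))"
    using s by (intro integrable_mult_right integrable_heat_integrand F) auto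
  show "AE y in lborel. norm (heat_kernel_grad s (x - y) v * F y) \<le> norm (?c * (heat_kernel (2 * s) (x - y) * F y))"
  proof (rule AE_I2)
    fix y
    have "\<bar>heat_kernel_grad s (x - y) v\<bar> * \<bar>F y\<bar> \<le> ?c * heat_kernel (2 * s) (x - y) * \<bar>F y\<bar>"
      by (intro mult_right_mono abs_heat_kernel_grad_le s) auto
    then show "norm (heat_kernel_grad s (x - y) v * F y) \<le> norm (?c * (heat_kernel (2 * s) (x - y) * F y))"
      by (simp add: abs_mult mult.assoc)
  qed
  show "(\<lambda>y. heat_kernel_grad s (x - y) v * F y) \<in> borel_measurable lborel"
    unfolding heat_kernel_grad_def by measurable
qed

text \<open>The Taylor remainder integrates to O(|v|^2) times the L^1 norm of \<open>F\<close>. This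
  identifies the \<open>frechet_derivative\<close> that occurs in
  \<open>mild_formula\<close>.\<close>

lemma heat_has_derivative:
  fixes F :: "real^'n \<Rightarrow> real"
  assumes F: "integrable lborel F" and s: "0 < s"
  shows "(heat s F has_derivative (\<lambda>v. LBINT y. heat_kernel_grad s (x - y) v * F y)) (at x)"
    (is "(_ has_derivative ?D) _")
proof -
  define c where "c = (4 * pi * s) powr (- real CARD('n) / 2)"
  have c: "0 < c" using s by (simp add: c_def)
  note int = integrable_heat_grad_integrand[OF F s, of x] integrable_heat_integrand[OF F s]
  have lin: "linear ?D"
  proof
    fix v w :: "real^'n" and r :: real
    have "?D (v + w) = (LBINT y. heat_kernel_grad s (x - y) v * F y + heat_kernel_grad s (x - y) w * F y)"
      by (intro Bochner_Integration.integral_cong refl)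
         (simp add: heat_kernel_grad_def inner_add_right distrib_right diff_divide_distrib left_diff_distrib)
    then show "?D (v + w) = ?D v + ?D w" using int by simp
    have "?D (r *\<^sub>R v) = (LBINT y. r * (heat_kernel_grad s (x - y) v * F y))"
      by (intro Bochner_Integration.integral_cong refl) (simp add: heat_kernel_grad_def)
    then show "?D (r *\<^sub>R v) = r *\<^sub>R ?D v" by simp
  qed
  have rem: "\<bar>heat s F (x + v) - heat s F x - ?D v\<bar> \<le> c / s * (norm v)\<^sup>2 * L1_norm F" for v
  proof -
    let ?R = "\<lambda>y. heat_kernel s (x + v - y) * F y - heat_kernel s (x - y) * F y - heat_kernel_grad s (x - y) v * F y"
    have R: "integrable lborel ?R"
      by (intro Bochner_Integration.integrable_diff int)
    have R_le: "\<bar>?R y\<bar> \<le> c / s * (norm v)\<^sup>2 * \<bar>F y\<bar>" for y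
    proof -
      have "\<bar>heat_kernel s (x + v - y) - heat_kernel s (x - y) - heat_kernel_grad s (x - y) v\<bar> \<le> c / s * (norm v)\<^sup>2"
        using heat_kernel_Taylor[OF s, of "x - y" v] unfolding c_def diff_add_eq .
      then have "\<bar>heat_kernel s (x + v - y) - heat_kernel s (x - y) - heat_kernel_grad s (x - y) v\<bar> * \<bar>F y\<bar>
          \<le> c / s * (norm v)\<^sup>2 * \<bar>F y\<bar>"
        by (rule mult_right_mono) simp
      then show ?thesis
        unfolding abs_mult[symmetric] left_diff_distrib .
    qed
    have eq: "heat s F (x + v) - heat s F x - ?D v = (LBINT y. ?R y)"
      unfolding heat_def
      by (subst Bochner_Integration.integral_diff; (intro Bochner_Integration.integrable_diff int)?)
         (subst Bochner_Integration.integral_diff; (intro int refl)?)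
    have "\<bar>LBINT y. ?R y\<bar> \<le> (LBINT y. \<bar>?R y\<bar>)" by (rule integral_abs_bound)
    also have "\<dots> \<le> (LBINT y. c / s * (norm v)\<^sup>2 * \<bar>F y\<bar>)"
      by (rule integral_mono[OF integrable_abs[OF R] _ R_le]) (use F in simp)
    finally show ?thesis unfolding eq by simp
  qed
  have "((\<lambda>v. norm (heat s F (x + v) - heat s F x - ?D v) / norm v) \<longlongrightarrow> 0) (at 0)"
  proof (rule Lim_null_comparison)
    let ?C = "c / s * L1_norm F"
    show "eventually (\<lambda>v. norm (norm (heat s F (x + v) - heat s F x - ?D v) / norm v) \<le> ?C * norm v) (at 0)"
      using rem by (intro always_eventually allI) (auto simp: divide_le_eq power2_eq_square mult_ac)
    have "((\<lambda>v::real^'n. ?C * norm v) \<longlongrightarrow> ?C * norm (0::real^'n)) (at 0)" by (rule tendsto_mult[OF tendsto_const tendsto_norm[OF tendsto_ident_at]])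
    then show "((\<lambda>v::real^'n. ?C * norm v) \<longlongrightarrow> 0) (at 0)" by simp
  qed
  then show ?thesis
    unfolding has_derivative_at using lin by (simp add: linear_conv_bounded_linear)
qed

text \<open>A pointwise majorant by another heat flow, rather than a norm estimate, so that the L^1
  and the supremum bounds of the Duhamel term both start from it.\<close>

lemma abs_heat_derivative_le:
  fixes F :: "real^'n \<Rightarrow> real"
  assumes F: "integrable lborel F" and s: "0 < s"
  shows "\<bar>frechet_derivative (heat s F) (at x) v\<bar>
    \<le> norm v * 2 powr (real CARD('n) / 2) * s powr (- 1 / 2) * heat (2 * s) (\<lambda>y. \<bar>F y\<bar>) x"
proof -
  let ?c = "norm v * 2 powr (real CARD('n) / 2) * s powr (- 1 / 2)"
  have eq: "frechet_derivative (heat s F) (at x) v = (LBINT y. heat_kernel_grad s (x - y) v * F y)"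
    using fun_cong[OF frechet_derivative_at[OF heat_has_derivative[OF F s], of x], of v] by (rule sym)
  have "\<bar>LBINT y. heat_kernel_grad s (x - y) v * F y\<bar> \<le> (LBINT y. \<bar>heat_kernel_grad s (x - y) v * F y\<bar>)"
    by (rule integral_abs_bound)
  also have "\<dots> \<le> (LBINT y. ?c * (heat_kernel (2 * s) (x - y) * \<bar>F y\<bar>))"
  proof (rule integral_mono)
    show "integrable lborel (\<lambda>y. \<bar>heat_kernel_grad s (x - y) v * F y\<bar>)"
      by (intro integrable_abs integrable_heat_grad_integrand F s)
    show "integrable lborel (\<lambda>y. ?c * (heat_kernel (2 * s) (x - y) * \<bar>F y\<bar>))"
      using s by (intro integrable_mult_right integrable_heat_integrand integrable_abs F) auto
    fix y
    show "\<bar>heat_kernel_grad s (x - y) v * F y\<bar> \<le> ?c * (heat_kernel (2 * s) (x - y) * \<bar>F y\<bar>)"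
      unfolding abs_mult mult.assoc[symmetric]
      by (intro mult_right_mono abs_heat_kernel_grad_le s) auto
  qed
  finally show ?thesis unfolding eq by (simp add: heat_def)
qed

text \<open>Gives the joint measurability in time and space that the exchange of integrals needs.
  Representatives of \<open>F\<close> are chosen time by time, but the heat flow smooths this away:
  a change of \<open>F \<tau>\<close> moves its values by at most the kernel maximum times the L^1
  distance.\<close>

lemma continuous_on_heat_path:
  fixes F :: "real \<Rightarrow> real^'n \<Rightarrow> real" and T :: "real set"
  assumes F: "\<And>\<tau>. \<tau> \<in> T \<Longrightarrow> integrable lborel (F \<tau>)"
    and cont: "\<And>\<tau>. \<tau> \<in> T \<Longrightarrow> ((\<lambda>\<sigma>. LBINT x. \<bar>F \<sigma> x - F \<tau> x\<bar>) \<longlongrightarrow> 0) (at \<tau> within T)"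
    and s: "\<And>\<tau>. \<tau> \<in> T \<Longrightarrow> 0 < s \<tau>" "continuous_on T s"
  shows "continuous_on (T \<times> UNIV) (\<lambda>(\<tau>, x). heat (s \<tau>) (F \<tau>) x)"
  unfolding continuous_on_sequentially
proof (intro allI ballI impI, elim conjE)
  fix z :: "nat \<Rightarrow> real \<times> (real^'n)" and l
  assume l: "l \<in> T \<times> UNIV" and z: "\<forall>k. z k \<in> T \<times> UNIV" and lim: "z \<longlonglongrightarrow> l"
  obtain \<tau> x where l_eq: "l = (\<tau>, x)" by (cases l)
  define t where "t k = fst (z k)" for k
  define y where "y k = snd (z k)" for k
  have t: "t \<longlonglongrightarrow> \<tau>" "\<And>k. t k \<in> T" and \<tau>: "\<tau> \<in> T" and y: "y \<longlonglongrightarrow> x"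
    using l z tendsto_fst[OF lim] tendsto_snd[OF lim] by (auto simp: t_def[abs_def] y_def[abs_def] l_eq mem_Times_iff)
  have st: "(\<lambda>k. s (t k)) \<longlonglongrightarrow> s \<tau>"
    using s(2) t \<tau> unfolding continuous_on_sequentially by (auto simp: comp_def)
  let ?p = "- real CARD('n) / 2"
  have st': "(\<lambda>k. (4 * pi * s (t k)) powr ?p) \<longlonglongrightarrow> (4 * pi * s \<tau>) powr ?p"
    using s(1)[OF \<tau>] by (intro tendsto_intros st) auto
  have [measurable]: "F \<tau> \<in> borel_measurable borel"
    using borel_measurable_integrable[OF F[OF \<tau>]] by simp
  have "(\<lambda>k. LBINT x. \<bar>F (t k) x - F \<tau> x\<bar>) \<longlonglongrightarrow> 0"
  proof (rule tendstoI)
    fix e :: real assume e: "0 < e"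
    have "eventually (\<lambda>\<sigma>. dist (LBINT x. \<bar>F \<sigma> x - F \<tau> x\<bar>) 0 < e) (at \<tau> within T)"
      using cont[OF \<tau>] e by (rule tendstoD)
    then obtain d where d: "0 < d" "\<And>\<sigma>. \<sigma> \<in> T \<Longrightarrow> \<sigma> \<noteq> \<tau> \<Longrightarrow> dist \<sigma> \<tau> < d \<Longrightarrow> dist (LBINT x. \<bar>F \<sigma> x - F \<tau> x\<bar>) 0 < e"
      unfolding eventually_at by blast
    have "eventually (\<lambda>k. dist (t k) \<tau> < d) sequentially" using t(1) d(1) by (rule tendstoD)
    then show "eventually (\<lambda>k. dist (LBINT x. \<bar>F (t k) x - F \<tau> x\<bar>) 0 < e) sequentially"
    proof eventually_elim
      case (elim k)
      \<comment> \<open>The limit at tau ignores tau itself; indices with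
        \<open>t k = \<tau>\<close> contribute 0.\<close>
      then show ?case using d(2)[OF t(2)] e by (cases "t k = \<tau>") auto
    qed
  qed
  then have lim1: "(\<lambda>k. (4 * pi * s (t k)) powr ?p * (LBINT x. \<bar>F (t k) x - F \<tau> x\<bar>)) \<longlonglongrightarrow> 0"
    using tendsto_mult[OF st'] by fastforce
  have diff: "(\<lambda>k. heat (s (t k)) (F (t k)) (y k) - heat (s (t k)) (F \<tau>) (y k)) \<longlonglongrightarrow> 0"
  proof (rule Lim_null_comparison[OF _ lim1], intro always_eventually allI)
    fix k
    have "heat (s (t k)) (F (t k)) (y k) - heat (s (t k)) (F \<tau>) (y k) = heat (s (t k)) (\<lambda>x. F (t k) x - F \<tau> x) (y k)"
      unfolding heat_def right_diff_distrib
      by (intro Bochner_Integration.integral_diff[symmetric] integrable_heat_integrand F t(2) \<tau> s(1))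
    then show "norm (heat (s (t k)) (F (t k)) (y k) - heat (s (t k)) (F \<tau>) (y k))
        \<le> (4 * pi * s (t k)) powr ?p * (LBINT x. \<bar>F (t k) x - F \<tau> x\<bar>)"
      using abs_heat_le_integral[of "\<lambda>x. F (t k) x - F \<tau> x" "s (t k)" "y k"] F[OF t(2)] F[OF \<tau>] s(1)[OF t(2)] by simp
  qed
  obtain B where B: "\<And>k. (4 * pi * s (t k)) powr ?p \<le> B"
    using convergent_imp_Bseq[OF convergentI[OF st']] unfolding Bseq_def by (auto dest: abs_le_D1)
  have "(\<lambda>k. heat (s (t k)) (F \<tau>) (y k)) \<longlonglongrightarrow> heat (s \<tau>) (F \<tau>) x"
    unfolding heat_def
  proof (rule integral_dominated_convergence[where w="\<lambda>z. B * \<bar>F \<tau> z\<bar>"]; (measurable)?)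
    show "AE z in lborel. (\<lambda>k. heat_kernel (s (t k)) (y k - z) * F \<tau> z) \<longlonglongrightarrow> heat_kernel (s \<tau>) (x - z) * F \<tau> z"
      using s(1)[OF \<tau>] unfolding heat_kernel_def by (intro AE_I2 tendsto_intros st y) auto
    show "AE z in lborel. norm (heat_kernel (s (t k)) (y k - z) * F \<tau> z) \<le> B * \<bar>F \<tau> z\<bar>" for k
      using order_trans[OF heat_kernel_le[OF s(1)[OF t(2)]] B]
      by (intro AE_I2) (auto simp: abs_mult intro!: mult_right_mono)
  qed (use F[OF \<tau>] in auto)
  from tendsto_add[OF diff this]
  show "((\<lambda>(\<tau>, x). heat (s \<tau>) (F \<tau>) x) \<circ> z) \<longlonglongrightarrow> (\<lambda>(\<tau>, x). heat (s \<tau>) (F \<tau>) x) l"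
    by (simp add: comp_def l_eq t_def y_def split_beta')
qed

lemma abs_flux: "\<bar>flux q r\<bar> = \<bar>r\<bar> powr q"
proof (cases "r = 0")
  case False
  then have "\<bar>r\<bar> * \<bar>r\<bar> powr (q - 1) = \<bar>r\<bar> powr q"
    using powr_add[of "\<bar>r\<bar>" 1 "q - 1"] by simp
  then show ?thesis by (simp add: flux_def abs_mult)
qed (simp add: flux_def)

section \<open>The Duhamel integral\<close>

text \<open>An upper bound for the Beta value B(1/2, 1-b), produced by halving the time interval in
  \<open>nn_integral_beta_le\<close>.\<close>

definition beta_const :: "real \<Rightarrow> real" where
  "beta_const b = (1 / (1 - b) + 2) * (1 / 2) powr (1 / 2 - b)"

lemma beta_const_pos: "b < 1 \<Longrightarrow> 0 < beta_const b"
  by (auto simp: beta_const_def intro!: mult_pos_pos add_pos_pos)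

text \<open>Each half of (0,t) contains one singularity; the other factor is monotone and is
  replaced by its value at t/2.\<close>

lemma nn_integral_beta_le:
  fixes b t :: real
  assumes b: "0 \<le> b" "b < 1" and t: "0 < t"
  shows "(\<integral>\<^sup>+\<tau>. indicator {0<..<t} \<tau> * ennreal ((t - \<tau>) powr (- 1 / 2) * \<tau> powr (- b)) \<partial>lborel)
    \<le> ennreal (beta_const b * t powr (1 / 2 - b))"
proof -
  let ?h = "t / 2"
  have "(\<integral>\<^sup>+\<tau>. indicator {0<..<t} \<tau> * ennreal ((t - \<tau>) powr (- 1 / 2) * \<tau> powr (- b)) \<partial>lborel)
    \<le> (\<integral>\<^sup>+\<tau>. ennreal (?h powr (- 1 / 2) * \<tau> powr (- b)) * indicator {0..?h} \<tau>
        + ennreal (?h powr (- b) * (t - \<tau>) powr (- 1 / 2)) * indicator {0..?h} (t - \<tau>) \<partial>lborel)"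
  proof (rule nn_integral_mono)
    fix \<tau> :: real
    show "indicator {0<..<t} \<tau> * ennreal ((t - \<tau>) powr (- 1 / 2) * \<tau> powr (- b))
      \<le> ennreal (?h powr (- 1 / 2) * \<tau> powr (- b)) * indicator {0..?h} \<tau>
        + ennreal (?h powr (- b) * (t - \<tau>) powr (- 1 / 2)) * indicator {0..?h} (t - \<tau>)"
    proof (cases "0 < \<tau> \<and> \<tau> < t")
      case True
      show ?thesis
      proof (cases "\<tau> \<le> ?h")
        case le: True
        have "(t - \<tau>) powr (- 1 / 2) \<le> ?h powr (- 1 / 2)"
          using True le by (intro powr_mono2') auto
        then have "ennreal ((t - \<tau>) powr (- 1 / 2) * \<tau> powr (- b)) \<le> ennreal (?h powr (- 1 / 2) * \<tau> powr (- b))"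
          by (intro ennreal_leI mult_right_mono) auto
        then show ?thesis using True le by (auto simp: indicator_def intro: add_increasing2)
      next
        case False
        have "\<tau> powr (- b) \<le> ?h powr (- b)"
          using True False b by (intro powr_mono2') auto
        then have "ennreal ((t - \<tau>) powr (- 1 / 2) * \<tau> powr (- b)) \<le> ennreal (?h powr (- b) * (t - \<tau>) powr (- 1 / 2))"
          by (subst mult.commute) (intro ennreal_leI mult_right_mono, auto)
        then show ?thesis using True False by (auto simp: indicator_def)
      qed
    qed auto
  qed
  also have "\<dots> = ennreal (?h powr (- 1 / 2) * (?h powr (1 - b) / (1 - b))) + ennreal (?h powr (- b) * (?h powr (1 / 2) / (1 / 2)))"
  proof -
    have "((\<lambda>\<tau>. ?h powr (- 1 / 2) * \<tau> powr (- b)) has_integral ?h powr (- 1 / 2) * (?h powr (- b + 1) / (- b + 1))) {0..?h}"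
      using b t by (intro has_integral_mult_right has_integral_powr_from_0) auto
    then have 1: "(\<integral>\<^sup>+\<tau>. ennreal (?h powr (- 1 / 2) * \<tau> powr (- b)) * indicator {0..?h} \<tau> \<partial>lborel)
        = ennreal (?h powr (- 1 / 2) * (?h powr (1 - b) / (1 - b)))"
      by (subst nn_integral_has_integral_lebesgue') auto
    have "((\<lambda>\<tau>. ?h powr (- b) * \<tau> powr (- 1 / 2)) has_integral ?h powr (- b) * (?h powr (- 1 / 2 + 1) / (- 1 / 2 + 1))) {0..?h}"
      using t by (intro has_integral_mult_right has_integral_powr_from_0) auto
    then have "(\<integral>\<^sup>+\<tau>. ennreal (?h powr (- b) * \<tau> powr (- 1 / 2)) * indicator {0..?h} \<tau> \<partial>lborel)
        = ennreal (?h powr (- b) * (?h powr (1 / 2) / (1 / 2)))"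
      by (subst nn_integral_has_integral_lebesgue') auto
    then have 2: "(\<integral>\<^sup>+\<tau>. ennreal (?h powr (- b) * (t - \<tau>) powr (- 1 / 2)) * indicator {0..?h} (t - \<tau>) \<partial>lborel)
        = ennreal (?h powr (- b) * (?h powr (1 / 2) / (1 / 2)))"
      using nn_integral_lborel_reflect[of "\<lambda>\<tau>. ennreal (?h powr (- b) * \<tau> powr (- 1 / 2)) * indicator {0..?h} \<tau>" t]
      by simp
    show ?thesis
      by (subst nn_integral_add) (simp_all only: 1 2, measurable)
  qed
  also have "\<dots> = ennreal (?h powr (- 1 / 2) * (?h powr (1 - b) / (1 - b)) + ?h powr (- b) * (?h powr (1 / 2) / (1 / 2)))"
    using b by (intro ennreal_plus[symmetric]) auto
  also have "?h powr (- 1 / 2) * (?h powr (1 - b) / (1 - b)) + ?h powr (- b) * (?h powr (1 / 2) / (1 / 2)) = beta_const b * t powr (1 / 2 - b)"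
  proof -
    have "?h powr (- 1 / 2) * ?h powr (1 - b) = ?h powr (1 / 2 - b)" "?h powr (- b) * ?h powr (1 / 2) = ?h powr (1 / 2 - b)"
      by (simp_all flip: powr_add add: algebra_simps)
    moreover have "?h powr (1 / 2 - b) = (1 / 2) powr (1 / 2 - b) * t powr (1 / 2 - b)"
      using t by (subst powr_mult[symmetric]) auto
    ultimately show ?thesis by (simp add: beta_const_def algebra_simps)
  qed
  finally show ?thesis .
qed

text \<open>The constant in the pointwise bound
  \<open>|a \<cdot> \<nabla>e\<^bsup>s\<Delta>\<^esup>F| \<le> c s\<^bsup>-1/2\<^esup> e\<^bsup>2s\<Delta>\<^esup>|F|\<close>, which reduces the Duhamel term to heat flows of \<open>|u|\<^sup>q\<close>.\<close>

definition grad_const :: "real^'n \<Rightarrow> real" where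
  "grad_const a = norm a * 2 powr (real CARD('n) / 2)"

lemma grad_const_nonneg: "0 \<le> grad_const a"
  by (simp add: grad_const_def)

context
  fixes a :: "real^'n" and q :: real and u0 :: "real^'n \<Rightarrow> real" and u :: "real \<Rightarrow> real^'n \<Rightarrow> real"
    and F :: "real \<Rightarrow> real^'n \<Rightarrow> real"
  assumes mild: "mild_formula a q u0 u"
    and F_def: "\<And>\<tau> x. F \<tau> x = \<bar>u \<tau> x\<bar> powr q"
    and u_meas: "\<And>\<tau>. 0 < \<tau> \<Longrightarrow> u \<tau> \<in> borel_measurable borel"
    and F_int: "\<And>\<tau>. 0 < \<tau> \<Longrightarrow> integrable lborel (F \<tau>)"
begin

text \<open>\<open>mild_formula\<close> includes the integrability in time, so the modulus may be
  taken inside the integral; the gradient bound then replaces the derivative by the heat flow at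
  twice the time difference.\<close>

lemma duhamel_pointwise:
  assumes t: "0 < t"
  shows "AE x in lborel. ennreal \<bar>u t x - heat t u0 x\<bar> \<le>
    (\<integral>\<^sup>+\<tau>. indicator {0<..<t} \<tau> * (ennreal (grad_const a * (t - \<tau>) powr (- 1 / 2)) * ennreal (heat (2 * (t - \<tau>)) (F \<tau>) x)) \<partial>lborel)"
proof -
  have flux_int: "integrable lborel (\<lambda>y. flux q (u \<tau> y))" if "0 < \<tau>" for \<tau>
  proof (rule Bochner_Integration.integrable_bound[OF F_int[OF that]])
    show "(\<lambda>y. flux q (u \<tau> y)) \<in> borel_measurable lborel"
      using u_meas[OF that] unfolding flux_def by measurable
  qed (simp add: abs_flux F_def)
  let ?k = "\<lambda>x \<tau>. frechet_derivative (heat (t - \<tau>) (\<lambda>y. flux q (u \<tau> y))) (at x) a"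
  have "AE x in lborel. set_integrable lborel {0<..<t} (?k x) \<and> u t x = heat t u0 x - (LINT \<tau>:{0<..<t}|lborel. ?k x \<tau>)"
    using mild t unfolding mild_formula_def Let_def by blast
  then show ?thesis
  proof eventually_elim
    case (elim x)
    then have int: "integrable lborel (\<lambda>\<tau>. indicator {0<..<t} \<tau> *\<^sub>R ?k x \<tau>)"
      by (simp add: set_integrable_def)
    have "\<bar>u t x - heat t u0 x\<bar> = norm (LBINT \<tau>. indicator {0<..<t} \<tau> *\<^sub>R ?k x \<tau>)"
      using elim by (simp add: set_lebesgue_integral_def)
    then have "ennreal \<bar>u t x - heat t u0 x\<bar> \<le> (\<integral>\<^sup>+\<tau>. ennreal (norm (indicator {0<..<t} \<tau> *\<^sub>R ?k x \<tau>)) \<partial>lborel)"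
      using integral_norm_bound_ennreal[OF int] by simp
    also have "\<dots> \<le> (\<integral>\<^sup>+\<tau>. indicator {0<..<t} \<tau> * (ennreal (grad_const a * (t - \<tau>) powr (- 1 / 2)) * ennreal (heat (2 * (t - \<tau>)) (F \<tau>) x)) \<partial>lborel)"
    proof (rule nn_integral_mono)
      fix \<tau>
      show "ennreal (norm (indicator {0<..<t} \<tau> *\<^sub>R ?k x \<tau>))
        \<le> indicator {0<..<t} \<tau> * (ennreal (grad_const a * (t - \<tau>) powr (- 1 / 2)) * ennreal (heat (2 * (t - \<tau>)) (F \<tau>) x))"
      proof (cases "0 < \<tau> \<and> \<tau> < t")
        case True
        have "\<bar>?k x \<tau>\<bar> \<le> grad_const a * (t - \<tau>) powr (- 1 / 2) * heat (2 * (t - \<tau>)) (\<lambda>y. \<bar>flux q (u \<tau> y)\<bar>) x"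
          unfolding grad_const_def using True by (intro abs_heat_derivative_le flux_int) auto
        also have "(\<lambda>y. \<bar>flux q (u \<tau> y)\<bar>) = F \<tau>" by (simp add: abs_flux F_def fun_eq_iff)
        finally have "ennreal \<bar>?k x \<tau>\<bar> \<le> ennreal (grad_const a * (t - \<tau>) powr (- 1 / 2) * heat (2 * (t - \<tau>)) (F \<tau>) x)"
          by (rule ennreal_leI)
        then show ?thesis using True grad_const_nonneg[of a] by (simp add: ennreal_mult')
      qed simp
    qed
    finally show ?case .
  qed
qed

lemma heat_F_nonneg: "0 \<le> heat s (F \<tau>) x"
  unfolding heat_def by (intro integral_nonneg_AE) (auto simp: F_def)

text \<open>All information on the nonlinearity sits in \<open>le\<close>; what is left is the Beta
  integral, which converges at time 0 because b < 1.\<close>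

lemma duhamel_sup:
  assumes t: "0 < t" and b: "0 \<le> b" "b < 1" and K: "0 \<le> K"
    and le: "\<And>\<tau> x. 0 < \<tau> \<Longrightarrow> \<tau> < t \<Longrightarrow> heat (2 * (t - \<tau>)) (F \<tau>) x \<le> K * \<tau> powr (- b)"
  shows "AE x in lborel. \<bar>u t x - heat t u0 x\<bar> \<le> grad_const a * K * beta_const b * t powr (1 / 2 - b)"
  using duhamel_pointwise[OF t]
proof eventually_elim
  case (elim x)
  note c = grad_const_nonneg[of a]
  have "ennreal \<bar>u t x - heat t u0 x\<bar> \<le>
    (\<integral>\<^sup>+\<tau>. ennreal (grad_const a * K) * (indicator {0<..<t} \<tau> * ennreal ((t - \<tau>) powr (- 1 / 2) * \<tau> powr (- b))) \<partial>lborel)"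
  proof (rule order_trans[OF elim nn_integral_mono])
    fix \<tau>
    show "indicator {0<..<t} \<tau> * (ennreal (grad_const a * (t - \<tau>) powr (- 1 / 2)) * ennreal (heat (2 * (t - \<tau>)) (F \<tau>) x))
      \<le> ennreal (grad_const a * K) * (indicator {0<..<t} \<tau> * ennreal ((t - \<tau>) powr (- 1 / 2) * \<tau> powr (- b)))"
    proof (cases "0 < \<tau> \<and> \<tau> < t")
      case True
      have "grad_const a * (t - \<tau>) powr (- 1 / 2) * heat (2 * (t - \<tau>)) (F \<tau>) x \<le> grad_const a * (t - \<tau>) powr (- 1 / 2) * (K * \<tau> powr (- b))"
        using le[of \<tau> x] True c by (intro mult_left_mono) auto
      then show ?thesis using True c K heat_F_nonneg
        by (auto simp: mult_ac simp flip: ennreal_mult intro!: ennreal_leI)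
    qed simp
  qed
  also have "\<dots> \<le> ennreal (grad_const a * K) * ennreal (beta_const b * t powr (1 / 2 - b))"
    using nn_integral_beta_le[OF b t] by (subst nn_integral_cmult) (auto intro!: mult_left_mono)
  also have "\<dots> = ennreal (grad_const a * K * beta_const b * t powr (1 / 2 - b))"
    using c K beta_const_pos[OF b(2)] by (simp add: ennreal_mult[symmetric] mult.assoc)
  finally show ?case
    using c K beta_const_pos[OF b(2)] by (subst (asm) ennreal_le_iff) auto
qed

text \<open>After Tonelli the heat flow contracts L^1, so only the mass of the source at each time
  enters.\<close>

lemma duhamel_L1:
  assumes t: "0 < t" and b: "0 \<le> b" "b < 1" and K: "0 \<le> K"
    and F_cont: "\<And>\<tau>. 0 < \<tau> \<Longrightarrow> ((\<lambda>\<sigma>. LBINT x. \<bar>F \<sigma> x - F \<tau> x\<bar>) \<longlongrightarrow> 0) (at \<tau> within {0<..})"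
    and le: "\<And>\<tau>. 0 < \<tau> \<Longrightarrow> \<tau> < t \<Longrightarrow> (LBINT x. F \<tau> x) \<le> K * \<tau> powr (- b)"
  shows "(\<integral>\<^sup>+x. ennreal \<bar>u t x - heat t u0 x\<bar> \<partial>lborel) \<le> ennreal (grad_const a * K * beta_const b * t powr (1 / 2 - b))"
proof -
  note c = grad_const_nonneg[of a]
  let ?T = "{0<..<t}"
  let ?H = "\<lambda>\<tau> x. indicator ?T \<tau> * ennreal (heat (2 * (t - \<tau>)) (F \<tau>) x)"
  \<comment> \<open>Continuity on the open strip, extended by 0, yields the measurability for
    Tonelli.\<close>
  have "continuous_on (?T \<times> UNIV) (\<lambda>(\<tau>, x). heat (2 * (t - \<tau>)) (F \<tau>) x)"
    by (intro continuous_on_heat_path F_int tendsto_within_subset[OF F_cont]) (auto intro!: continuous_intros)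
  then have "(\<lambda>z. indicator (?T \<times> UNIV) z *\<^sub>R (case z of (\<tau>, x) \<Rightarrow> heat (2 * (t - \<tau>)) (F \<tau>) x)) \<in> borel_measurable borel"
    by (intro borel_measurable_continuous_on_indicator) (auto intro!: borel_open open_Times)
  then have "(\<lambda>z. ennreal (indicator (?T \<times> UNIV) z *\<^sub>R (case z of (\<tau>, x) \<Rightarrow> heat (2 * (t - \<tau>)) (F \<tau>) x))) \<in> borel_measurable (borel \<Otimes>\<^sub>M borel)"
    unfolding borel_prod by measurable
  also have "(\<lambda>z. ennreal (indicator (?T \<times> UNIV) z *\<^sub>R (case z of (\<tau>, x) \<Rightarrow> heat (2 * (t - \<tau>)) (F \<tau>) x))) = (\<lambda>(\<tau>, x). ?H \<tau> x)"
    by (auto simp: fun_eq_iff indicator_def)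
  finally have [measurable]: "(\<lambda>(\<tau>, x). ?H \<tau> x) \<in> borel_measurable (borel \<Otimes>\<^sub>M borel)" .
  then have H_snd: "(\<lambda>x. ?H \<tau> x) \<in> borel_measurable lborel" for \<tau>
    using measurable_Pair2[of "\<lambda>(\<tau>, x). ?H \<tau> x" borel borel borel \<tau>] by simp
  let ?c = "\<lambda>\<tau>. ennreal (grad_const a * (t - \<tau>) powr (- 1 / 2))"
  have "(\<integral>\<^sup>+x. ennreal \<bar>u t x - heat t u0 x\<bar> \<partial>lborel) \<le> (\<integral>\<^sup>+x. \<integral>\<^sup>+\<tau>. ?c \<tau> * ?H \<tau> x \<partial>lborel \<partial>lborel)"
  proof (rule nn_integral_mono_AE)
    show "AE x in lborel. ennreal \<bar>u t x - heat t u0 x\<bar> \<le> (\<integral>\<^sup>+\<tau>. ?c \<tau> * ?H \<tau> x \<partial>lborel)"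
      using duhamel_pointwise[OF t] by eventually_elim (simp only: mult.left_commute)
  qed
  also have "\<dots> = (\<integral>\<^sup>+\<tau>. \<integral>\<^sup>+x. ?c \<tau> * ?H \<tau> x \<partial>lborel \<partial>lborel)"
    by (rule lborel_pair.Fubini') measurable
  also have "\<dots> \<le> (\<integral>\<^sup>+\<tau>. ennreal (grad_const a * K) * (indicator ?T \<tau> * ennreal ((t - \<tau>) powr (- 1 / 2) * \<tau> powr (- b))) \<partial>lborel)"
  proof (rule nn_integral_mono)
    fix \<tau>
    show "(\<integral>\<^sup>+x. ?c \<tau> * ?H \<tau> x \<partial>lborel) \<le> ennreal (grad_const a * K) * (indicator ?T \<tau> * ennreal ((t - \<tau>) powr (- 1 / 2) * \<tau> powr (- b)))"
    proof (cases "0 < \<tau> \<and> \<tau> < t")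
      case True
      have F0: "\<bar>F \<tau> x\<bar> = F \<tau> x" for x by (simp add: F_def)
      have "(\<integral>\<^sup>+x. ?H \<tau> x \<partial>lborel) = (\<integral>\<^sup>+x. ennreal \<bar>heat (2 * (t - \<tau>)) (F \<tau>) x\<bar> \<partial>lborel)"
        using True heat_F_nonneg by (intro nn_integral_cong) auto
      also have "\<dots> \<le> ennreal (LBINT x. F \<tau> x)"
        using nn_integral_abs_heat_le[OF F_int[of \<tau>], of "2 * (t - \<tau>)"] True by (simp add: F0)
      also have "\<dots> \<le> ennreal (K * \<tau> powr (- b))"
        using True by (intro ennreal_leI le) auto
      finally have "?c \<tau> * (\<integral>\<^sup>+x. ?H \<tau> x \<partial>lborel) \<le> ?c \<tau> * ennreal (K * \<tau> powr (- b))"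
        by (intro mult_left_mono) auto
      also have "\<dots> = ennreal (grad_const a * K) * (indicator ?T \<tau> * ennreal ((t - \<tau>) powr (- 1 / 2) * \<tau> powr (- b)))"
        using True c K by (simp add: mult_ac flip: ennreal_mult)
      finally show ?thesis unfolding nn_integral_cmult[OF H_snd] .
    qed simp
  qed
  also have "\<dots> \<le> ennreal (grad_const a * K) * ennreal (beta_const b * t powr (1 / 2 - b))"
    using nn_integral_beta_le[OF b t] by (subst nn_integral_cmult) (auto intro!: mult_left_mono)
  also have "\<dots> = ennreal (grad_const a * K * beta_const b * t powr (1 / 2 - b))"
    using c K beta_const_pos[OF b(2)] by (simp add: ennreal_mult[symmetric] mult.assoc)
  finally show ?thesis .
qed

end

section \<open>Solutions of the Cauchy problem\<close>

lemma filterlim_shift_within: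
  fixes t0 s :: real
  assumes "\<And>r. r \<in> T' \<Longrightarrow> t0 + r \<in> T"
  shows "filterlim (\<lambda>r. t0 + r) (at (t0 + s) within T) (at s within T')"
  unfolding filterlim_at
proof
  show "((\<lambda>r. t0 + r) \<longlongrightarrow> t0 + s) (at s within T')" by (intro tendsto_intros)
  show "eventually (\<lambda>r. t0 + r \<in> T \<and> t0 + r \<noteq> t0 + s) (at s within T')"
    using assms by (auto simp: eventually_at intro!: exI[of _ 1])
qed

lemma continuous_Lp_shift:
  assumes "continuous_Lp p T u" "\<And>r. r \<in> T' \<Longrightarrow> t0 + r \<in> T"
  shows "continuous_Lp p T' (\<lambda>s. u (t0 + s))"
  unfolding continuous_Lp_def
proof (intro ballI conjI)
  fix s assume s: "s \<in> T'"
  then show "u (t0 + s) \<in> Lp p" using assms by (auto simp: continuous_Lp_def)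
  have "((\<lambda>r. Lp_norm p (\<lambda>x. u r x - u (t0 + s) x)) \<longlongrightarrow> 0) (at (t0 + s) within T)"
    using assms s by (auto simp: continuous_Lp_def)
  then show "((\<lambda>r. Lp_norm p (\<lambda>x. u (t0 + r) x - u (t0 + s) x)) \<longlongrightarrow> 0) (at s within T')"
    by (rule filterlim_compose[OF _ filterlim_shift_within]) (rule assms(2))
qed

lemma has_derivative_Lp_shift:
  assumes "has_derivative_Lp p T u v" "\<And>r. r \<in> T' \<Longrightarrow> t0 + r \<in> T"
  shows "has_derivative_Lp p T' (\<lambda>s. u (t0 + s)) (\<lambda>s. v (t0 + s))"
  unfolding has_derivative_Lp_def
proof (intro ballI)
  fix s assume s: "s \<in> T'"
  have "((\<lambda>r. Lp_norm p (\<lambda>x. (u r x - u (t0 + s) x) / (r - (t0 + s)) - v (t0 + s) x)) \<longlongrightarrow> 0) (at (t0 + s) within T)"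
    using assms s by (auto simp: has_derivative_Lp_def)
  from filterlim_compose[OF this filterlim_shift_within[of T' t0 T s]]
  show "((\<lambda>r. Lp_norm p (\<lambda>x. (u (t0 + r) x - u (t0 + s) x) / (r - s) - v (t0 + s) x)) \<longlongrightarrow> 0) (at s within T')"
    using assms(2) by simp
qed

text \<open>The equation is autonomous, so every clause shifts in time; smoothing estimates can then
  be applied from a later starting time with \<open>u t0\<close> as data.\<close>

lemma is_solution_shift:
  fixes a :: "real^'n"
  assumes sol: "is_solution a q u0 u" and t0: "0 \<le> t0"
  shows "is_solution a q (u t0) (\<lambda>s. u (t0 + s))"
proof -
  obtain ut Du D2u where D: "\<forall>t>0. \<forall>i. weak_partial i (u t) (Du i t) \<and>
                 (\<forall>j. weak_partial j (Du i t) (D2u i j t))"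
    and C: "\<forall>p. 1 < p \<and> p < \<infinity> \<longrightarrow>
        continuous_Lp p {0<..} u \<and>
        (\<forall>i. continuous_Lp p {0<..} (Du i)) \<and>
        (\<forall>i j. continuous_Lp p {0<..} (D2u i j)) \<and>
        continuous_Lp p {0<..} ut \<and> has_derivative_Lp p {0<..} u ut"
    and E: "\<forall>t>0. \<exists>N. (\<forall>i. weak_partial i (\<lambda>x. flux q (u t x)) (N i)) \<and>
        (AE x in lborel. ut t x - (\<Sum>i\<in>UNIV. D2u i i t x) + (\<Sum>i\<in>UNIV. a $ i * N i x) = 0)"
    using sol unfolding is_solution_def by (elim conjE exE) (rule that; assumption)
  have shift: "t0 + r \<in> {0<..}" if "r \<in> {0<..}" for r using t0 that by auto
  show ?thesis
    unfolding is_solution_def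
  proof (intro conjI exI[of _ "\<lambda>s. ut (t0 + s)"] exI[of _ "\<lambda>i s. Du i (t0 + s)"] exI[of _ "\<lambda>i j s. D2u i j (t0 + s)"] allI impI)
    show "continuous_Lp 1 {0..} (\<lambda>s. u (t0 + s))"
      using sol t0 by (intro continuous_Lp_shift[where T="{0..}"]) (auto simp: is_solution_def)
  qed (use t0 C D E shift in \<open>auto intro!: continuous_Lp_shift[where T="{0<..}"] has_derivative_Lp_shift[where T="{0<..}"]\<close>)
qed

context
  fixes a :: "real^'n" and q :: real and u0 :: "real^'n \<Rightarrow> real" and u :: "real \<Rightarrow> real^'n \<Rightarrow> real"
  assumes sol: "is_solution a q u0 u"
begin

lemma solution_integrable: "0 \<le> t \<Longrightarrow> integrable lborel (u t)"
  using sol by (auto simp: is_solution_def continuous_Lp_def Lp_1_iff_integrable)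

lemma solution_L1_continuous:
  assumes "0 \<le> t"
  shows "((\<lambda>s. LBINT x. \<bar>u s x - u t x\<bar>) \<longlongrightarrow> 0) (at t within {0..})"
proof -
  have "((\<lambda>s. Lp_norm 1 (\<lambda>x. u s x - u t x)) \<longlongrightarrow> 0) (at t within {0..})"
    using sol assms by (auto simp: is_solution_def continuous_Lp_def)
  then have "((\<lambda>s. enn2real (Lp_norm 1 (\<lambda>x. u s x - u t x))) \<longlongrightarrow> enn2real 0) (at t within {0..})"
    by (intro tendsto_intros) auto
  moreover have "eventually (\<lambda>s. enn2real (Lp_norm 1 (\<lambda>x. u s x - u t x)) = (LBINT x. \<bar>u s x - u t x\<bar>)) (at t within {0..})"
    unfolding eventually_at_filter
  proof (intro always_eventually allI impI)
    fix s :: real assume "s \<in> {0..}"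
    then have "integrable lborel (\<lambda>x. \<bar>u s x - u t x\<bar>)"
      using solution_integrable[of s] solution_integrable[OF assms] by simp
    then show "enn2real (Lp_norm 1 (\<lambda>x. u s x - u t x)) = (LBINT x. \<bar>u s x - u t x\<bar>)"
      by (simp add: Lp_norm_1 nn_integral_eq_integral integral_nonneg_AE)
  qed
  ultimately show ?thesis
    by (simp add: Lim_transform_eventually)
qed

text \<open>Continuity up to and including time 0 is what the hitting-time argument uses.\<close>

lemma solution_norm_continuous: "continuous_on {0..} (\<lambda>t. L1_norm (u t))"
  unfolding continuous_on_def
proof
  fix t :: real assume t: "t \<in> {0..}"
  have "eventually (\<lambda>s. norm (L1_norm (u s) - L1_norm (u t)) \<le> (LBINT x. \<bar>u s x - u t x\<bar>)) (at t within {0..})"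
    unfolding eventually_at_filter
  proof (intro always_eventually allI impI)
    fix s :: real assume "s \<in> {0..}"
    then have int: "integrable lborel (u s)" "integrable lborel (u t)"
      using t by (auto intro: solution_integrable)
    then have "L1_norm (u s) - L1_norm (u t) = (LBINT x. \<bar>u s x\<bar> - \<bar>u t x\<bar>)"
      by simp
    then have "norm (L1_norm (u s) - L1_norm (u t)) \<le> (LBINT x. \<bar>\<bar>u s x\<bar> - \<bar>u t x\<bar>\<bar>)"
      by (simp add: integral_abs_bound)
    also have "\<dots> \<le> (LBINT x. \<bar>u s x - u t x\<bar>)"
      using int by (intro integral_mono) auto
    finally show "norm (L1_norm (u s) - L1_norm (u t)) \<le> (LBINT x. \<bar>u s x - u t x\<bar>)" .
  qed
  from Lim_null_comparison[OF this solution_L1_continuous] t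
  show "((\<lambda>t. L1_norm (u t)) \<longlongrightarrow> L1_norm (u t)) (at t within {0..})"
    by (simp add: LIM_zero_iff)
qed

end

lemma AE_abs_le_if_Lp_norm_top_le:
  assumes "Lp_norm \<infinity> f \<le> ennreal B" "0 \<le> B"
  shows "AE x in lborel. \<bar>f x\<bar> \<le> B"
proof -
  have le: "esssup lborel (\<lambda>x. ennreal \<bar>f x\<bar>) \<le> ennreal B"
    using assms(1) by (simp add: Lp_norm_def)
  show ?thesis
    using esssup_AE[of "\<lambda>x. ennreal \<bar>f x\<bar>" lborel]
  proof eventually_elim
    case (elim x)
    then have "ennreal \<bar>f x\<bar> \<le> ennreal B" using le by (rule order_trans)
    then show ?case using assms(2) by (simp add: ennreal_le_iff)
  qed
qed

lemma recip_simps [simp]: "recip 1 = 1" "recip top = 0"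
  by (simp_all add: recip_def)

lemma Lp_norm_finite_imp_nn_integral:
  assumes "0 < p" "Lp_norm (ennreal p) f < \<infinity>"
  shows "(\<integral>\<^sup>+x. ennreal (\<bar>f x\<bar> powr p) \<partial>lborel) < \<infinity>"
  using assms by (auto simp: Lp_norm_def Let_def less_top[symmetric] split: if_splits)

text \<open>Mean value theorem on [0,B]. It turns L^1 continuity of \<open>u\<close> into L^1
  continuity of the source wherever \<open>u\<close> is bounded by \<open>B\<close>.\<close>

lemma abs_powr_diff_le:
  fixes x y B q :: real
  assumes "1 \<le> q" "\<bar>x\<bar> \<le> B" "\<bar>y\<bar> \<le> B"
  shows "\<bar>\<bar>x\<bar> powr q - \<bar>y\<bar> powr q\<bar> \<le> q * B powr (q - 1) * \<bar>x - y\<bar>"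
proof -
  have main: "\<bar>s powr q - r powr q\<bar> \<le> q * B powr (q - 1) * \<bar>s - r\<bar>" if "0 \<le> r" "r < s" "s \<le> B" for r s :: real
  proof -
    have "\<exists>l z. r < z \<and> z < s \<and> DERIV (\<lambda>x. x powr q) z :> l \<and> s powr q - r powr q = (s - r) * l"
    proof (rule MVT[OF \<open>r < s\<close>])
      show "continuous_on {r..s} (\<lambda>x. x powr q)"
        using assms(1) that by (intro continuous_on_powr') (auto intro!: continuous_intros)
      show "(\<lambda>x. x powr q) differentiable (at z)" if "r < z" "z < s" for z
        using that \<open>0 \<le> r\<close> by (intro differentiableI[OF has_field_derivative_imp_has_derivative[OF has_real_derivative_powr]]) auto
    qed
    then obtain l z where z: "r < z" "z < s" "DERIV (\<lambda>x. x powr q) z :> l" and eq: "s powr q - r powr q = (s - r) * l"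
      by blast
    have "l = q * z powr (q - 1)"
      using z that by (intro DERIV_unique[OF z(3)] has_real_derivative_powr) auto
    moreover have "z powr (q - 1) \<le> B powr (q - 1)"
      using z that assms by (intro powr_mono2) auto
    ultimately have l: "0 \<le> l" "l \<le> q * B powr (q - 1)"
      using assms(1) by (auto intro!: mult_left_mono)
    then have "(s - r) * l \<le> (s - r) * (q * B powr (q - 1))"
      using that by (intro mult_left_mono) auto
    then show ?thesis unfolding eq using l that by (simp add: abs_mult mult_ac)
  qed
  have "\<bar>\<bar>x\<bar> powr q - \<bar>y\<bar> powr q\<bar> \<le> q * B powr (q - 1) * \<bar>\<bar>x\<bar> - \<bar>y\<bar>\<bar>"
  proof (cases "\<bar>x\<bar>" "\<bar>y\<bar>" rule: linorder_cases)
    case less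
    then show ?thesis using main[of "\<bar>x\<bar>" "\<bar>y\<bar>"] assms by (simp add: abs_minus_commute)
  next
    case greater
    then show ?thesis using main[of "\<bar>y\<bar>" "\<bar>x\<bar>"] assms by simp
  qed simp
  also have "\<dots> \<le> q * B powr (q - 1) * \<bar>x - y\<bar>"
    using assms by (intro mult_left_mono) auto
  finally show ?thesis .
qed

text \<open>One factor |f| is kept for the mass, the other q - 1 go to the supremum. The decay
  exponents of the source in L^1 arise from this splitting.\<close>

lemma
  fixes f :: "real^'n \<Rightarrow> real"
  assumes f: "integrable lborel f" and B: "AE x in lborel. \<bar>f x\<bar> \<le> B" and q: "1 \<le> q"
  shows integrable_powr_if_bounded: "integrable lborel (\<lambda>x. \<bar>f x\<bar> powr q)"
    and integral_powr_le: "(LBINT x. \<bar>f x\<bar> powr q) \<le> B powr (q - 1) * L1_norm f"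
proof -
  have [measurable]: "f \<in> borel_measurable borel"
    using borel_measurable_integrable[OF f] by simp
  have le: "AE x in lborel. \<bar>f x\<bar> powr q \<le> B powr (q - 1) * \<bar>f x\<bar>"
    using B
  proof eventually_elim
    case (elim x)
    have "\<bar>f x\<bar> powr q = \<bar>f x\<bar> powr (q - 1) * \<bar>f x\<bar>"
    proof (cases "f x = 0")
      case False
      then show ?thesis using powr_add[of "\<bar>f x\<bar>" "q - 1" 1] by simp
    qed simp
    also have "\<dots> \<le> B powr (q - 1) * \<bar>f x\<bar>"
      using elim q by (intro mult_right_mono powr_mono2) auto
    finally show ?case .
  qed
  have int: "integrable lborel (\<lambda>x. B powr (q - 1) * \<bar>f x\<bar>)" using f by simp
  show "integrable lborel (\<lambda>x. \<bar>f x\<bar> powr q)"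
    using le by (intro Bochner_Integration.integrable_bound[OF int]) (auto elim!: eventually_mono)
  then have "(LBINT x. \<bar>f x\<bar> powr q) \<le> (LBINT x. B powr (q - 1) * \<bar>f x\<bar>)"
    using le int by (intro integral_mono_AE) auto
  then show "(LBINT x. \<bar>f x\<bar> powr q) \<le> B powr (q - 1) * L1_norm f" by simp
qed

section \<open>Consequences of the smoothing estimate\<close>

context
  fixes a :: "real^'n" and q :: real
  assumes smoothing: "\<And>r p :: ennreal. 1 \<le> r \<Longrightarrow> r \<le> p \<Longrightarrow>
      \<exists>C::real. \<forall>u0 u. is_solution a q u0 u \<and> u0 \<in> Lp 1 \<inter> Lp r \<longrightarrow>
        (\<forall>t>0. Lp_norm p (u t) \<le>
          ennreal (C * t powr (- (real CARD('n) / 2) * (recip r - recip p))) * Lp_norm r u0)"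
    and q: "1 < q"
begin

text \<open>\<open>ennreal\<close> truncates negative reals to 0; a nonnegative constant allows
  products to be moved inside \<open>ennreal\<close> later.\<close>

lemma smoothing_nonneg:
  assumes "1 \<le> r" "r \<le> p"
  obtains C :: real where "0 \<le> C"
    "\<And>u0 u t. is_solution a q u0 u \<Longrightarrow> u0 \<in> Lp 1 \<Longrightarrow> u0 \<in> Lp r \<Longrightarrow> 0 < t \<Longrightarrow>
        Lp_norm p (u t) \<le> ennreal (C * t powr (- (real CARD('n) / 2) * (recip r - recip p))) * Lp_norm r u0"
proof -
  obtain C :: real where C: "\<And>u0 u t. is_solution a q u0 u \<Longrightarrow> u0 \<in> Lp 1 \<Longrightarrow> u0 \<in> Lp r \<Longrightarrow> 0 < t \<Longrightarrow>
        Lp_norm p (u t) \<le> ennreal (C * t powr (- (real CARD('n) / 2) * (recip r - recip p))) * Lp_norm r u0"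
    using smoothing[OF assms] by blast
  show ?thesis
  proof (rule that[of "max C 0"])
    fix u0 u t assume *: "is_solution a q u0 u" "u0 \<in> Lp 1" "u0 \<in> Lp r" "(0::real) < t"
    have "ennreal (C * t powr (- (real CARD('n) / 2) * (recip r - recip p))) \<le> ennreal (max C 0 * t powr (- (real CARD('n) / 2) * (recip r - recip p)))"
      by (intro ennreal_leI mult_right_mono) auto
    then show "Lp_norm p (u t) \<le> ennreal (max C 0 * t powr (- (real CARD('n) / 2) * (recip r - recip p))) * Lp_norm r u0"
      using C[OF *] by (meson mult_right_mono order_trans zero_le)
  qed simp
qed

lemma smoothing_1_infty:
  obtains C :: real where "0 \<le> C"
    "\<And>u0 u t. is_solution a q u0 u \<Longrightarrow> integrable lborel u0 \<Longrightarrow> 0 < t \<Longrightarrow>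
        AE x in lborel. \<bar>u t x\<bar> \<le> C * t powr (- (real CARD('n) / 2)) * L1_norm u0"
proof -
  obtain C where C: "0 \<le> C" "\<And>u0 u t. is_solution a q u0 u \<Longrightarrow> u0 \<in> Lp 1 \<Longrightarrow> u0 \<in> Lp 1 \<Longrightarrow> 0 < t \<Longrightarrow>
        Lp_norm \<infinity> (u t) \<le> ennreal (C * t powr (- (real CARD('n) / 2) * (recip 1 - recip \<infinity>))) * Lp_norm 1 u0"
    using smoothing_nonneg[of 1 \<infinity>] by auto
  show ?thesis
  proof (rule that[OF C(1)])
    fix u0 u t assume *: "is_solution a q u0 u" "integrable lborel u0" "(0::real) < t"
    have "Lp_norm \<infinity> (u t) \<le> ennreal (C * t powr (- (real CARD('n) / 2))) * ennreal (L1_norm u0)"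
      using C(2)[OF *(1) _ _ *(3)] *(2) by (simp add: Lp_1_iff_integrable Lp_norm_1 nn_integral_eq_integral)
    also have "\<dots> = ennreal (C * t powr (- (real CARD('n) / 2)) * L1_norm u0)"
      using C(1) by (simp add: ennreal_mult)
    finally show "AE x in lborel. \<bar>u t x\<bar> \<le> C * t powr (- (real CARD('n) / 2)) * L1_norm u0"
      using C(1) by (intro AE_abs_le_if_Lp_norm_top_le) (auto intro!: mult_nonneg_nonneg integral_nonneg_AE)
  qed
qed

lemma smoothing_1_1:
  obtains C :: real where "0 \<le> C"
    "\<And>u0 u t. is_solution a q u0 u \<Longrightarrow> integrable lborel u0 \<Longrightarrow> 0 < t \<Longrightarrow>
        L1_norm (u t) \<le> C * L1_norm u0"
proof -
  obtain C where C: "0 \<le> C" "\<And>u0 u t. is_solution a q u0 u \<Longrightarrow> u0 \<in> Lp 1 \<Longrightarrow> u0 \<in> Lp 1 \<Longrightarrow> 0 < t \<Longrightarrow>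
        Lp_norm 1 (u t) \<le> ennreal (C * t powr (- (real CARD('n) / 2) * (recip 1 - recip 1))) * Lp_norm 1 u0"
    using smoothing_nonneg[of 1 1] by auto
  show ?thesis
  proof (rule that[OF C(1)])
    fix u0 u t assume *: "is_solution a q u0 u" "integrable lborel u0" "(0::real) < t"
    have "Lp_norm 1 (u t) \<le> ennreal C * ennreal (L1_norm u0)"
      using C(2)[OF *(1) _ _ *(3)] *(2,3) by (simp add: Lp_1_iff_integrable Lp_norm_1 nn_integral_eq_integral)
    also have "Lp_norm 1 (u t) = ennreal (L1_norm (u t))"
      using solution_integrable[OF *(1), of t] *(3) by (simp add: Lp_norm_1 nn_integral_eq_integral)
    finally show "L1_norm (u t) \<le> C * L1_norm u0"
      using C(1) by (simp add: ennreal_mult[symmetric] ennreal_le_iff integral_nonneg_AE)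
  qed
qed

text \<open>\<open>M\<close> is an arbitrary real. The absolute value keeps the bound nonnegative,
  and for negative \<open>M\<close> it remains true since \<open>ennreal M\<close> is then
  0.\<close>

lemma smoothing_infty_infty:
  obtains C :: real where "0 \<le> C"
    "\<And>u0 u t M. is_solution a q u0 u \<Longrightarrow> u0 \<in> Lp 1 \<Longrightarrow> u0 \<in> Lp \<infinity> \<Longrightarrow> Lp_norm \<infinity> u0 \<le> ennreal M \<Longrightarrow> 0 < t \<Longrightarrow>
        AE x in lborel. \<bar>u t x\<bar> \<le> C * \<bar>M\<bar>"
proof -
  obtain C where C: "0 \<le> C" "\<And>u0 u t. is_solution a q u0 u \<Longrightarrow> u0 \<in> Lp 1 \<Longrightarrow> u0 \<in> Lp \<infinity> \<Longrightarrow> 0 < t \<Longrightarrow>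
        Lp_norm \<infinity> (u t) \<le> ennreal (C * t powr (- (real CARD('n) / 2) * (recip \<infinity> - recip \<infinity>))) * Lp_norm \<infinity> u0"
    using smoothing_nonneg[of \<infinity> \<infinity>] by auto
  show ?thesis
  proof (rule that[OF C(1)])
    fix u0 u t M assume *: "is_solution a q u0 u" "u0 \<in> Lp 1" "u0 \<in> Lp \<infinity>" "Lp_norm \<infinity> u0 \<le> ennreal M" "(0::real) < t"
    have "Lp_norm \<infinity> (u t) \<le> ennreal C * Lp_norm \<infinity> u0"
      using C(2)[OF *(1-3,5)] *(5) by simp
    also have "\<dots> \<le> ennreal C * ennreal \<bar>M\<bar>"
      using *(4) by (intro mult_left_mono order_trans[OF *(4)] ennreal_leI) auto
    also have "\<dots> = ennreal (C * \<bar>M\<bar>)" using C(1) by (simp add: ennreal_mult)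
    finally show "AE x in lborel. \<bar>u t x\<bar> \<le> C * \<bar>M\<bar>"
      using C(1) by (intro AE_abs_le_if_Lp_norm_top_le) auto
  qed
qed

text \<open>A bound on the source uniform down to time 0, where the supremum bound from L^1 data
  blows up. It comes from u_0 in L^q.\<close>

lemma smoothing_q_q:
  assumes sol: "is_solution a q u0 u" and u0: "u0 \<in> Lp 1" "u0 \<in> Lp (ennreal q)"
  obtains K :: real where "0 \<le> K" "\<And>t. 0 < t \<Longrightarrow> (LBINT x. \<bar>u t x\<bar> powr q) \<le> K"
proof -
  obtain C where C: "0 \<le> C" "\<And>u0 u t. is_solution a q u0 u \<Longrightarrow> u0 \<in> Lp 1 \<Longrightarrow> u0 \<in> Lp (ennreal q) \<Longrightarrow> 0 < t \<Longrightarrow>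
        Lp_norm (ennreal q) (u t) \<le> ennreal (C * t powr (- (real CARD('n) / 2) * (recip (ennreal q) - recip (ennreal q)))) * Lp_norm (ennreal q) u0"
    using smoothing_nonneg[of "ennreal q" "ennreal q"] q by auto
  define L where "L = enn2real (Lp_norm (ennreal q) u0)"
  have L: "Lp_norm (ennreal q) u0 = ennreal L"
    using u0 by (auto simp: L_def Lp_def less_top)
  have L0: "0 \<le> L" by (simp add: L_def)
  show ?thesis
  proof (rule that[of "(C * L) powr q"])
    fix t :: real assume t: "0 < t"
    have le: "Lp_norm (ennreal q) (u t) \<le> ennreal (C * L)"
      using C(2)[OF sol u0 t] t C(1) L0 by (simp add: L ennreal_mult)
    let ?I = "\<integral>\<^sup>+x. ennreal (\<bar>u t x\<bar> powr q) \<partial>lborel"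
    have fin: "?I < \<infinity>"
      using q le by (intro Lp_norm_finite_imp_nn_integral) (auto simp: le_less_trans)
    have "u t \<in> borel_measurable borel"
      using borel_measurable_integrable[OF solution_integrable[OF sol, of t]] t by simp
    then have int: "integrable lborel (\<lambda>x. \<bar>u t x\<bar> powr q)"
      using fin by (subst integrable_iff_bounded) auto
    let ?J = "LBINT x. \<bar>u t x\<bar> powr q"
    have J: "?I = ennreal ?J" "0 \<le> ?J"
      using int by (auto simp: nn_integral_eq_integral intro!: integral_nonneg_AE)
    have "ennreal (?J powr (1 / q)) \<le> ennreal (C * L)"
      using le q J by (simp add: Lp_norm_def Let_def)
    then have "?J powr (1 / q) \<le> C * L"
      using C(1) L0 by (subst (asm) ennreal_le_iff) auto
    then have "(?J powr (1 / q)) powr q \<le> (C * L) powr q"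
      using q by (intro powr_mono2) auto
    then show "?J \<le> (C * L) powr q"
      using q J by (simp add: powr_powr)
  qed simp
qed

text \<open>Away from \<open>t = 0\<close> the solution is locally uniformly bounded, so that \<open>L\<^sup>1\<close> continuity of \<open>u\<close>
  passes to \<open>|u|\<^sup>q\<close>.\<close>

lemma
  fixes u0 :: "real^'n \<Rightarrow> real"
  assumes sol: "is_solution a q u0 u" and u0: "integrable lborel u0"
  shows solution_powr_integrable: "\<And>t. 0 < t \<Longrightarrow> integrable lborel (\<lambda>x. \<bar>u t x\<bar> powr q)"
    and solution_powr_continuous: "\<And>t. 0 < t \<Longrightarrow>
      ((\<lambda>s. LBINT x. \<bar>\<bar>u s x\<bar> powr q - \<bar>u t x\<bar> powr q\<bar>) \<longlongrightarrow> 0) (at t within {0<..})"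
proof -
  obtain C where C: "0 \<le> C" "\<And>t. 0 < t \<Longrightarrow>
        AE x in lborel. \<bar>u t x\<bar> \<le> C * t powr (- (real CARD('n) / 2)) * L1_norm u0"
    using smoothing_1_infty sol u0 by metis
  show int: "integrable lborel (\<lambda>x. \<bar>u t x\<bar> powr q)" if "0 < t" for t
    using q that by (intro integrable_powr_if_bounded[OF solution_integrable[OF sol] C(2)]) auto
  fix t :: real assume t: "0 < t"
  \<comment> \<open>Valid at all times from t/2 on, hence near \<open>t\<close>, since the smoothing
    bound decreases in time.\<close>
  define B where "B = C * (t / 2) powr (- (real CARD('n) / 2)) * L1_norm u0"
  have B: "AE x in lborel. \<bar>u s x\<bar> \<le> B" if "t / 2 \<le> s" for s
  proof -
    have "s powr (- (real CARD('n) / 2)) \<le> (t / 2) powr (- (real CARD('n) / 2))"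
      using t that by (intro powr_mono2') auto
    then have "C * s powr (- (real CARD('n) / 2)) * L1_norm u0 \<le> B"
      unfolding B_def using C(1) by (intro mult_right_mono mult_left_mono integral_nonneg_AE) auto
    then show ?thesis using C(2)[of s] t that by (auto elim!: eventually_mono)
  qed
  have "((\<lambda>s. LBINT x. \<bar>u s x - u t x\<bar>) \<longlongrightarrow> 0) (at t within {0<..})"
    using solution_L1_continuous[OF sol, of t] t by (auto intro: tendsto_within_subset)
  then have lim: "((\<lambda>s. q * B powr (q - 1) * (LBINT x. \<bar>u s x - u t x\<bar>)) \<longlongrightarrow> 0) (at t within {0<..})"
    by (rule tendsto_mult_right_zero)
  show "((\<lambda>s. LBINT x. \<bar>\<bar>u s x\<bar> powr q - \<bar>u t x\<bar> powr q\<bar>) \<longlongrightarrow> 0) (at t within {0<..})"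
  proof (rule Lim_null_comparison[OF _ lim])
    have "eventually (\<lambda>s. t / 2 < s) (at t within {0<..})"
      using t by (intro order_tendstoD(1)[OF tendsto_ident_at]) auto
    then show "eventually (\<lambda>s. norm (LBINT x. \<bar>\<bar>u s x\<bar> powr q - \<bar>u t x\<bar> powr q\<bar>)
        \<le> q * B powr (q - 1) * (LBINT x. \<bar>u s x - u t x\<bar>)) (at t within {0<..})"
    proof eventually_elim
      case (elim s)
      have intd: "integrable lborel (\<lambda>x. u s x - u t x)"
        using solution_integrable[OF sol] elim t by (intro Bochner_Integration.integrable_diff) auto
      have "AE x in lborel. \<bar>\<bar>u s x\<bar> powr q - \<bar>u t x\<bar> powr q\<bar> \<le> q * B powr (q - 1) * \<bar>u s x - u t x\<bar>"
        using B[of s] B[of t] elim t q by (auto elim!: eventually_elim2 intro!: abs_powr_diff_le)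
      then have "(LBINT x. \<bar>\<bar>u s x\<bar> powr q - \<bar>u t x\<bar> powr q\<bar>) \<le> (LBINT x. q * B powr (q - 1) * \<bar>u s x - u t x\<bar>)"
        using int[of s] int[of t] elim t intd by (intro integral_mono_AE) auto
      then show ?case by (simp add: integral_nonneg_AE)
    qed
  qed
qed

end

section \<open>Absorption lemmas\<close>

text \<open>To be read with \<open>h\<close> the mass of u and \<open>\<phi>\<close> the mass of
  |u|^q. Up to a time R the source is at most \<open>P0\<close>; after R the factor c D R^(-delta)
  <= 1/2 multiplies the supremum \<open>g\<close> of the rescaled mass. Hence g <= X + g/2, and g <=
  2X whatever the interval.\<close>

lemma absorb_linear:
  fixes h \<phi> :: "real \<Rightarrow> real" and \<beta> \<delta> c \<eta>0 P0 D H :: real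
  assumes \<beta>: "0 < \<beta>" and \<delta>: "0 < \<delta>" and c: "0 \<le> c" and \<eta>0: "0 \<le> \<eta>0" and P0: "0 \<le> P0" and D: "0 \<le> D"
    and h0: "\<And>t. 0 < t \<Longrightarrow> 0 \<le> h t" and hH: "\<And>t. 0 < t \<Longrightarrow> h t \<le> H"
    and \<phi>P: "\<And>\<tau>. 0 < \<tau> \<Longrightarrow> \<phi> \<tau> \<le> P0"
    and \<phi>D: "\<And>\<tau>. 0 < \<tau> \<Longrightarrow> \<phi> \<tau> \<le> D * \<tau> powr (- (1 / 2) - \<delta>) * h \<tau>"
    and step: "\<And>t K. 0 < t \<Longrightarrow> 0 \<le> K \<Longrightarrow> (\<And>\<tau>. 0 < \<tau> \<Longrightarrow> \<tau> < t \<Longrightarrow> \<phi> \<tau> \<le> K * \<tau> powr (- (1 / 2 + \<beta> / 2)))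
      \<Longrightarrow> h t \<le> (\<eta>0 + c * K) * t powr (- (\<beta> / 2))"
  shows "\<exists>G\<ge>0. \<forall>t>0. h t \<le> G * t powr (- (\<beta> / 2))"
proof -
  let ?b = "1 / 2 + \<beta> / 2"
  obtain R where R: "1 \<le> R" "c * D * R powr (- \<delta>) \<le> 1 / 2"
  proof -
    have "((\<lambda>R. c * D * R powr (- \<delta>)) \<longlongrightarrow> c * D * 0) at_top"
      using \<delta> by (intro tendsto_intros tendsto_neg_powr filterlim_ident) auto
    then have "eventually (\<lambda>R. c * D * R powr (- \<delta>) < 1 / 2) at_top"
      by (intro order_tendstoD) auto
    then have "eventually (\<lambda>R. 1 \<le> R \<and> c * D * R powr (- \<delta>) \<le> 1 / 2) at_top"
      using eventually_ge_at_top[of 1] by eventually_elim auto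
    then show ?thesis using that by (auto simp: eventually_at_top_linorder)
  qed
  define X where "X = \<eta>0 + c * (P0 * R powr ?b)"
  have X: "0 \<le> X" using \<eta>0 c P0 by (simp add: X_def)
  have "h T \<le> 2 * X * T powr (- (\<beta> / 2))" if T: "0 < T" for T
  proof -
    let ?\<psi> = "\<lambda>s. s powr (\<beta> / 2) * h s"
    have H: "0 \<le> H" using h0[of 1] hH[of 1] by simp
    \<comment> \<open>The supremum is over a bounded interval, where \<open>H\<close> makes it
      finite; only a finite \<open>g\<close> can be absorbed.\<close>
    define g where "g = (SUP s\<in>{0<..T}. ?\<psi> s)"
    have "bdd_above (?\<psi> ` {0<..T})"
    proof (rule bdd_aboveI2)
      fix s assume s: "s \<in> {0<..T}"
      then have "s powr (\<beta> / 2) \<le> T powr (\<beta> / 2)"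
        using \<beta> by (intro powr_mono2) auto
      then show "?\<psi> s \<le> T powr (\<beta> / 2) * H"
        using hH[of s] h0[of s] s by (intro mult_mono) auto
    qed
    then have g_ge: "?\<psi> s \<le> g" if "s \<in> {0<..T}" for s
      unfolding g_def using that by (intro cSUP_upper) auto
    have g0: "0 \<le> g"
      using g_ge[of T] h0[of T] T by (auto intro: order_trans[of _ "?\<psi> T"])
    have h_le: "h s \<le> g * s powr (- (\<beta> / 2))" if "s \<in> {0<..T}" for s
      using g_ge[OF that] that by (simp add: powr_minus field_simps)
    have "?\<psi> t \<le> X + g / 2" if t: "t \<in> {0<..T}" for t
    proof -
      \<comment> \<open>The first summand serves the times up to R, the second the later
        ones.\<close>
      define K where "K = P0 * R powr ?b + D * R powr (- \<delta>) * g"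
      have K: "0 \<le> K" using P0 D g0 by (simp add: K_def)
      have "h t \<le> (\<eta>0 + c * K) * t powr (- (\<beta> / 2))"
      proof (rule step[OF _ K])
        fix \<tau> assume \<tau>: "0 < \<tau>" "\<tau> < t"
        show "\<phi> \<tau> \<le> K * \<tau> powr (- ?b)"
        proof (cases "\<tau> \<le> R")
          case True
          have "1 = \<tau> powr ?b * \<tau> powr (- ?b)" using \<tau> by (simp flip: powr_add)
          also have "\<dots> \<le> R powr ?b * \<tau> powr (- ?b)"
            using \<tau> True \<beta> by (intro mult_right_mono powr_mono2) auto
          finally have "P0 * 1 \<le> P0 * (R powr ?b * \<tau> powr (- ?b))" using P0 by (intro mult_left_mono)
          also have "\<dots> \<le> K * \<tau> powr (- ?b)"
            unfolding K_def mult.assoc[symmetric] using D g0 by (intro mult_right_mono) auto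
          finally show ?thesis using \<phi>P[OF \<tau>(1)] by simp
        next
          case False
          have "\<phi> \<tau> \<le> D * \<tau> powr (- (1 / 2) - \<delta>) * (g * \<tau> powr (- (\<beta> / 2)))"
            using \<tau> t D by (intro order_trans[OF \<phi>D] mult_left_mono h_le) auto
          also have "\<dots> = D * \<tau> powr (- \<delta>) * g * \<tau> powr (- ?b)"
          proof -
            have eq: "\<tau> powr (- (1 / 2) - \<delta>) * \<tau> powr (- (\<beta> / 2)) = \<tau> powr (- \<delta>) * \<tau> powr (- ?b)"
              unfolding powr_add[symmetric] by (intro arg_cong2[where f="(powr)"] refl) simp
            have "D * \<tau> powr (- (1 / 2) - \<delta>) * (g * \<tau> powr (- (\<beta> / 2))) = D * g * (\<tau> powr (- (1 / 2) - \<delta>) * \<tau> powr (- (\<beta> / 2)))"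
              by (simp only: mult_ac)
            then show ?thesis unfolding eq by (simp only: mult_ac)
          qed
          also have "\<dots> \<le> D * R powr (- \<delta>) * g * \<tau> powr (- ?b)"
            using False R D g0 \<delta> by (intro mult_right_mono mult_left_mono powr_mono2') auto
          also have "\<dots> \<le> K * \<tau> powr (- ?b)"
            unfolding K_def using P0 by (intro mult_right_mono) auto
          finally show ?thesis .
        qed
      qed (use t in auto)
      then have "?\<psi> t \<le> t powr (\<beta> / 2) * ((\<eta>0 + c * K) * t powr (- (\<beta> / 2)))"
        by (intro mult_left_mono) auto
      also have "\<dots> = X + (c * D * R powr (- \<delta>)) * g"
        using t by (simp add: powr_minus X_def K_def field_simps)
      also have "\<dots> \<le> X + 1 / 2 * g"
        using R g0 by (intro add_left_mono mult_right_mono) auto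
      finally show ?thesis by simp
    qed
    then have "g \<le> X + g / 2"
      unfolding g_def using T by (intro cSUP_least) auto
    then have "?\<psi> T \<le> 2 * X" using g_ge[of T] T by simp
    then show ?thesis using T by (simp add: powr_minus field_simps)
  qed
  then show ?thesis using X by (intro exI[of _ "2 * X"]) auto
qed

text \<open>By the intermediate value theorem any point at or above the level is preceded by, or is,
  a time where the level is attained; these times form a compact set in [0,t0], whose minimum is
  \<open>t1\<close>.\<close>

lemma first_hitting:
  fixes \<psi> :: "real \<Rightarrow> real"
  assumes cont: "continuous_on {0..} \<psi>" and "\<psi> 0 < l" and t0: "0 < t0" "l < \<psi> t0"
  obtains t1 where "0 < t1" "\<psi> t1 = l" "\<And>s. 0 \<le> s \<Longrightarrow> s < t1 \<Longrightarrow> \<psi> s < l"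
proof -
  let ?S = "{s \<in> {0..t0}. \<psi> s = l}"
  have cont': "continuous_on {0..t} \<psi>" for t
    using cont by (rule continuous_on_subset) auto
  have hit: "\<exists>s. 0 \<le> s \<and> s \<le> t \<and> \<psi> s = l" if "0 \<le> t" "l \<le> \<psi> t" for t
    using IVT'[OF _ that(2) that(1) cont'] assms(2) by auto
  have "closed ?S"
    using cont' by (intro continuous_closed_preimage_constant) auto
  then have "compact ({0..t0} \<inter> ?S)" by (intro compact_Int_closed) auto
  also have "{0..t0} \<inter> ?S = ?S" by auto
  finally have "compact ?S" .
  moreover have "?S \<noteq> {}" using hit[of t0] t0 by auto
  ultimately obtain t1 where t1: "t1 \<in> ?S" "\<And>s. s \<in> ?S \<Longrightarrow> t1 \<le> s"
    using compact_attains_inf[of ?S] by blast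
  show ?thesis
  proof (rule that[of t1])
    show "0 < t1" using t1 assms(2) by (cases "t1 = 0") auto
    show "\<psi> t1 = l" using t1 by simp
    fix s assume s: "0 \<le> s" "s < t1"
    show "\<psi> s < l"
    proof (rule ccontr)
      assume "\<not> \<psi> s < l"
      then obtain s' where "0 \<le> s'" "s' \<le> s" "\<psi> s' = l" using hit[of s] s by auto
      then show False using t1(2)[of s'] t1(1) s by auto
    qed
  qed
qed

text \<open>\<open>\<eta>\<close> depends on the constants alone and is fixed before
  \<open>h\<close> and \<open>\<phi>\<close>. At the first time the rescaled mass reaches 4 eta, the
  linear term, the early source and the late source contribute at most eta each, so its value is at
  most 3 eta, a contradiction.\<close>

lemma absorb_superlinear:
  fixes \<beta> \<delta> c E D q :: real
  assumes \<beta>: "0 < \<beta>" and \<delta>: "0 < \<delta>" and c: "0 \<le> c" and E: "0 \<le> E" and D: "0 \<le> D" and q: "1 < q"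
  shows "\<exists>\<eta>>0. \<forall>h \<phi> :: real \<Rightarrow> real.
    continuous_on {0..} h \<longrightarrow> (\<forall>t>0. 0 \<le> h t) \<longrightarrow> (\<forall>\<tau>>0. \<phi> \<tau> \<le> E * h \<tau>) \<longrightarrow>
    (\<forall>\<tau> G. 0 < \<tau> \<longrightarrow> 0 < G \<longrightarrow> (\<forall>s. 0 < s \<longrightarrow> s \<le> \<tau> \<longrightarrow> h s \<le> G * s powr (- (\<beta> / 2))) \<longrightarrow>
      \<phi> \<tau> \<le> D * G powr q * \<tau> powr (- (1 / 2 + \<beta> / 2) - \<delta>)) \<longrightarrow>
    (\<forall>t K. 0 < t \<longrightarrow> 0 \<le> K \<longrightarrow> (\<forall>\<tau>. 0 < \<tau> \<longrightarrow> \<tau> < t \<longrightarrow> \<phi> \<tau> \<le> K * \<tau> powr (- (1 / 2 + \<beta> / 2)))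
      \<longrightarrow> h t \<le> (\<eta> + c * K) * t powr (- (\<beta> / 2))) \<longrightarrow>
    (\<forall>t>0. h t \<le> 4 * \<eta> * t powr (- (\<beta> / 2)))"
proof -
  let ?b = "1 / 2 + \<beta> / 2"
  \<comment> \<open>Chosen so that c E eps^(1/2) <= 1/4; the summand 1 keeps the quotient meaningful
    when c E = 0.\<close>
  define \<epsilon> where "\<epsilon> = (1 / (4 * (c * E) + 1)) powr 2"
  have cE: "0 < 4 * (c * E) + 1" using c E by (simp add: add_nonneg_pos)
  have \<epsilon>: "0 < \<epsilon>" using cE by (simp add: \<epsilon>_def)
  have "\<epsilon> powr (1 / 2) = 1 / (4 * (c * E) + 1)"
    unfolding \<epsilon>_def using cE by (subst powr_powr) auto
  then have "c * E * \<epsilon> powr (1 / 2) = c * E / (4 * (c * E) + 1)" by simp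
  also have "\<dots> \<le> 1 / 4" using cE by (simp add: divide_le_eq)
  finally have cE_le: "c * E * \<epsilon> powr (1 / 2) \<le> 1 / 4" .
  define Y where "Y = c * D * \<epsilon> powr (- \<delta>) * 4 powr q"
  have Y: "0 \<le> Y" using c D by (simp add: Y_def)
  \<comment> \<open>Solves (1 + Y) eta^(q-1) = 1, so that the late contribution Y eta^q at the level
    4 eta is at most eta.\<close>
  define \<eta> where "\<eta> = (1 / (1 + Y)) powr (1 / (q - 1))"
  have \<eta>: "0 < \<eta>" using Y by (simp add: \<eta>_def)
  have "\<eta> powr (q - 1) = 1 / (1 + Y)"
    unfolding \<eta>_def using Y q by (subst powr_powr) auto
  then have "Y * \<eta> powr (q - 1) = Y / (1 + Y)" by simp
  also have "\<dots> \<le> 1" using Y by (simp add: divide_le_eq)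
  finally have "Y * \<eta> powr (q - 1) \<le> 1" .
  then have "\<eta> * (Y * \<eta> powr (q - 1)) \<le> \<eta> * 1" using \<eta> by (intro mult_left_mono) auto
  moreover have "\<eta> * \<eta> powr (q - 1) = \<eta> powr q"
    using \<eta> powr_add[of \<eta> 1 "q - 1"] by simp
  ultimately have Y\<eta>: "Y * \<eta> powr q \<le> \<eta>" by (simp add: mult.left_commute)
  show ?thesis
  proof (intro exI[of _ \<eta>] conjI \<eta> allI impI)
    fix h \<phi> :: "real \<Rightarrow> real" and t :: real
    assume cont: "continuous_on {0..} h" and h0: "\<forall>t>0. 0 \<le> h t" and \<phi>E: "\<forall>\<tau>>0. \<phi> \<tau> \<le> E * h \<tau>"
      and \<phi>D: "\<forall>\<tau> G. 0 < \<tau> \<longrightarrow> 0 < G \<longrightarrow> (\<forall>s. 0 < s \<longrightarrow> s \<le> \<tau> \<longrightarrow> h s \<le> G * s powr (- (\<beta> / 2))) \<longrightarrow>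
        \<phi> \<tau> \<le> D * G powr q * \<tau> powr (- ?b - \<delta>)"
      and step: "\<forall>t K. 0 < t \<longrightarrow> 0 \<le> K \<longrightarrow> (\<forall>\<tau>. 0 < \<tau> \<longrightarrow> \<tau> < t \<longrightarrow> \<phi> \<tau> \<le> K * \<tau> powr (- ?b))
        \<longrightarrow> h t \<le> (\<eta> + c * K) * t powr (- (\<beta> / 2))"
      and t: "0 < t"
    let ?\<psi> = "\<lambda>s. s powr (\<beta> / 2) * h s"
    have "?\<psi> t \<le> 4 * \<eta>"
    proof (rule ccontr)
      assume "\<not> ?\<psi> t \<le> 4 * \<eta>"
      moreover have "continuous_on {0..} ?\<psi>"
        using \<beta> by (intro continuous_on_mult cont continuous_on_powr') (auto intro!: continuous_intros)
      ultimately obtain t1 where t1: "0 < t1" "?\<psi> t1 = 4 * \<eta>" "\<And>s. 0 \<le> s \<Longrightarrow> s < t1 \<Longrightarrow> ?\<psi> s < 4 * \<eta>"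
        using first_hitting[of ?\<psi> "4 * \<eta>" t] \<eta> t by (auto simp: not_le)
      have h_le: "h s \<le> 4 * \<eta> * s powr (- (\<beta> / 2))" if "0 < s" "s < t1" for s
        using t1(3)[of s] that by (simp add: powr_minus field_simps)
      define K where "K = E * (4 * \<eta>) * \<epsilon> powr (1 / 2) + D * (4 * \<eta>) powr q * \<epsilon> powr (- \<delta>)"
      have K: "0 \<le> K" using E D \<eta> by (simp add: K_def)
      have "\<phi> \<tau> \<le> K * \<tau> powr (- ?b)" if \<tau>: "0 < \<tau>" "\<tau> < t1" for \<tau>
      proof (cases "\<tau> \<le> \<epsilon>")
        case True
        have "\<phi> \<tau> \<le> E * (4 * \<eta> * \<tau> powr (- (\<beta> / 2)))"
          using \<phi>E \<tau> h_le[OF \<tau>] E by (meson mult_left_mono order_trans)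
        also have "\<tau> powr (- (\<beta> / 2)) = \<tau> powr (1 / 2) * \<tau> powr (- ?b)"
          by (simp flip: powr_add)
        also have "E * (4 * \<eta> * (\<tau> powr (1 / 2) * \<tau> powr (- ?b))) \<le> E * (4 * \<eta> * (\<epsilon> powr (1 / 2) * \<tau> powr (- ?b)))"
          using True \<tau> E \<eta> by (intro mult_left_mono mult_right_mono powr_mono2) auto
        also have "\<dots> \<le> K * \<tau> powr (- ?b)"
          unfolding K_def mult.assoc[symmetric] using D by (intro mult_right_mono) auto
        finally show ?thesis .
      next
        case False
        have "\<phi> \<tau> \<le> D * (4 * \<eta>) powr q * \<tau> powr (- ?b - \<delta>)"
          using \<phi>D[rule_format, of \<tau> "4 * \<eta>"] \<eta> \<tau> h_le by auto
        also have "\<tau> powr (- ?b - \<delta>) = \<tau> powr (- \<delta>) * \<tau> powr (- ?b)"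
          by (simp flip: powr_add)
        also have "D * (4 * \<eta>) powr q * (\<tau> powr (- \<delta>) * \<tau> powr (- ?b)) \<le> D * (4 * \<eta>) powr q * (\<epsilon> powr (- \<delta>) * \<tau> powr (- ?b))"
          using False \<tau> D \<delta> \<epsilon> by (intro mult_left_mono mult_right_mono powr_mono2') auto
        also have "\<dots> \<le> K * \<tau> powr (- ?b)"
          unfolding K_def mult.assoc[symmetric] using E \<eta> by (intro mult_right_mono) auto
        finally show ?thesis .
      qed
      then have "h t1 \<le> (\<eta> + c * K) * t1 powr (- (\<beta> / 2))"
        using step t1(1) K by blast
      then have "?\<psi> t1 \<le> t1 powr (\<beta> / 2) * ((\<eta> + c * K) * t1 powr (- (\<beta> / 2)))"
        by (intro mult_left_mono) auto
      also have "\<dots> = \<eta> + c * K"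
        using t1(1) by (simp add: powr_minus field_simps)
      also have "c * K = (c * E * \<epsilon> powr (1 / 2)) * (4 * \<eta>) + Y * \<eta> powr q"
        using \<eta> by (simp add: K_def Y_def powr_mult algebra_simps)
      also have "\<dots> \<le> 1 / 4 * (4 * \<eta>) + \<eta>"
        using cE_le Y\<eta> \<eta> by (intro add_mono mult_right_mono) auto
      finally show False using t1(2) \<eta> by simp
    qed
    then show "h t \<le> 4 * \<eta> * t powr (- (\<beta> / 2))"
      using t by (simp add: powr_minus field_simps)
  qed
qed

section \<open>Decay of the solution\<close>

lemma ennreal_tendsto_0I:
  fixes f :: "'a \<Rightarrow> ennreal"
  assumes "\<And>\<epsilon>::real. 0 < \<epsilon> \<Longrightarrow> eventually (\<lambda>t. f t \<le> ennreal \<epsilon>) F"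
  shows "(f \<longlongrightarrow> 0) F"
proof (rule order_tendstoI)
  fix x :: ennreal assume "0 < x"
  then obtain y where y: "0 < y" "y < x" using dense by blast
  then obtain \<epsilon> :: real where "y = ennreal \<epsilon>" "0 < \<epsilon>"
    by (cases y) (auto simp: top_unique less_top[symmetric])
  then show "eventually (\<lambda>t. f t < x) F"
    using assms[of \<epsilon>] y by (auto elim!: eventually_mono intro: le_less_trans)
qed simp

text \<open>Elementary interpolation against the supremum: p - r of the p factors are bounded by
  \<open>Y\<close>, the other r are integrated.\<close>

lemma Lp_norm_interpolation:
  fixes f :: "real^'n \<Rightarrow> real"
  assumes r: "0 < r" "r \<le> p" and X: "0 \<le> X" and Y: "0 < Y"
    and int: "(\<integral>\<^sup>+x. ennreal (\<bar>f x\<bar> powr r) \<partial>lborel) \<le> ennreal X"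
    and sup: "AE x in lborel. \<bar>f x\<bar> \<le> Y" and [measurable]: "f \<in> borel_measurable borel"
  shows "Lp_norm (ennreal p) f \<le> ennreal ((X * Y powr (p - r)) powr (1 / p))"
proof -
  let ?I = "\<integral>\<^sup>+x. ennreal (\<bar>f x\<bar> powr p) \<partial>lborel"
  have "?I \<le> (\<integral>\<^sup>+x. ennreal (Y powr (p - r)) * ennreal (\<bar>f x\<bar> powr r) \<partial>lborel)"
  proof (rule nn_integral_mono_AE)
    show "AE x in lborel. ennreal (\<bar>f x\<bar> powr p) \<le> ennreal (Y powr (p - r)) * ennreal (\<bar>f x\<bar> powr r)"
      using sup
    proof eventually_elim
      case (elim x)
      have "\<bar>f x\<bar> powr p = \<bar>f x\<bar> powr (p - r) * \<bar>f x\<bar> powr r"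
        by (simp flip: powr_add)
      also have "\<dots> \<le> Y powr (p - r) * \<bar>f x\<bar> powr r"
        using elim r by (intro mult_right_mono powr_mono2) auto
      finally show ?case by (simp add: ennreal_mult[symmetric] ennreal_leI)
    qed
  qed
  also have "\<dots> = ennreal (Y powr (p - r)) * (\<integral>\<^sup>+x. ennreal (\<bar>f x\<bar> powr r) \<partial>lborel)"
    by (rule nn_integral_cmult) measurable
  also have "\<dots> \<le> ennreal (Y powr (p - r)) * ennreal X"
    using int by (intro mult_left_mono) auto
  also have "\<dots> = ennreal (X * Y powr (p - r))"
    using X by (simp add: ennreal_mult[symmetric] mult.commute)
  finally have le: "?I \<le> ennreal (X * Y powr (p - r))" .
  then have fin: "?I \<noteq> \<infinity>" by (metis ennreal_neq_top infinity_ennreal_def neq_top_trans)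
  have "enn2real ?I \<le> X * Y powr (p - r)"
    using le X by (intro enn2real_leI) auto
  then have "enn2real ?I powr (1 / p) \<le> (X * Y powr (p - r)) powr (1 / p)"
    using r by (intro powr_mono2) auto
  then show ?thesis
    using fin r by (simp add: Lp_norm_def Let_def ennreal_leI)
qed

lemma powr_mult_cancel:
  fixes t c e :: real
  shows "0 < t \<Longrightarrow> t powr e * (c * t powr (- e)) = c"
  by (simp add: powr_minus)

text \<open>Used with r = 1 and r = 2. The exponent in \<open>int\<close> is r times the L^r rate,
  because the integral is the r-th power of the norm.\<close>

lemma asymptotic_Lp_if_bounds:
  fixes u :: "real \<Rightarrow> real^'n \<Rightarrow> real" and A \<beta> r :: real
  defines "d \<equiv> \<lambda>t x. u t x - A * frac_deriv \<beta> (heat_kernel t) x"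
  assumes r: "1 \<le> r"
    and meas: "\<And>t. 0 < t \<Longrightarrow> d t \<in> borel_measurable borel"
    and int: "\<And>\<epsilon>. 0 < \<epsilon> \<Longrightarrow> eventually (\<lambda>t. (\<integral>\<^sup>+x. ennreal (\<bar>d t x\<bar> powr r) \<partial>lborel)
        \<le> ennreal (\<epsilon> * t powr (- (real CARD('n) / 2 * (r - 1) + r * \<beta> / 2)))) at_top"
    and sup: "\<And>\<epsilon>. 0 < \<epsilon> \<Longrightarrow> eventually (\<lambda>t. AE x in lborel. \<bar>d t x\<bar>
        \<le> \<epsilon> * t powr (- (real CARD('n) / 2 + \<beta> / 2))) at_top"
    and p: "ennreal r \<le> p"
  shows "asymptotic_Lp \<beta> A u p"
proof -
  have d_eq: "(\<lambda>x. u t x - A * frac_deriv \<beta> (heat_kernel t) x) = d t" for t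
    by (simp add: d_def)
  show ?thesis
    unfolding asymptotic_Lp_def d_eq
  proof (rule ennreal_tendsto_0I)
    fix \<epsilon> :: real assume \<epsilon>: "0 < \<epsilon>"
    let ?e = "real CARD('n) / 2 + \<beta> / 2"
    show "eventually (\<lambda>t. ennreal (t powr (real CARD('n) / 2 * (1 - recip p) + \<beta> / 2)) * Lp_norm p (d t) \<le> ennreal \<epsilon>) at_top"
    proof (cases p)
      case top
      show ?thesis
        using sup[OF \<epsilon>] eventually_gt_at_top[of 0]
      proof eventually_elim
        case (elim t)
        have "AE x in lborel. ennreal \<bar>d t x\<bar> \<le> ennreal (\<epsilon> * t powr (- ?e))"
          using elim(1) by eventually_elim (rule ennreal_leI)
        then have "Lp_norm p (d t) \<le> ennreal (\<epsilon> * t powr (- ?e))"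
          unfolding Lp_norm_def using meas[OF elim(2)] top by (simp add: esssup_I)
        then have "ennreal (t powr ?e) * Lp_norm p (d t) \<le> ennreal (t powr ?e) * ennreal (\<epsilon> * t powr (- ?e))"
          by (rule mult_left_mono) simp
        also have "\<dots> = ennreal \<epsilon>"
          using powr_mult_cancel[OF elim(2), of ?e \<epsilon>] \<epsilon> by (subst ennreal_mult[symmetric]) (auto simp only: powr_ge_zero mult_nonneg_nonneg less_imp_le)
        finally show ?case by (simp add: top)
      qed
    next
      case (real P)
      then have P: "r \<le> P" "0 < P" using p r by auto
      \<comment> \<open>Both bounds carry this constant, so the interpolated P-th power contains it
        to the power P - r + 1, which has to equal eps^P.\<close>
      define \<epsilon>' where "\<epsilon>' = \<epsilon> powr (P / (P - r + 1))"
      have \<epsilon>': "0 < \<epsilon>'" using \<epsilon> by (simp add: \<epsilon>'_def)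
      have recip: "recip p = 1 / P"
      proof -
        have "1 / ennreal P = ennreal (1 / P)"
          using P divide_ennreal[of 1 P] by simp
        then show ?thesis unfolding recip_def real using P by simp
      qed
      let ?er = "real CARD('n) / 2 * (r - 1) + r * \<beta> / 2"
      let ?ep = "real CARD('n) / 2 * (1 - 1 / P) + \<beta> / 2"
      show ?thesis
        using int[OF \<epsilon>'] sup[OF \<epsilon>'] eventually_gt_at_top[of 0]
      proof eventually_elim
        case (elim t)
        have "Lp_norm p (d t) \<le> ennreal ((\<epsilon>' * t powr (- ?er) * (\<epsilon>' * t powr (- ?e)) powr (P - r)) powr (1 / P))"
          unfolding real using P r elim \<epsilon>' by (intro Lp_norm_interpolation meas) auto
        also have "(\<epsilon>' * t powr (- ?er) * (\<epsilon>' * t powr (- ?e)) powr (P - r)) powr (1 / P) = \<epsilon> * t powr (- ?ep)"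
        proof -
          have "\<epsilon>' * \<epsilon>' powr (P - r) = \<epsilon>' powr (P - r + 1)"
            using \<epsilon>' by (simp add: powr_add)
          also have "\<dots> = \<epsilon> powr P"
            unfolding \<epsilon>'_def using P by (subst powr_powr) auto
          finally have 1: "\<epsilon>' * \<epsilon>' powr (P - r) = \<epsilon> powr P" .
          have "t powr (- ?er) * (t powr (- ?e)) powr (P - r) = t powr (- ?er + - ?e * (P - r))"
            by (simp only: powr_powr powr_add)
          also have "- ?er + - ?e * (P - r) = - ?ep * P"
            using P by (simp add: field_simps)
          finally have 2: "t powr (- ?er) * (t powr (- ?e)) powr (P - r) = (t powr (- ?ep)) powr P"
            by (simp only: powr_powr)
          have "\<epsilon>' * t powr (- ?er) * (\<epsilon>' * t powr (- ?e)) powr (P - r) = (\<epsilon>' * \<epsilon>' powr (P - r)) * (t powr (- ?er) * (t powr (- ?e)) powr (P - r))"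
            using \<epsilon>' by (simp add: powr_mult mult_ac)
          also have "\<dots> = (\<epsilon> * t powr (- ?ep)) powr P"
            unfolding 1 2 using \<epsilon> by (simp add: powr_mult)
          finally show ?thesis
            using P \<epsilon> by (simp add: powr_powr)
        qed
        finally have "ennreal (t powr ?ep) * Lp_norm p (d t) \<le> ennreal (t powr ?ep) * ennreal (\<epsilon> * t powr (- ?ep))"
          by (rule mult_left_mono) simp
        also have "\<dots> = ennreal \<epsilon>"
          using powr_mult_cancel[OF elim(3), of ?ep \<epsilon>] \<epsilon> by (subst ennreal_mult[symmetric]) (auto simp only: powr_ge_zero mult_nonneg_nonneg less_imp_le)
        finally show ?case by (simp add: recip)
      qed
    qed
  qed
qed

text \<open>Applied to I_beta u_0, this identifies the limit of the quotient at the origin with the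
  integral A.\<close>

lemma fourier_tendsto_integral:
  fixes w :: "real^'n \<Rightarrow> real"
  assumes w: "integrable lborel w"
  shows "(fourier w \<longlongrightarrow> of_real (LBINT x. w x)) (at 0)"
  unfolding tendsto_at_iff_sequentially comp_def
proof (intro allI impI)
  fix X :: "nat \<Rightarrow> real^'n" assume X: "X \<longlonglongrightarrow> 0"
  have [measurable]: "w \<in> borel_measurable borel"
    using borel_measurable_integrable[OF w] by simp
  have "(\<lambda>k. fourier w (X k)) \<longlonglongrightarrow> (LBINT x. of_real (w x))"
    unfolding fourier_def
  proof (rule integral_dominated_convergence[where w="\<lambda>x. \<bar>w x\<bar>"]; (measurable)?)
    have "(\<lambda>k. exp (- \<i> * of_real (x \<bullet> X k)) * of_real (w x)) \<longlonglongrightarrow> exp (- \<i> * of_real (x \<bullet> 0)) * (of_real (w x) :: complex)" for x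
      by (intro tendsto_intros X)
    then show "AE x in lborel. (\<lambda>k. exp (- \<i> * of_real (x \<bullet> X k)) * of_real (w x)) \<longlonglongrightarrow> (of_real (w x) :: complex)"
      by simp
  qed (use w in \<open>auto simp: norm_mult\<close>)
  then show "(\<lambda>k. fourier w (X k)) \<longlonglongrightarrow> of_real (LBINT x. w x)" by simp
qed

lemma nn_integral_heat_le_if_heat_decay:
  assumes "heat_decay \<beta> f \<le> ennreal \<eta>" "0 \<le> \<eta>" "0 < t"
  shows "L1_ennnorm (heat t f) \<le> ennreal (\<eta> * t powr (- (\<beta> / 2)))"
proof -
  let ?N = "Lp_norm 1 (heat t f)"
  have "ennreal (t powr (\<beta> / 2)) * ?N \<le> ennreal \<eta>"
    using assms unfolding heat_decay_def by (auto simp: SUP_le_iff)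
  then have "ennreal (t powr (- (\<beta> / 2))) * (ennreal (t powr (\<beta> / 2)) * ?N) \<le> ennreal (t powr (- (\<beta> / 2))) * ennreal \<eta>"
    by (rule mult_left_mono) simp
  also have "ennreal (t powr (- (\<beta> / 2))) * (ennreal (t powr (\<beta> / 2)) * ?N) = ?N"
    using assms(3) by (simp add: mult.assoc[symmetric] ennreal_mult[symmetric] powr_minus)
  also have "ennreal (t powr (- (\<beta> / 2))) * ennreal \<eta> = ennreal (\<eta> * t powr (- (\<beta> / 2)))"
    using assms(2) by (simp add: ennreal_mult[symmetric] mult.commute)
  finally show ?thesis by (simp add: Lp_norm_1)
qed

section \<open>Decay of the mass\<close>

context
  fixes a :: "real^'n" and \<beta> q :: real
  assumes smoothing: "\<And>r p :: ennreal. 1 \<le> r \<Longrightarrow> r \<le> p \<Longrightarrow>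
      \<exists>C::real. \<forall>u0 u. is_solution a q u0 u \<and> u0 \<in> Lp 1 \<inter> Lp r \<longrightarrow>
        (\<forall>t>0. Lp_norm p (u t) \<le>
          ennreal (C * t powr (- (real CARD('n) / 2) * (recip r - recip p))) * Lp_norm r u0)"
    and duhamel: "\<And>u0 u. u0 \<in> Lp 1 \<inter> Lp (ennreal q) \<Longrightarrow> is_solution a q u0 u \<Longrightarrow>
      mild_formula a q u0 u"
    and \<beta>: "0 < \<beta>" "\<beta> < 1" and q_gt: "q > 1 + 1 / (real CARD('n) + \<beta>)"
begin

lemma q_gt_1: "1 < q"
proof -
  have "0 < 1 / (real CARD('n) + \<beta>)" using \<beta> by (simp add: add_pos_pos)
  then show ?thesis using q_gt by linarith
qed

text \<open>Twice the surplus of the source decay over 1/2 + beta/2 when the mass decays like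
  t^(-beta/2) and the supremum like t^(-(n+beta)/2).\<close>

lemma gain_pos: "0 < (real CARD('n) + \<beta>) * (q - 1) - 1"
proof -
  have "1 / (real CARD('n) + \<beta>) < q - 1" using q_gt by simp
  then show ?thesis using \<beta> by (simp add: divide_less_eq mult.commute add_pos_pos)
qed

text \<open>The Duhamel constant at b = 1/2 + beta/2, the source rate that reproduces exactly
  t^(-beta/2); beta < 1 keeps b below 1.\<close>

definition mass_step_const :: real where
  "mass_step_const = grad_const a * beta_const (1 / 2 + \<beta> / 2)"

lemma mass_step_const_nonneg: "0 \<le> mass_step_const"
  unfolding mass_step_const_def using grad_const_nonneg[of a] beta_const_pos[of "1 / 2 + \<beta> / 2"] \<beta>
  by simp

lemma solution_measurable:
  "is_solution a q u0 u \<Longrightarrow> 0 \<le> t \<Longrightarrow> u t \<in> borel_measurable borel"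
  using borel_measurable_integrable[OF solution_integrable] by simp

text \<open>One pass through the Duhamel formula, in the shape of the hypothesis \<open>step\<close>
  of both absorption lemmas.\<close>

lemma mass_step:
  fixes u0 :: "real^'n \<Rightarrow> real"
  assumes sol: "is_solution a q u0 u" and u0: "u0 \<in> Lp 1" "u0 \<in> Lp (ennreal q)"
    and decay: "heat_decay \<beta> u0 \<le> ennreal \<eta>" "0 \<le> \<eta>" and t: "0 < t" and K: "0 \<le> K"
    and le: "\<And>\<tau>. 0 < \<tau> \<Longrightarrow> \<tau> < t \<Longrightarrow> (LBINT x. \<bar>u \<tau> x\<bar> powr q) \<le> K * \<tau> powr (- (1 / 2 + \<beta> / 2))"
  shows "L1_norm (u t) \<le> (\<eta> + mass_step_const * K) * t powr (- (\<beta> / 2))"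
proof -
  note int = solution_integrable[OF sol]
  have u0': "integrable lborel u0" using u0 by (simp add: Lp_1_iff_integrable)
  have [measurable]: "u t \<in> borel_measurable borel" "u0 \<in> borel_measurable borel"
    using borel_measurable_integrable[OF int[of t]] borel_measurable_integrable[OF u0'] t by auto
  have mild: "mild_formula a q u0 u" using duhamel sol u0 by blast
  have "(\<integral>\<^sup>+x. ennreal \<bar>u t x - heat t u0 x\<bar> \<partial>lborel)
    \<le> ennreal (grad_const a * K * beta_const (1 / 2 + \<beta> / 2) * t powr (1 / 2 - (1 / 2 + \<beta> / 2)))"
  proof (rule duhamel_L1[OF mild refl _ _ t _ _ K])
    show "((\<lambda>\<sigma>. LBINT x. \<bar>\<bar>u \<sigma> x\<bar> powr q - \<bar>u \<tau> x\<bar> powr q\<bar>) \<longlongrightarrow> 0) (at \<tau> within {0<..})" if "0 < \<tau>" for \<tau>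
      by (rule solution_powr_continuous[OF smoothing q_gt_1 sol u0' that])
    show "integrable lborel (\<lambda>x. \<bar>u \<tau> x\<bar> powr q)" if "0 < \<tau>" for \<tau>
      by (rule solution_powr_integrable[OF smoothing q_gt_1 sol u0' that])
  qed (use le \<beta> solution_measurable[OF sol] in auto)
  moreover have "L1_ennnorm (heat t u0) \<le> ennreal (\<eta> * t powr (- (\<beta> / 2)))"
    by (rule nn_integral_heat_le_if_heat_decay[OF decay t])
  moreover have "ennreal (L1_norm (u t)) \<le> (\<integral>\<^sup>+x. ennreal \<bar>u t x - heat t u0 x\<bar> \<partial>lborel) + L1_ennnorm (heat t u0)"
  proof -
    have "ennreal (L1_norm (u t)) = L1_ennnorm (u t)"
      using int[of t] t by (intro nn_integral_eq_integral[symmetric]) auto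
    also have "\<dots> \<le> (\<integral>\<^sup>+x. ennreal \<bar>u t x - heat t u0 x\<bar> + ennreal \<bar>heat t u0 x\<bar> \<partial>lborel)"
      by (intro nn_integral_mono) (simp flip: ennreal_plus)
    also have "\<dots> = (\<integral>\<^sup>+x. ennreal \<bar>u t x - heat t u0 x\<bar> \<partial>lborel) + L1_ennnorm (heat t u0)"
      by (rule nn_integral_add) measurable
    finally show ?thesis .
  qed
  ultimately have "ennreal (L1_norm (u t)) \<le>
    ennreal (grad_const a * K * beta_const (1 / 2 + \<beta> / 2) * t powr (1 / 2 - (1 / 2 + \<beta> / 2))) + ennreal (\<eta> * t powr (- (\<beta> / 2)))"
    by (meson add_mono order_trans)
  also have "\<dots> = ennreal ((\<eta> + mass_step_const * K) * t powr (- (\<beta> / 2)))"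
    using grad_const_nonneg[of a] beta_const_pos[of "1 / 2 + \<beta> / 2"] \<beta> K decay(2)
    by (subst ennreal_plus[symmetric]) (auto simp: mass_step_const_def algebra_simps)
  finally show ?thesis
    using mass_step_const_nonneg K decay(2) by (subst (asm) ennreal_le_iff) auto
qed

text \<open>The supremum bound restarts the equation at time \<open>t/2\<close>.\<close>

lemma sup_decay:
  obtains C :: real where "0 \<le> C"
    "\<And>u0 u t G. is_solution a q u0 u \<Longrightarrow> 0 < t \<Longrightarrow> L1_norm (u (t / 2)) \<le> G * (t / 2) powr (- (\<beta> / 2)) \<Longrightarrow>
      AE x in lborel. \<bar>u t x\<bar> \<le> C * G * t powr (- (real CARD('n) / 2 + \<beta> / 2))"
proof -
  obtain C :: real where C: "0 \<le> C"
    "\<And>u0 u t. is_solution a q u0 u \<Longrightarrow> integrable lborel u0 \<Longrightarrow> 0 < t \<Longrightarrow>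
        AE x in lborel. \<bar>u t x\<bar> \<le> C * t powr (- (real CARD('n) / 2)) * L1_norm u0"
    using smoothing_1_infty[OF smoothing q_gt_1] by metis
  let ?e = "real CARD('n) / 2 + \<beta> / 2"
  show ?thesis
  proof (rule that[of "C * 2 powr ?e"])
    fix u0 u t G assume sol: "is_solution a q u0 u" and t: "(0::real) < t"
      and G: "L1_norm (u (t / 2)) \<le> G * (t / 2) powr (- (\<beta> / 2))"
    have "is_solution a q (u (t / 2)) (\<lambda>s. u (t / 2 + s))"
      using t by (intro is_solution_shift[OF sol]) auto
    from C(2)[OF this solution_integrable[OF sol], of "t / 2"] t
    have "AE x in lborel. \<bar>u t x\<bar> \<le> C * (t / 2) powr (- (real CARD('n) / 2)) * L1_norm (u (t / 2))"
      by simp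
    moreover have "C * (t / 2) powr (- (real CARD('n) / 2)) * L1_norm (u (t / 2)) \<le> C * 2 powr ?e * G * t powr (- ?e)"
    proof -
      have "C * (t / 2) powr (- (real CARD('n) / 2)) * L1_norm (u (t / 2))
        \<le> C * (t / 2) powr (- (real CARD('n) / 2)) * (G * (t / 2) powr (- (\<beta> / 2)))"
        using C(1) by (intro mult_left_mono G) auto
      also have "\<dots> = C * G * (t / 2) powr (- ?e)"
      proof -
        have "(t / 2) powr (- (real CARD('n) / 2)) * (t / 2) powr (- (\<beta> / 2)) = (t / 2) powr (- ?e)"
          unfolding powr_add[symmetric] by (intro arg_cong2[where f="(powr)"] refl) simp
        then show ?thesis by (simp only: mult_ac)
      qed
      also have "(t / 2) powr (- ?e) = 2 powr ?e * t powr (- ?e)"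
        using t by (simp add: powr_divide powr_minus field_simps)
      finally show ?thesis by (simp add: mult_ac)
    qed
    ultimately show "AE x in lborel. \<bar>u t x\<bar> \<le> C * 2 powr ?e * G * t powr (- ?e)"
      by (auto elim!: eventually_mono)
  qed (use C in auto)
qed

text \<open>Without any decay of the mass, smoothing from L^1 already gives the supremum rate
  t^(-n/2). For q > 1 + 1/n the source is then a multiple of t^(-1/2-delta) times the mass, so the
  absorption is linear in the mass.\<close>

lemma mass_decay_supercritical:
  fixes u0 :: "real^'n \<Rightarrow> real"
  assumes sol: "is_solution a q u0 u" and u0: "u0 \<in> Lp 1" "u0 \<in> Lp (ennreal q)"
    and decay: "heat_decay \<beta> u0 < \<infinity>" and q: "q > 1 + 1 / real CARD('n)"
  shows "\<exists>G\<ge>0. \<forall>t>0. L1_norm (u t) \<le> G * t powr (- (\<beta> / 2))"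
proof -
  have u0': "integrable lborel u0" using u0 by (simp add: Lp_1_iff_integrable)
  obtain C :: real where C: "0 \<le> C"
    "\<And>t. 0 < t \<Longrightarrow> AE x in lborel. \<bar>u t x\<bar> \<le> C * t powr (- (real CARD('n) / 2)) * L1_norm u0"
    using smoothing_1_infty[OF smoothing q_gt_1] sol u0' by metis
  obtain C1 where C1: "\<And>t. 0 < t \<Longrightarrow> L1_norm (u t) \<le> C1 * L1_norm u0"
    using smoothing_1_1[OF smoothing q_gt_1] sol u0' by metis
  obtain P0 where P0: "0 \<le> P0" "\<And>t. 0 < t \<Longrightarrow> (LBINT x. \<bar>u t x\<bar> powr q) \<le> P0"
    using smoothing_q_q[OF smoothing q_gt_1 sol u0] by metis
  define \<eta> where "\<eta> = enn2real (heat_decay \<beta> u0)"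
  have \<eta>: "heat_decay \<beta> u0 \<le> ennreal \<eta>" "0 \<le> \<eta>"
    using decay by (simp_all add: \<eta>_def less_top)
  define m where "m = L1_norm u0"
  have m: "0 \<le> m" by (auto simp: m_def intro!: integral_nonneg_AE)
  \<comment> \<open>The surplus of n(q-1)/2 over the exponent 1/2.\<close>
  define \<delta> where "\<delta> = (real CARD('n) * (q - 1) - 1) / 2"
  have "1 / real CARD('n) < q - 1" using q by simp
  then have \<delta>: "0 < \<delta>" by (simp add: \<delta>_def divide_less_eq mult.commute)
  show ?thesis
  proof (rule absorb_linear[OF \<beta>(1) \<delta> mass_step_const_nonneg \<eta>(2) P0(1)])
    show "0 \<le> (C * m) powr (q - 1)" by simp
    show "L1_norm (u t) \<le> C1 * m" if "0 < t" for t
      unfolding m_def by (rule C1[OF that])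
    fix \<tau> :: real assume \<tau>: "0 < \<tau>"
    have "(LBINT x. \<bar>u \<tau> x\<bar> powr q) \<le> (C * \<tau> powr (- (real CARD('n) / 2)) * m) powr (q - 1) * L1_norm (u \<tau>)"
      unfolding m_def using \<tau> q_gt_1 by (intro integral_powr_le solution_integrable[OF sol] C(2)) auto
    also have "(C * \<tau> powr (- (real CARD('n) / 2)) * m) powr (q - 1) = (C * m) powr (q - 1) * \<tau> powr (- (1 / 2) - \<delta>)"
    proof -
      have "(\<tau> powr (- (real CARD('n) / 2))) powr (q - 1) = \<tau> powr (- (1 / 2) - \<delta>)"
        unfolding powr_powr by (intro arg_cong2[where f="(powr)"] refl) (simp add: \<delta>_def field_simps)
      then show ?thesis using C(1) m by (simp add: powr_mult mult_ac)
    qed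
    finally show "(LBINT x. \<bar>u \<tau> x\<bar> powr q) \<le> (C * m) powr (q - 1) * \<tau> powr (- (1 / 2) - \<delta>) * L1_norm (u \<tau>)" .
  next
    fix t K :: real assume "0 < t" "0 \<le> K"
      "\<And>\<tau>. 0 < \<tau> \<Longrightarrow> \<tau> < t \<Longrightarrow> (LBINT x. \<bar>u \<tau> x\<bar> powr q) \<le> K * \<tau> powr (- (1 / 2 + \<beta> / 2))"
    then show "L1_norm (u t) \<le> (\<eta> + mass_step_const * K) * t powr (- (\<beta> / 2))"
      by (intro mass_step[OF sol u0 \<eta>]) auto
  qed (auto intro: P0(2) integral_nonneg_AE)
qed

text \<open>The supremum rate t^(-(n+beta)/2) is available only under the assumed mass bound G, at
  the price G^(q-1); with the mass itself this makes G^q, the superlinear form. Early times use the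
  supremum bound for bounded data, so \<open>\<eta>\<close> depends on the data only through
  \<open>M\<close>.\<close>

lemma mass_decay_small:
  fixes M :: real
  shows "\<exists>\<eta>>0. \<forall>(u0 :: real^'n \<Rightarrow> real) u. is_solution a q u0 u \<longrightarrow> u0 \<in> Lp 1 \<longrightarrow> u0 \<in> Lp (ennreal q) \<longrightarrow>
    u0 \<in> Lp \<infinity> \<longrightarrow> Lp_norm \<infinity> u0 \<le> ennreal M \<longrightarrow> heat_decay \<beta> u0 < ennreal \<eta> \<longrightarrow>
    (\<forall>t>0. L1_norm (u t) \<le> 4 * \<eta> * t powr (- (\<beta> / 2)))"
proof -
  let ?e = "real CARD('n) / 2 + \<beta> / 2"
  obtain C where C: "0 \<le> C"
    "\<And>u0 u t G. is_solution a q u0 u \<Longrightarrow> 0 < t \<Longrightarrow> L1_norm (u (t / 2)) \<le> G * (t / 2) powr (- (\<beta> / 2)) \<Longrightarrow>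
      AE x in lborel. \<bar>u t x\<bar> \<le> C * G * t powr (- ?e)"
    using sup_decay by metis
  obtain C' where C': "0 \<le> C'"
    "\<And>u0 u t. is_solution a q u0 u \<Longrightarrow> u0 \<in> Lp 1 \<Longrightarrow> u0 \<in> Lp \<infinity> \<Longrightarrow> Lp_norm \<infinity> u0 \<le> ennreal M \<Longrightarrow> 0 < t \<Longrightarrow>
        AE x in lborel. \<bar>u t x\<bar> \<le> C' * \<bar>M\<bar>"
    using smoothing_infty_infty[OF smoothing q_gt_1] by metis
  define \<delta> where "\<delta> = ((real CARD('n) + \<beta>) * (q - 1) - 1) / 2"
  have \<delta>: "0 < \<delta>" using gain_pos by (simp add: \<delta>_def)
  obtain \<eta> where \<eta>: "0 < \<eta>" and absorb: "\<And>h \<phi> :: real \<Rightarrow> real.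
    continuous_on {0..} h \<longrightarrow> (\<forall>t>0. 0 \<le> h t) \<longrightarrow> (\<forall>\<tau>>0. \<phi> \<tau> \<le> (C' * \<bar>M\<bar>) powr (q - 1) * h \<tau>) \<longrightarrow>
    (\<forall>\<tau> G. 0 < \<tau> \<longrightarrow> 0 < G \<longrightarrow> (\<forall>s. 0 < s \<longrightarrow> s \<le> \<tau> \<longrightarrow> h s \<le> G * s powr (- (\<beta> / 2))) \<longrightarrow>
      \<phi> \<tau> \<le> C powr (q - 1) * G powr q * \<tau> powr (- (1 / 2 + \<beta> / 2) - \<delta>)) \<longrightarrow>
    (\<forall>t K. 0 < t \<longrightarrow> 0 \<le> K \<longrightarrow> (\<forall>\<tau>. 0 < \<tau> \<longrightarrow> \<tau> < t \<longrightarrow> \<phi> \<tau> \<le> K * \<tau> powr (- (1 / 2 + \<beta> / 2)))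
      \<longrightarrow> h t \<le> (\<eta> + mass_step_const * K) * t powr (- (\<beta> / 2))) \<longrightarrow>
    (\<forall>t>0. h t \<le> 4 * \<eta> * t powr (- (\<beta> / 2)))"
    using absorb_superlinear[OF \<beta>(1) \<delta> mass_step_const_nonneg _ _ q_gt_1, of "(C' * \<bar>M\<bar>) powr (q - 1)" "C powr (q - 1)"]
    by auto
  show ?thesis
  proof (intro exI[of _ \<eta>] conjI \<eta> allI impI)
    fix u0 :: "real^'n \<Rightarrow> real" and u :: "real \<Rightarrow> real^'n \<Rightarrow> real" and t :: real
    assume sol: "is_solution a q u0 u" and u0: "u0 \<in> Lp 1" "u0 \<in> Lp (ennreal q)"
      and inf: "u0 \<in> Lp \<infinity>" "Lp_norm \<infinity> u0 \<le> ennreal M" and decay: "heat_decay \<beta> u0 < ennreal \<eta>" and t: "0 < t"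
    let ?h = "\<lambda>t. L1_norm (u t)" and ?\<phi> = "\<lambda>t. LBINT x. \<bar>u t x\<bar> powr q"
    show "?h t \<le> 4 * \<eta> * t powr (- (\<beta> / 2))"
    proof (rule absorb[of ?h ?\<phi>, rule_format])
      show "continuous_on {0..} ?h" by (rule solution_norm_continuous[OF sol])
      show "0 \<le> ?h t" for t by (intro integral_nonneg_AE) auto
      show "?\<phi> \<tau> \<le> (C' * \<bar>M\<bar>) powr (q - 1) * ?h \<tau>" if "0 < \<tau>" for \<tau>
        using that q_gt_1 by (intro integral_powr_le solution_integrable[OF sol] C'(2)[OF sol u0(1) inf]) auto
      show "?\<phi> \<tau> \<le> C powr (q - 1) * G powr q * \<tau> powr (- (1 / 2 + \<beta> / 2) - \<delta>)"
        if \<tau>: "0 < \<tau>" and G: "0 < G" and le: "\<And>s. 0 < s \<Longrightarrow> s \<le> \<tau> \<Longrightarrow> ?h s \<le> G * s powr (- (\<beta> / 2))" for \<tau> G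
      proof -
        have "?\<phi> \<tau> \<le> (C * G * \<tau> powr (- ?e)) powr (q - 1) * ?h \<tau>"
          using \<tau> q_gt_1 le[of "\<tau> / 2"] by (intro integral_powr_le solution_integrable[OF sol] C(2)[OF sol]) auto
        also have "\<dots> \<le> (C * G * \<tau> powr (- ?e)) powr (q - 1) * (G * \<tau> powr (- (\<beta> / 2)))"
          using le[of \<tau>] \<tau> by (intro mult_left_mono) auto
        also have "\<dots> = C powr (q - 1) * (G powr (q - 1) * G) * ((\<tau> powr (- ?e)) powr (q - 1) * \<tau> powr (- (\<beta> / 2)))"
          using C(1) G by (simp add: powr_mult mult_ac)
        also have "G powr (q - 1) * G = G powr q"
          using G powr_add[of G "q - 1" 1] by simp
        also have "(\<tau> powr (- ?e)) powr (q - 1) * \<tau> powr (- (\<beta> / 2)) = \<tau> powr (- (1 / 2 + \<beta> / 2) - \<delta>)"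
          unfolding powr_powr powr_add[symmetric]
          by (intro arg_cong2[where f="(powr)"] refl) (simp add: \<delta>_def field_simps)
        finally show ?thesis .
      qed
      show "?h t \<le> (\<eta> + mass_step_const * K) * t powr (- (\<beta> / 2))"
        if "0 < t" "0 \<le> K" "\<And>\<tau>. 0 < \<tau> \<Longrightarrow> \<tau> < t \<Longrightarrow> ?\<phi> \<tau> \<le> K * \<tau> powr (- (1 / 2 + \<beta> / 2))" for t K
        using that decay \<eta> by (intro mass_step[OF sol u0 less_imp_le]) auto
      show "0 < t" by (rule t)
    qed
  qed
qed

section \<open>Decay of the Duhamel term and conclusion\<close>

text \<open>The source decays like tau^(-b) with b above 1/2 + beta/2, and the surplus delta
  survives in both norms. In the supremum bound \<open>t \<ge> 2\<close> ensures that times after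
  t/2 are at least 1, where a larger decay exponent may be weakened to b.\<close>

lemma nonlinear_decay:
  fixes u0 :: "real^'n \<Rightarrow> real"
  assumes sol: "is_solution a q u0 u" and u0: "u0 \<in> Lp 1" "u0 \<in> Lp (ennreal q)"
    and G: "0 \<le> G" "\<And>t. 0 < t \<Longrightarrow> L1_norm (u t) \<le> G * t powr (- (\<beta> / 2))"
  shows "\<exists>\<delta>>0. \<exists>C\<ge>0.
    (\<forall>t>0. (\<integral>\<^sup>+x. ennreal \<bar>u t x - heat t u0 x\<bar> \<partial>lborel) \<le> ennreal (C * t powr (- (\<beta> / 2) - \<delta>))) \<and>
    (\<forall>t\<ge>2. AE x in lborel. \<bar>u t x - heat t u0 x\<bar> \<le> C * t powr (- (real CARD('n) / 2 + \<beta> / 2) - \<delta>))"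
proof -
  let ?e = "real CARD('n) / 2 + \<beta> / 2"
  have u0': "integrable lborel u0" using u0 by (simp add: Lp_1_iff_integrable)
  note int = solution_integrable[OF sol]
  note mild = duhamel[OF IntI[OF u0] sol]
  let ?F = "\<lambda>\<tau> x. \<bar>u \<tau> x\<bar> powr q"
  have F_int: "integrable lborel (?F \<tau>)" if "0 < \<tau>" for \<tau>
    by (rule solution_powr_integrable[OF smoothing q_gt_1 sol u0' that])
  have F_cont: "((\<lambda>\<sigma>. LBINT x. \<bar>?F \<sigma> x - ?F \<tau> x\<bar>) \<longlongrightarrow> 0) (at \<tau> within {0<..})" if "0 < \<tau>" for \<tau>
    by (rule solution_powr_continuous[OF smoothing q_gt_1 sol u0' that])
  obtain C where C: "0 \<le> C" "\<And>t. 0 < t \<Longrightarrow> AE x in lborel. \<bar>u t x\<bar> \<le> C * t powr (- ?e)"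
  proof -
    obtain C where C: "0 \<le> C"
      "\<And>u0 u t G. is_solution a q u0 u \<Longrightarrow> 0 < t \<Longrightarrow> L1_norm (u (t / 2)) \<le> G * (t / 2) powr (- (\<beta> / 2)) \<Longrightarrow>
        AE x in lborel. \<bar>u t x\<bar> \<le> C * G * t powr (- ?e)"
      using sup_decay by metis
    show ?thesis
      using C(1) G by (intro that[of "C * G"] C(2)[OF sol]) auto
  qed
  obtain P0 where P0: "0 \<le> P0" "\<And>t. 0 < t \<Longrightarrow> (LBINT x. ?F t x) \<le> P0"
    using smoothing_q_q[OF smoothing q_gt_1 sol u0] by metis
  define \<delta>1 where "\<delta>1 = ((real CARD('n) + \<beta>) * (q - 1) - 1) / 2"
  \<comment> \<open>Capped by (1 - beta)/4 so that b < 1 and the Beta integral converges at time 0,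
    even if the true surplus \<open>\<delta>1\<close> is larger.\<close>
  define \<delta> where "\<delta> = min \<delta>1 ((1 - \<beta>) / 4)"
  have "0 < \<delta>1" using gain_pos by (simp add: \<delta>1_def)
  then have \<delta>: "0 < \<delta>" "\<delta> \<le> \<delta>1" "\<delta> < (1 - \<beta>) / 2"
    using \<beta> by (auto simp: \<delta>_def min_def field_simps)
  define b where "b = 1 / 2 + \<beta> / 2 + \<delta>"
  have b: "0 \<le> b" "b < 1" using \<delta> \<beta> by (auto simp: b_def)
  define K where "K = P0 + C powr (q - 1) * G"
  have K: "0 \<le> K" using P0 G by (simp add: K_def)
  \<comment> \<open>The second term accounts for the times after t/2, where the supremum of |u|^q is
    used instead of its mass.\<close>
  define K' where "K' = K + C powr q * 2 powr (real CARD('n) / 2)"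
  have K': "0 \<le> K'" using K by (simp add: K'_def)
  \<comment> \<open>For tau <= 1 the weight tau^(-b) is at least 1, so the uniform bound
    \<open>P0\<close> fits; the decay rates are used only for tau > 1.\<close>
  have \<phi>_le: "(LBINT x. ?F \<tau> x) \<le> K * \<tau> powr (- b)" if \<tau>: "0 < \<tau>" for \<tau>
  proof (cases "\<tau> \<le> 1")
    case True
    have "1 \<le> \<tau> powr (- b)"
      using True \<tau> b powr_mono2'[of "- b" \<tau> 1] by simp
    then have "P0 * 1 \<le> P0 * \<tau> powr (- b)" using P0 by (intro mult_left_mono) auto
    also have "\<dots> \<le> K * \<tau> powr (- b)"
      unfolding K_def using G by (intro mult_right_mono) auto
    finally show ?thesis using P0(2)[OF \<tau>] by simp
  next
    case False
    have "(LBINT x. ?F \<tau> x) \<le> (C * \<tau> powr (- ?e)) powr (q - 1) * L1_norm (u \<tau>)"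
      using \<tau> q_gt_1 by (intro integral_powr_le int C(2)) auto
    also have "\<dots> \<le> (C * \<tau> powr (- ?e)) powr (q - 1) * (G * \<tau> powr (- (\<beta> / 2)))"
      using G(2)[OF \<tau>] by (intro mult_left_mono) auto
    also have "\<dots> = C powr (q - 1) * G * ((\<tau> powr (- ?e)) powr (q - 1) * \<tau> powr (- (\<beta> / 2)))"
      using C(1) by (simp add: powr_mult mult_ac)
    also have "(\<tau> powr (- ?e)) powr (q - 1) * \<tau> powr (- (\<beta> / 2)) = \<tau> powr (- (1 / 2 + \<beta> / 2) - \<delta>1)"
      unfolding powr_powr powr_add[symmetric]
      by (intro arg_cong2[where f="(powr)"] refl) (simp add: \<delta>1_def field_simps)
    also have "C powr (q - 1) * G * \<tau> powr (- (1 / 2 + \<beta> / 2) - \<delta>1) \<le> C powr (q - 1) * G * \<tau> powr (- b)"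
      using False G \<delta> by (intro mult_left_mono powr_mono) (auto simp: b_def)
    also have "\<dots> \<le> K * \<tau> powr (- b)"
      unfolding K_def using P0 by (intro mult_right_mono) auto
    finally show ?thesis .
  qed
  \<comment> \<open>Two ways to gain t^(-n/2): before t/2 the kernel has spread for a time of order
    t and acts on the mass; after t/2 the heat flow does not increase the supremum of |u|^q, which
    already has this decay.\<close>
  have heat_le: "heat (2 * (t - \<tau>)) (?F \<tau>) x \<le> K' * t powr (- (real CARD('n) / 2)) * \<tau> powr (- b)"
    if t: "2 \<le> t" and \<tau>: "0 < \<tau>" "\<tau> < t" for t \<tau> x
  proof (cases "\<tau> \<le> t / 2")
    case True
    have "heat (2 * (t - \<tau>)) (?F \<tau>) x \<le> (4 * pi * (2 * (t - \<tau>))) powr (- real CARD('n) / 2) * (LBINT x. ?F \<tau> x)"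
      using abs_heat_le_integral[OF F_int[OF \<tau>(1)], of "2 * (t - \<tau>)" x] \<tau> by auto
    also have "\<dots> \<le> t powr (- real CARD('n) / 2) * (K * \<tau> powr (- b))"
    proof (rule mult_mono)
      have "t \<le> 4 * pi * (2 * (t - \<tau>))"
      proof -
        have "t \<le> 2 * (t - \<tau>)" using True by simp
        also have "\<dots> \<le> 4 * pi * (2 * (t - \<tau>))"
          using mult_right_mono[of 1 "4 * pi" "2 * (t - \<tau>)"] pi_gt3 \<tau> by simp
        finally show ?thesis .
      qed
      then show "(4 * pi * (2 * (t - \<tau>))) powr (- real CARD('n) / 2) \<le> t powr (- real CARD('n) / 2)"
        using t by (intro powr_mono2') auto
      show "(LBINT x. ?F \<tau> x) \<le> K * \<tau> powr (- b)" by (rule \<phi>_le[OF \<tau>(1)])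
    qed (auto intro!: integral_nonneg_AE)
    also have "\<dots> = K * t powr (- (real CARD('n) / 2)) * \<tau> powr (- b)" by simp
    also have "\<dots> \<le> K' * t powr (- (real CARD('n) / 2)) * \<tau> powr (- b)"
      unfolding K'_def by (intro mult_right_mono) auto
    finally show ?thesis .
  next
    case False
    have "\<bar>heat (2 * (t - \<tau>)) (?F \<tau>) x\<bar> \<le> (C * \<tau> powr (- ?e)) powr q"
    proof (rule abs_heat_le)
      show "AE x in lborel. \<bar>?F \<tau> x\<bar> \<le> (C * \<tau> powr (- ?e)) powr q"
        using C(2)[OF \<tau>(1)] by eventually_elim (use q_gt_1 in \<open>auto intro!: powr_mono2\<close>)
    qed (use \<tau> borel_measurable_integrable[OF F_int[OF \<tau>(1)]] in auto)
    also have "\<dots> = C powr q * (\<tau> powr (- (real CARD('n) / 2)) * \<tau> powr (- (1 / 2 + \<beta> / 2) - \<delta>1))"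
    proof -
      have "(\<tau> powr (- ?e)) powr q = \<tau> powr (- (real CARD('n) / 2)) * \<tau> powr (- (1 / 2 + \<beta> / 2) - \<delta>1)"
        unfolding powr_powr powr_add[symmetric]
        by (intro arg_cong2[where f="(powr)"] refl) (simp add: \<delta>1_def field_simps)
      then show ?thesis using C(1) by (simp add: powr_mult)
    qed
    also have "\<dots> \<le> C powr q * ((2 powr (real CARD('n) / 2) * t powr (- (real CARD('n) / 2))) * \<tau> powr (- b))"
    proof (intro mult_left_mono mult_mono)
      have "\<tau> powr (- (real CARD('n) / 2)) \<le> (t / 2) powr (- (real CARD('n) / 2))"
        using False t by (intro powr_mono2') auto
      also have "\<dots> = 2 powr (real CARD('n) / 2) * t powr (- (real CARD('n) / 2))"
        using t by (simp add: powr_divide powr_minus field_simps)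
      finally show "\<tau> powr (- (real CARD('n) / 2)) \<le> 2 powr (real CARD('n) / 2) * t powr (- (real CARD('n) / 2))" .
      show "\<tau> powr (- (1 / 2 + \<beta> / 2) - \<delta>1) \<le> \<tau> powr (- b)"
        using False t \<delta> by (intro powr_mono) (auto simp: b_def)
    qed auto
    also have "\<dots> = C powr q * 2 powr (real CARD('n) / 2) * t powr (- (real CARD('n) / 2)) * \<tau> powr (- b)"
      by (simp only: mult.assoc)
    also have "\<dots> \<le> K' * t powr (- (real CARD('n) / 2)) * \<tau> powr (- b)"
      unfolding K'_def using K by (intro mult_right_mono) auto
    finally show ?thesis by simp
  qed
  let ?B = "grad_const a * K * beta_const b" and ?B' = "grad_const a * K' * beta_const b"
  have B: "0 \<le> ?B" "0 \<le> ?B'"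
    using grad_const_nonneg[of a] beta_const_pos[OF b(2)] K K' by auto
  have exp: "1 / 2 - b = - (\<beta> / 2) - \<delta>" by (simp add: b_def)
  show ?thesis
  proof (rule exI[of _ \<delta>], rule conjI[OF \<delta>(1)], rule exI[of _ "?B + ?B'"], intro conjI allI impI)
    show "0 \<le> ?B + ?B'" using B by simp
    fix t :: real assume t: "0 < t"
    have "(\<integral>\<^sup>+x. ennreal \<bar>u t x - heat t u0 x\<bar> \<partial>lborel) \<le> ennreal (?B * t powr (1 / 2 - b))"
      by (rule duhamel_L1[OF mild refl _ F_int t b K F_cont \<phi>_le]) (use solution_measurable[OF sol] in auto)
    also have "\<dots> \<le> ennreal ((?B + ?B') * t powr (- (\<beta> / 2) - \<delta>))"
      unfolding exp using B by (intro ennreal_leI mult_right_mono) auto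
    finally show "(\<integral>\<^sup>+x. ennreal \<bar>u t x - heat t u0 x\<bar> \<partial>lborel) \<le> ennreal ((?B + ?B') * t powr (- (\<beta> / 2) - \<delta>))" .
  next
    fix t :: real assume t: "2 \<le> t"
    have K't: "0 \<le> K' * t powr (- (real CARD('n) / 2))" using K' by simp
    have "AE x in lborel. \<bar>u t x - heat t u0 x\<bar> \<le> grad_const a * (K' * t powr (- (real CARD('n) / 2))) * beta_const b * t powr (1 / 2 - b)"
      by (rule duhamel_sup[OF mild refl _ F_int _ b K't heat_le]) (use t solution_measurable[OF sol] in auto)
    moreover have "grad_const a * (K' * t powr (- (real CARD('n) / 2))) * beta_const b * t powr (1 / 2 - b) \<le> (?B + ?B') * t powr (- ?e - \<delta>)"
    proof -
      have "t powr (- (real CARD('n) / 2)) * t powr (1 / 2 - b) = t powr (- ?e - \<delta>)"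
        unfolding powr_add[symmetric] by (intro arg_cong2[where f="(powr)"] refl) (simp add: b_def)
      then have "grad_const a * (K' * t powr (- (real CARD('n) / 2))) * beta_const b * t powr (1 / 2 - b) = ?B' * t powr (- ?e - \<delta>)"
        by (metis mult.assoc mult.commute)
      also have "\<dots> \<le> (?B + ?B') * t powr (- ?e - \<delta>)"
        using B by (intro mult_right_mono) auto
      finally show ?thesis .
    qed
    ultimately show "AE x in lborel. \<bar>u t x - heat t u0 x\<bar> \<le> (?B + ?B') * t powr (- ?e - \<delta>)"
      by (auto elim!: eventually_mono)
  qed
qed

text \<open>The difference splits into the Duhamel term \<open>N\<close>, below the target rates by
  a factor t^(-delta), and the linear error \<open>L\<close>. They are added only in the endpoint
  norms: the supremum together with L^2 or L^1.\<close>

lemma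
  fixes u0 :: "real^'n \<Rightarrow> real"
  assumes sol: "is_solution a q u0 u" and u0: "u0 \<in> Lp 1" "u0 \<in> Lp (ennreal q)"
    and G: "0 \<le> G" "\<And>t. 0 < t \<Longrightarrow> L1_norm (u t) \<le> G * t powr (- (\<beta> / 2))"
    and bound: "\<And>\<xi>. \<xi> \<noteq> 0 \<Longrightarrow> norm (fourier u0 \<xi>) / norm \<xi> powr \<beta> \<le> B"
    and lim: "((\<lambda>\<xi>. fourier u0 \<xi> / of_real (norm \<xi> powr \<beta>)) \<longlongrightarrow> of_real A) (at 0)"
  shows asymptotics_ge_2: "\<And>p. 2 \<le> p \<Longrightarrow> asymptotic_Lp \<beta> A u p"
    and asymptotics_ge_1: "\<And>w p. is_frac_integral \<beta> u0 w \<Longrightarrow> A = (LBINT x. w x) \<Longrightarrow> 1 \<le> p \<Longrightarrow> asymptotic_Lp \<beta> A u p"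
proof -
  let ?e = "real CARD('n) / 2 + \<beta> / 2"
  have u0': "integrable lborel u0" using u0 by (simp add: Lp_1_iff_integrable)
  define N where "N t x = u t x - heat t u0 x" for t x
  define L where "L = linear_error \<beta> A u0"
  define d where "d t x = u t x - A * frac_deriv \<beta> (heat_kernel t) x" for t x
  have d_eq: "d t x = N t x + L t x" for t x by (simp add: d_def N_def L_def linear_error_def)
  obtain \<delta> C where \<delta>: "0 < \<delta>" and C: "0 \<le> C"
    and N1: "\<And>t. 0 < t \<Longrightarrow> L1_ennnorm (N t) \<le> ennreal (C * t powr (- (\<beta> / 2) - \<delta>))"
    and Nsup: "\<And>t. 2 \<le> t \<Longrightarrow> AE x in lborel. \<bar>N t x\<bar> \<le> C * t powr (- ?e - \<delta>)"
    using nonlinear_decay[OF sol u0 G] unfolding N_def by blast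
  have L_meas: "L t \<in> borel_measurable borel" if "0 < t" for t
    unfolding L_def using borel_measurable_integrable[OF integrable_linear_error[OF u0' \<beta>(1) _ that]] \<beta> by simp
  have N_meas: "N t \<in> borel_measurable borel" if "0 < t" for t
  proof -
    have [measurable]: "u t \<in> borel_measurable borel" "u0 \<in> borel_measurable borel"
      using solution_measurable[OF sol, of t] that borel_measurable_integrable[OF u0'] by auto
    show ?thesis unfolding N_def[abs_def] by measurable
  qed
  have d_meas: "d t \<in> borel_measurable borel" if "0 < t" for t
    using N_meas[OF that] L_meas[OF that] unfolding d_eq[abs_def] by measurable
  have small: "eventually (\<lambda>t. K * t powr (- \<delta>) \<le> \<epsilon>) at_top" if "0 < \<epsilon>" for K \<epsilon> :: real
  proof -
    have "((\<lambda>t. K * t powr (- \<delta>)) \<longlongrightarrow> K * 0) at_top"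
      using \<delta> by (intro tendsto_intros tendsto_neg_powr filterlim_ident) auto
    then have "eventually (\<lambda>t. K * t powr (- \<delta>) < \<epsilon>) at_top"
      using that by (intro order_tendstoD) auto
    then show ?thesis by eventually_elim simp
  qed
  have sup: "eventually (\<lambda>t. AE x in lborel. \<bar>d t x\<bar> \<le> \<epsilon> * t powr (- ?e)) at_top" if \<epsilon>: "0 < \<epsilon>" for \<epsilon>
  proof -
    have "eventually (\<lambda>t. AE x in lborel. \<bar>L t x\<bar> \<le> \<epsilon> / 2 * t powr (- ?e)) at_top"
      unfolding L_def using \<epsilon> by (intro linear_error_sup[OF \<beta> u0' bound lim]) auto
    then show ?thesis
      using small[of "\<epsilon> / 2" C, OF half_gt_zero[OF \<epsilon>]] eventually_ge_at_top[of 2]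
    proof eventually_elim
      case (elim t)
      have "C * t powr (- ?e - \<delta>) = C * t powr (- \<delta>) * t powr (- ?e)"
        by (simp flip: powr_add add: add.commute)
      also have "\<dots> \<le> \<epsilon> / 2 * t powr (- ?e)"
        using elim(2) by (rule mult_right_mono) simp
      finally have le: "C * t powr (- ?e - \<delta>) \<le> \<epsilon> / 2 * t powr (- ?e)" .
      show ?case
        using elim(1) Nsup[OF elim(3)]
      proof eventually_elim
        case (elim x)
        then show ?case using le abs_triangle_ineq[of "N t x" "L t x"] unfolding d_eq by (simp add: field_simps)
      qed
    qed
  qed
  show "asymptotic_Lp \<beta> A u p" if p: "2 \<le> p" for p
  proof (rule asymptotic_Lp_if_bounds[where r=2], unfold d_def[symmetric])
    fix \<epsilon> :: real assume \<epsilon>: "0 < \<epsilon>"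
    \<comment> \<open>One quarter, because (N + L)^2 <= 2 N^2 + 2 L^2.\<close>
    then have \<epsilon>4: "0 < \<epsilon> / 4" by simp
    have "eventually (\<lambda>t. (\<integral>\<^sup>+x. ennreal ((L t x)\<^sup>2) \<partial>lborel) \<le> ennreal (\<epsilon> / 4 * t powr (- (real CARD('n) / 2 + \<beta>)))) at_top"
      unfolding L_def using \<epsilon> by (intro linear_error_L2[OF \<beta> u0' bound lim]) auto
    then have "eventually (\<lambda>t. (\<integral>\<^sup>+x. ennreal ((d t x)\<^sup>2) \<partial>lborel) \<le> ennreal (\<epsilon> * t powr (- (real CARD('n) / 2 + \<beta>)))) at_top"
      using small[of "\<epsilon> / 4" "C\<^sup>2", OF \<epsilon>4] eventually_ge_at_top[of 2]
    proof eventually_elim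
      case (elim t)
      have t: "0 < t" "1 \<le> t" using elim by auto
      \<comment> \<open>The supremum and L^1 bounds of \<open>N\<close>. Their product bounds the
        integral of N^2 with surplus 2 delta, of which one delta gives the smallness and the other
        factor is at most 1.\<close>
      let ?Y = "C * t powr (- ?e - \<delta>)" and ?X = "C * t powr (- (\<beta> / 2) - \<delta>)"
      have "(\<integral>\<^sup>+x. ennreal ((N t x)\<^sup>2) \<partial>lborel) \<le> (\<integral>\<^sup>+x. ennreal ?Y * ennreal \<bar>N t x\<bar> \<partial>lborel)"
      proof (rule nn_integral_mono_AE)
        show "AE x in lborel. ennreal ((N t x)\<^sup>2) \<le> ennreal ?Y * ennreal \<bar>N t x\<bar>"
          using Nsup[OF elim(3)]
        proof eventually_elim
          case (elim x)
          then have "\<bar>N t x\<bar> * \<bar>N t x\<bar> \<le> ?Y * \<bar>N t x\<bar>"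
            by (rule mult_right_mono) simp
          then have "(N t x)\<^sup>2 \<le> ?Y * \<bar>N t x\<bar>"
            by (simp add: power2_eq_square)
          then show ?case using C by (simp add: ennreal_mult[symmetric] ennreal_leI)
        qed
      qed
      also have "\<dots> = ennreal ?Y * L1_ennnorm (N t)"
        using N_meas[OF t(1)] by (intro nn_integral_cmult) simp
      also have "\<dots> \<le> ennreal ?Y * ennreal ?X"
        by (intro mult_left_mono N1 t) auto
      also have "\<dots> = ennreal (C\<^sup>2 * (t powr (- \<delta>) * t powr (- \<delta>)) * t powr (- (real CARD('n) / 2 + \<beta>)))"
      proof -
        have eq: "t powr (- ?e - \<delta>) * t powr (- (\<beta> / 2) - \<delta>) = t powr (- \<delta>) * t powr (- \<delta>) * t powr (- (real CARD('n) / 2 + \<beta>))"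
          unfolding powr_add[symmetric] by (intro arg_cong2[where f="(powr)"] refl) simp
        have "?Y * ?X = C\<^sup>2 * (t powr (- ?e - \<delta>) * t powr (- (\<beta> / 2) - \<delta>))"
          by (simp only: power2_eq_square mult_ac)
        then have "?Y * ?X = C\<^sup>2 * (t powr (- \<delta>) * t powr (- \<delta>)) * t powr (- (real CARD('n) / 2 + \<beta>))"
          unfolding eq by (simp only: mult.assoc)
        then show ?thesis using C by (simp add: ennreal_mult[symmetric])
      qed
      also have "\<dots> \<le> ennreal (\<epsilon> / 4 * t powr (- (real CARD('n) / 2 + \<beta>)))"
      proof (intro ennreal_leI mult_right_mono)
        have "t powr (- \<delta>) \<le> 1" using t \<delta> powr_mono2'[of "- \<delta>" 1 t] by simp
        then have "C\<^sup>2 * (t powr (- \<delta>) * t powr (- \<delta>)) \<le> C\<^sup>2 * (t powr (- \<delta>) * 1)"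
          by (intro mult_left_mono) auto
        then show "C\<^sup>2 * (t powr (- \<delta>) * t powr (- \<delta>)) \<le> \<epsilon> / 4" using elim(2) by simp
      qed simp
      finally have N2: "(\<integral>\<^sup>+x. ennreal ((N t x)\<^sup>2) \<partial>lborel) \<le> ennreal (\<epsilon> / 4 * t powr (- (real CARD('n) / 2 + \<beta>)))" .
      have "(\<integral>\<^sup>+x. ennreal ((d t x)\<^sup>2) \<partial>lborel) \<le> (\<integral>\<^sup>+x. 2 * ennreal ((N t x)\<^sup>2) + 2 * ennreal ((L t x)\<^sup>2) \<partial>lborel)"
      proof (rule nn_integral_mono)
        fix x
        have "(d t x)\<^sup>2 \<le> 2 * (N t x)\<^sup>2 + 2 * (L t x)\<^sup>2"
          unfolding d_eq using sum_squares_bound[of "N t x" "L t x"] by (simp add: power2_sum)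
        then have "ennreal ((d t x)\<^sup>2) \<le> ennreal (2 * (N t x)\<^sup>2 + 2 * (L t x)\<^sup>2)" by (rule ennreal_leI)
        also have "\<dots> = 2 * ennreal ((N t x)\<^sup>2) + 2 * ennreal ((L t x)\<^sup>2)"
          by (simp add: ennreal_mult)
        finally show "ennreal ((d t x)\<^sup>2) \<le> 2 * ennreal ((N t x)\<^sup>2) + 2 * ennreal ((L t x)\<^sup>2)" .
      qed
      also have "\<dots> = 2 * (\<integral>\<^sup>+x. ennreal ((N t x)\<^sup>2) \<partial>lborel) + 2 * (\<integral>\<^sup>+x. ennreal ((L t x)\<^sup>2) \<partial>lborel)"
        using N_meas[OF t(1)] L_meas[OF t(1)] by (simp add: nn_integral_add nn_integral_cmult)
      also have "\<dots> \<le> 2 * ennreal (\<epsilon> / 4 * t powr (- (real CARD('n) / 2 + \<beta>))) + 2 * ennreal (\<epsilon> / 4 * t powr (- (real CARD('n) / 2 + \<beta>)))"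
        using N2 elim(1) by (intro add_mono mult_left_mono) auto
      also have "\<dots> = ennreal (\<epsilon> * t powr (- (real CARD('n) / 2 + \<beta>)))"
      proof -
        have two: "2 * ennreal z = ennreal (2 * z)" for z
          using ennreal_mult'[of 2 z] by simp
        show ?thesis
          unfolding two using \<epsilon> by (subst ennreal_plus[symmetric]) auto
      qed
      finally show ?case .
    qed
    moreover have "\<bar>d t x\<bar> powr 2 = (d t x)\<^sup>2" for t x by simp
    ultimately show "eventually (\<lambda>t. (\<integral>\<^sup>+x. ennreal (\<bar>d t x\<bar> powr 2) \<partial>lborel) \<le> ennreal (\<epsilon> * t powr (- (real CARD('n) / 2 * (2 - 1) + 2 * \<beta> / 2)))) at_top"
      by simp
  qed (use p sup d_meas in auto)
  show "asymptotic_Lp \<beta> A u p" if w: "is_frac_integral \<beta> u0 w" "A = (LBINT x. w x)" and p: "1 \<le> p" for w p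
  proof (rule asymptotic_Lp_if_bounds[where r=1], unfold d_def[symmetric])
    fix \<epsilon> :: real assume \<epsilon>: "0 < \<epsilon>"
    have "eventually (\<lambda>t. L1_ennnorm (L t) \<le> ennreal (\<epsilon> / 2 * t powr (- (\<beta> / 2)))) at_top"
      unfolding L_def using \<epsilon> by (intro linear_error_L1[OF \<beta> u0' w]) auto
    then have "eventually (\<lambda>t. L1_ennnorm (d t) \<le> ennreal (\<epsilon> * t powr (- (\<beta> / 2)))) at_top"
      using small[of "\<epsilon> / 2" C, OF half_gt_zero[OF \<epsilon>]] eventually_gt_at_top[of 0]
    proof eventually_elim
      case (elim t)
      have "L1_ennnorm (d t) \<le> (\<integral>\<^sup>+x. ennreal \<bar>N t x\<bar> + ennreal \<bar>L t x\<bar> \<partial>lborel)"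
        unfolding d_eq by (intro nn_integral_mono) (simp flip: ennreal_plus)
      also have "\<dots> = L1_ennnorm (N t) + L1_ennnorm (L t)"
        using N_meas[OF elim(3)] L_meas[OF elim(3)] by (intro nn_integral_add) auto
      also have "L1_ennnorm (N t) \<le> ennreal (\<epsilon> / 2 * t powr (- (\<beta> / 2)))"
      proof (rule order_trans[OF N1[OF elim(3)] ennreal_leI])
        have "t powr (- (\<beta> / 2) - \<delta>) = t powr (- \<delta>) * t powr (- (\<beta> / 2))"
          unfolding powr_add[symmetric] by (intro arg_cong2[where f="(powr)"] refl) simp
        then have "C * t powr (- (\<beta> / 2) - \<delta>) = C * t powr (- \<delta>) * t powr (- (\<beta> / 2))"
          by (simp only: mult.assoc)
        also have "\<dots> \<le> \<epsilon> / 2 * t powr (- (\<beta> / 2))"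
          using elim(2) by (rule mult_right_mono) simp
        finally show "C * t powr (- (\<beta> / 2) - \<delta>) \<le> \<epsilon> / 2 * t powr (- (\<beta> / 2))" .
      qed
      also note elim(1)
      also have "ennreal (\<epsilon> / 2 * t powr (- (\<beta> / 2))) + ennreal (\<epsilon> / 2 * t powr (- (\<beta> / 2))) = ennreal (\<epsilon> * t powr (- (\<beta> / 2)))"
        using \<epsilon> by (subst ennreal_plus[symmetric]) auto
      finally show ?case by (simp add: add_mono)
    qed
    then show "eventually (\<lambda>t. (\<integral>\<^sup>+x. ennreal (\<bar>d t x\<bar> powr 1) \<partial>lborel) \<le> ennreal (\<epsilon> * t powr (- (real CARD('n) / 2 * (1 - 1) + 1 * \<beta> / 2)))) at_top"
      by simp
  qed (use p sup d_meas in auto)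
qed

end

text \<open>\<open>M\<close> is quantified before \<open>\<eta>\<close>, and the data after it, to
  express that the smallness threshold depends on the data only through a bound on the supremum
  norm. In the integrable case the limit of the quotient belongs to the conclusion, since A enters
  there as an integral.\<close>

theorem corollary2p2:
  fixes a :: "real^'n" and \<beta> q :: real
  assumes smoothing: "\<And>r p :: ennreal. 1 \<le> r \<Longrightarrow> r \<le> p \<Longrightarrow>
      \<exists>C::real. \<forall>u0 u. is_solution a q u0 u \<and> u0 \<in> Lp 1 \<inter> Lp r \<longrightarrow>
        (\<forall>t>0. Lp_norm p (u t) \<le>
          ennreal (C * t powr (- (real CARD('n) / 2) * (recip r - recip p))) * Lp_norm r u0)"
    and duhamel: "\<And>u0 u. u0 \<in> Lp 1 \<inter> Lp (ennreal q) \<Longrightarrow> is_solution a q u0 u \<Longrightarrow>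
      mild_formula a q u0 u"
    and "0 < \<beta>" "\<beta> < 1" and "q > 1 + 1 / (real CARD('n) + \<beta>)"
  shows "\<forall>M::real. \<exists>\<eta>>0. \<forall>u0 u.
    u0 \<in> Lp 1 \<inter> Lp (ennreal q) \<and> heat_decay \<beta> u0 < \<infinity> \<and>
    (q \<le> 1 + 1 / real CARD('n) \<longrightarrow>
      u0 \<in> Lp \<infinity> \<and> Lp_norm \<infinity> u0 \<le> ennreal M \<and> heat_decay \<beta> u0 < ennreal \<eta>) \<and>
    is_solution a q u0 u \<longrightarrow>
      (\<forall>w A. is_frac_integral \<beta> u0 w \<and> A = (\<integral>x. w x \<partial>lborel) \<longrightarrow>
        ((\<lambda>\<xi>. fourier u0 \<xi> / of_real (norm \<xi> powr \<beta>)) \<longlongrightarrow> of_real A) (at 0) \<and>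
        (\<forall>p. 1 \<le> p \<longrightarrow> asymptotic_Lp \<beta> A u p)) \<and>
      (\<forall>A::real.
        bdd_above ((\<lambda>\<xi>. norm (fourier u0 \<xi>) / norm \<xi> powr \<beta>) ` (UNIV - {0})) \<and>
        ((\<lambda>\<xi>. fourier u0 \<xi> / of_real (norm \<xi> powr \<beta>)) \<longlongrightarrow> of_real A) (at 0) \<longrightarrow>
        (\<forall>p. 2 \<le> p \<longrightarrow> asymptotic_Lp \<beta> A u p))"
proof (rule allI, goal_cases)
  case (1 M)
  note hyps = smoothing duhamel assms(3-5)
  obtain \<eta> where \<eta>: "0 < \<eta>" and small: "\<And>(u0 :: real^'n \<Rightarrow> real) u. is_solution a q u0 u \<Longrightarrow> u0 \<in> Lp 1 \<Longrightarrow> u0 \<in> Lp (ennreal q) \<Longrightarrow>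
    u0 \<in> Lp \<infinity> \<Longrightarrow> Lp_norm \<infinity> u0 \<le> ennreal M \<Longrightarrow> heat_decay \<beta> u0 < ennreal \<eta> \<Longrightarrow>
    (\<forall>t>0. (\<integral>x. \<bar>u t x\<bar> \<partial>lborel) \<le> 4 * \<eta> * t powr (- (\<beta> / 2)))"
    using mass_decay_small[OF hyps, of M] by blast
  show ?case
  proof (intro exI[of _ \<eta>] conjI[OF \<eta>] allI impI, elim conjE, goal_cases)
    case (1 u0 u)
    then have sol: "is_solution a q u0 u" and u0: "u0 \<in> Lp 1" "u0 \<in> Lp (ennreal q)"
      and decay: "heat_decay \<beta> u0 < \<infinity>"
      and crit: "q \<le> 1 + 1 / real CARD('n) \<longrightarrow>
        u0 \<in> Lp \<infinity> \<and> Lp_norm \<infinity> u0 \<le> ennreal M \<and> heat_decay \<beta> u0 < ennreal \<eta>"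
      by blast+
    \<comment> \<open>The two ranges of q differ only here: both yield mass decay like t^(-beta/2),
      from which all later estimates start.\<close>
    obtain G where G: "0 \<le> G" "\<And>t. 0 < t \<Longrightarrow> (\<integral>x. \<bar>u t x\<bar> \<partial>lborel) \<le> G * t powr (- (\<beta> / 2))"
    proof (cases "q \<le> 1 + 1 / real CARD('n)")
      case True
      then show ?thesis
        using crit \<eta> small[OF sol u0] by (intro that[of "4 * \<eta>"]) auto
    next
      case False
      then show ?thesis
        using mass_decay_supercritical[OF hyps sol u0 decay] that by auto
    qed
    show ?case
    proof (intro conjI allI impI; elim conjE)
      fix w :: "real^'n \<Rightarrow> real" and A
      assume w: "is_frac_integral \<beta> u0 w" and A: "A = (\<integral>x. w x \<partial>lborel)"
      then have intw: "integrable lborel w"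
        and fw: "\<And>\<xi>. \<xi> \<noteq> 0 \<Longrightarrow> fourier w \<xi> = fourier u0 \<xi> / of_real (norm \<xi> powr \<beta>)"
        by (auto simp: is_frac_integral_def Lp_1_iff_integrable)
      show lim: "((\<lambda>\<xi>. fourier u0 \<xi> / of_real (norm \<xi> powr \<beta>)) \<longlongrightarrow> of_real A) (at 0)"
        using fourier_tendsto_integral[OF intw] unfolding A
        by (rule Lim_transform_eventually) (auto simp: eventually_at fw intro!: exI[of _ 1])
      \<comment> \<open>The L^1 norm of \<open>w\<close> bounds the quotient, so the supremum
        estimate in frequency space is available in case (a) as well.\<close>
      have bound: "norm (fourier u0 \<xi>) / norm \<xi> powr \<beta> \<le> (\<integral>x. \<bar>w x\<bar> \<partial>lborel)" if "\<xi> \<noteq> 0" for \<xi>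
        using norm_fourier_le[OF intw, of \<xi>] fw[OF that] by (simp add: norm_divide)
      fix p :: ennreal assume p: "1 \<le> p"
      show "asymptotic_Lp \<beta> A u p"
        by (rule asymptotics_ge_1[OF hyps sol u0 G bound lim w A p])
    next
      fix A :: real and p :: ennreal
      assume bdd: "bdd_above ((\<lambda>\<xi>. norm (fourier u0 \<xi>) / norm \<xi> powr \<beta>) ` (UNIV - {0}))"
        and lim: "((\<lambda>\<xi>. fourier u0 \<xi> / of_real (norm \<xi> powr \<beta>)) \<longlongrightarrow> of_real A) (at 0)" and p: "2 \<le> p"
      obtain B where bound: "\<And>\<xi>. \<xi> \<noteq> 0 \<Longrightarrow> norm (fourier u0 \<xi>) / norm \<xi> powr \<beta> \<le> B"
        using bdd unfolding bdd_above_def by auto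
      show "asymptotic_Lp \<beta> A u p"
        by (rule asymptotics_ge_2[OF hyps sol u0 G bound lim p])
    qed
  qed
qed

end
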